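(* Let $(X,\mu,T)$ be an ergodic $\mathbb{G}$-TDS. Then $H_{ap}=H_{ms}^c=H_{me}$ as subsets of $L^2(X,\mu)$, where $H_{ap}$ is the set of almost periodic functions, $H_{ms}^c$ is the complement in $L^2(X,\mu)$ of the set $H_{ms}$ of $\mu$-mean sensitive functions, and $H_{me}$ is the set of $\mu$-mean equicontinuous functions.
   Context: $\mathbb{G}$ is a locally compact abelian group (written additively, identity $e$) with Haar measure $\nu$. A Følner sequence is a sequence $(F_n)_{n\in\mathbb{N}}$ of measurable subsets of $\mathbb{G}$ with $0<\nu(F_n)<\infty$ and $\nu((g+F_n)\triangle F_n)/\nu(F_n)\to 0$ for every $g\in\mathbb{G}$. A Følner sequence $(F_n)$ is fixed that satisfies the pointwise ergodic theorem: for every ergodic measure preserving $\mathbb{G}$-action $T$ on a standard probability space $(X,\mu)$ and every $f\in L^1(X,\mu)$, for $\mu$-a.e. $x$, $\frac{1}{\nu(F_n)}\int_{F_n} f(T^jx)\,d\nu(j)\to\int f\,d\mu$; a point $x$ at which this convergence holds is called generic for $f$. The upper density of $S\subset\mathbb{G}$ is $\overline{D}(S)=\limsup_n \nu(S\cap F_n)/\nu(F_n)$. A $\mathbb{G}$-TDS is a pair $(X,T)$ with $X$ a compact metric space (metric $d$) and $T:\mathbb{G}\times X\to X$, $(j,x)\mapsto T^jx$, a group action (jointly Borel measurable) with each $T^j:X\to X$ continuous. An ergodic $\mathbb{G}$-TDS $(X,\mu,T)$ is a $\mathbb{G}$-TDS with a Borel probability measure $\mu$ that is invariant under every $T^j$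 and ergodic. $L^2(X,\mu)$ consists of complex-valued functions, and $U^jf=f\circ T^j$. $f\in L^2(X,\mu)$ is almost periodic if the closure of $\{U^jf:j\in\mathbb{G}\}$ in $L^2(X,\mu)$ is compact. For $f\in L^2(X,\mu)$ (a fixed representative) define $d_f(x,y)=\limsup_n\left(\frac{1}{\nu(F_n)}\int_{F_n}|f(T^jx)-f(T^jy)|^2d\nu(j)\right)^{1/2}$; whenever $d_f$ is used, only points generic for $|f|^2$ (a set of full measure) are considered. $f$ is $\mu$-mean sensitive if there is $\varepsilon>0$ such that for every measurable $A$ with $\mu(A)>0$ there exist $x,y\in A$ with $d_f(x,y)>\varepsilon$. Define $\rho_f(x,y)=\inf\{\varepsilon>0:\overline{D}(\{i\in\mathbb{G}:|f(T^ix)-f(T^iy)|>\varepsilon\})<\varepsilon\}$. $f$ is $\mu$-mean equicontinuous if for every $\tau>0$ there is a compact $M\subset X$ with $\mu(M)\ge1-\tau$ such that for every $\varepsilon>0$ there is $\delta>0$ such that $x,y\in M$ and $d(x,y)\le\delta$ imply $\rho_f(x,y)\le\varepsilon$. *)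

theory Defs
  imports "HOL-Probability.Probability"
begin

definition haar_measure :: "'g::{topological_ab_group_add,t2_space} measure \<Rightarrow> bool" where
  "haar_measure \<nu> \<longleftrightarrow>
     sets \<nu> = sets borel \<and>
     emeasure \<nu> UNIV \<noteq> 0 \<and>
     (\<forall>K. compact K \<longrightarrow> emeasure \<nu> K < \<infinity>) \<and>
     (\<forall>g. \<forall>A\<in>sets borel. emeasure \<nu> ((+) g ` A) = emeasure \<nu> A) \<and>
     (\<forall>A\<in>sets borel. emeasure \<nu> A = (INF U\<in>{U. open U \<and> A \<subseteq> U}. emeasure \<nu> U)) \<and>
     (\<forall>U. open U \<longrightarrow> emeasure \<nu> U = (SUP K\<in>{K. compact K \<and> K \<subseteq> U}. emeasure \<nu> K))"

definition folner_sequence ::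
  "'g::{topological_ab_group_add,t2_space} measure \<Rightarrow> (nat \<Rightarrow> 'g set) \<Rightarrow> bool" where
  "folner_sequence \<nu> F \<longleftrightarrow>
     (\<forall>n. F n \<in> sets \<nu> \<and> 0 < emeasure \<nu> (F n) \<and> emeasure \<nu> (F n) < \<infinity>) \<and>
     (\<forall>g. (\<lambda>n. measure \<nu> (sym_diff ((+) g ` F n) (F n)) / measure \<nu> (F n)) \<longlonglongrightarrow> 0)"

definition folner_average ::
  "'g measure \<Rightarrow> (nat \<Rightarrow> 'g set) \<Rightarrow> nat \<Rightarrow> ('g \<Rightarrow> 'b::{banach,second_countable_topology}) \<Rightarrow> 'b" where
  "folner_average \<nu> F n h = (1 / measure \<nu> (F n)) *\<^sub>R (LINT j:F n|\<nu>. h j)"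

definition upper_density :: "'g measure \<Rightarrow> (nat \<Rightarrow> 'g set) \<Rightarrow> 'g set \<Rightarrow> ereal" where
  "upper_density \<nu> F S = limsup (\<lambda>n. ereal (measure \<nu> (S \<inter> F n) / measure \<nu> (F n)))"

definition measure_preserving_action ::
  "'x measure \<Rightarrow> ('g::topological_ab_group_add \<Rightarrow> 'x \<Rightarrow> 'x) \<Rightarrow> bool" where
  "measure_preserving_action M T \<longleftrightarrow>
     (\<forall>x\<in>space M. T 0 x = x) \<and>
     (\<forall>g h. \<forall>x\<in>space M. T (g + h) x = T g (T h x)) \<and>
     (\<lambda>(j, x). T j x) \<in> borel \<Otimes>\<^sub>M M \<rightarrow>\<^sub>M M \<and>
     (\<forall>j. \<forall>A\<in>sets M. emeasure M (T j -` A \<inter> space M) = emeasure M A)"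

definition ergodic_action ::
  "'x measure \<Rightarrow> ('g::topological_ab_group_add \<Rightarrow> 'x \<Rightarrow> 'x) \<Rightarrow> bool" where
  "ergodic_action M T \<longleftrightarrow>
     measure_preserving_action M T \<and>
     (\<forall>A\<in>sets M. (\<forall>j. T j -` A \<inter> space M = A) \<longrightarrow> measure M A = 0 \<or> measure M A = 1)"

definition standard_prob_space :: "'x measure \<Rightarrow> bool" where
  "standard_prob_space M \<longleftrightarrow>
     prob_space M \<and>
     (\<exists>\<tau>. completely_metrizable_space \<tau> \<and> second_countable \<tau> \<and> topspace \<tau> = space M \<and>
          sets M = sigma_sets (space M) {U. openin \<tau> U})"

text \<open>The Bochner integral of a non-integrable function is 0, so a convergence statement
  about averages has to require that the averages exist.\<close>

definition generic ::
  "'g measure \<Rightarrow> (nat \<Rightarrow> 'g set) \<Rightarrow> 'x measure \<Rightarrow> ('g \<Rightarrow> 'x \<Rightarrow> 'x) \<Rightarrow>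
   ('x \<Rightarrow> 'b::{banach,second_countable_topology}) \<Rightarrow> 'x \<Rightarrow> bool" where
  "generic \<nu> F M T f x \<longleftrightarrow>
     (\<forall>\<^sub>F n in sequentially. set_integrable \<nu> (F n) (\<lambda>j. f (T j x))) \<and>
     (\<lambda>n. folner_average \<nu> F n (\<lambda>j. f (T j x))) \<longlonglongrightarrow> (\<integral>y. f y \<partial>M)"

text \<open>HOL cannot quantify over all types inside a formula. Every standard Borel space has at
  most the cardinality of the continuum, hence is isomorphic to one whose underlying set is a
  set of reals. The space of \<^term>\<open>M\<close> and its Polish topology are arbitrary here
  and need not be related to the topology of the reals, so no generality is lost.\<close>

definition satisfies_pointwise_ergodic ::
  "'g::topological_ab_group_add measure \<Rightarrow> (nat \<Rightarrow> 'g set) \<Rightarrow> bool" where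
  "satisfies_pointwise_ergodic \<nu> F \<longleftrightarrow>
     (\<forall>(M :: real measure) (T :: 'g \<Rightarrow> real \<Rightarrow> real) (f :: real \<Rightarrow> complex).
        standard_prob_space M \<longrightarrow> ergodic_action M T \<longrightarrow> integrable M f \<longrightarrow>
        (AE x in M. generic \<nu> F M T f x))"

text \<open>The phase space is the whole type. As it is second countable, the product
  sigma-algebra in \<^const>\<open>measure_preserving_action\<close> is the Borel sigma-algebra of the
  product of the group with the phase space.\<close>

definition ergodic_tds ::
  "'x::metric_space measure \<Rightarrow> ('g::topological_ab_group_add \<Rightarrow> 'x \<Rightarrow> 'x) \<Rightarrow> bool" where
  "ergodic_tds \<mu> T \<longleftrightarrow>
     compact (UNIV :: 'x set) \<and>
     sets \<mu> = sets borel \<and> prob_space \<mu> \<and>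
     (\<forall>j. continuous_on UNIV (T j)) \<and>
     ergodic_action \<mu> T"

text \<open>\<open>L2_fun \<mu>\<close> consists of functions (representatives), \<open>L2_space \<mu>\<close> of their classes
  modulo equality almost everywhere. The latter carries the metric of \<open>L\<^sup>2\<close>; the integral
  does not depend on the chosen representatives.\<close>

definition L2_fun :: "'x measure \<Rightarrow> ('x \<Rightarrow> complex) set" where
  "L2_fun \<mu> = {f \<in> borel_measurable \<mu>. integrable \<mu> (\<lambda>x. (cmod (f x))\<^sup>2)}"

definition L2_class :: "'x measure \<Rightarrow> ('x \<Rightarrow> complex) \<Rightarrow> ('x \<Rightarrow> complex) set" where
  "L2_class \<mu> f = {g \<in> L2_fun \<mu>. AE x in \<mu>. g x = f x}"

definition L2_space :: "'x measure \<Rightarrow> ('x \<Rightarrow> complex) set set" where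
  "L2_space \<mu> = L2_class \<mu> ` L2_fun \<mu>"

definition L2_dist :: "'x measure \<Rightarrow> ('x \<Rightarrow> complex) set \<Rightarrow> ('x \<Rightarrow> complex) set \<Rightarrow> real" where
  "L2_dist \<mu> P Q = sqrt (\<integral>x. (cmod ((SOME f. f \<in> P) x - (SOME g. g \<in> Q) x))\<^sup>2 \<partial>\<mu>)"

definition L2_topology :: "'x measure \<Rightarrow> ('x \<Rightarrow> complex) set topology" where
  "L2_topology \<mu> = Metric_space.mtopology (L2_space \<mu>) (L2_dist \<mu>)"

definition almost_periodic :: "'x measure \<Rightarrow> ('g \<Rightarrow> 'x \<Rightarrow> 'x) \<Rightarrow> ('x \<Rightarrow> complex) \<Rightarrow> bool" where
  "almost_periodic \<mu> T f \<longleftrightarrow>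
     compactin (L2_topology \<mu>)
       (L2_topology \<mu> closure_of (range (\<lambda>j. L2_class \<mu> (f \<circ> T j))))"

definition d_fun ::
  "'g measure \<Rightarrow> (nat \<Rightarrow> 'g set) \<Rightarrow> ('g \<Rightarrow> 'x \<Rightarrow> 'x) \<Rightarrow> ('x \<Rightarrow> complex) \<Rightarrow> 'x \<Rightarrow> 'x \<Rightarrow> ereal" where
  "d_fun \<nu> F T f x y =
     limsup (\<lambda>n. ereal (sqrt (folner_average \<nu> F n (\<lambda>j. (cmod (f (T j x) - f (T j y)))\<^sup>2))))"

definition mean_sensitive ::
  "'g measure \<Rightarrow> (nat \<Rightarrow> 'g set) \<Rightarrow> 'x measure \<Rightarrow> ('g \<Rightarrow> 'x \<Rightarrow> 'x) \<Rightarrow> ('x \<Rightarrow> complex) \<Rightarrow> bool" where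
  "mean_sensitive \<nu> F \<mu> T f \<longleftrightarrow>
     (\<exists>\<epsilon>::real. \<epsilon> > 0 \<and>
       (\<forall>A\<in>sets \<mu>. measure \<mu> A > 0 \<longrightarrow>
         (\<exists>x\<in>A. \<exists>y\<in>A.
            generic \<nu> F \<mu> T (\<lambda>z. (cmod (f z))\<^sup>2) x \<and>
            generic \<nu> F \<mu> T (\<lambda>z. (cmod (f z))\<^sup>2) y \<and>
            d_fun \<nu> F T f x y > ereal \<epsilon>)))"

definition rho_fun ::
  "'g measure \<Rightarrow> (nat \<Rightarrow> 'g set) \<Rightarrow> ('g \<Rightarrow> 'x \<Rightarrow> 'x) \<Rightarrow> ('x \<Rightarrow> complex) \<Rightarrow> 'x \<Rightarrow> 'x \<Rightarrow> real" where
  "rho_fun \<nu> F T f x y =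
     Inf {\<epsilon>. \<epsilon> > 0 \<and> upper_density \<nu> F {i. cmod (f (T i x) - f (T i y)) > \<epsilon>} < ereal \<epsilon>}"

definition mean_equicontinuous ::
  "'g measure \<Rightarrow> (nat \<Rightarrow> 'g set) \<Rightarrow> 'x::metric_space measure \<Rightarrow> ('g \<Rightarrow> 'x \<Rightarrow> 'x) \<Rightarrow>
   ('x \<Rightarrow> complex) \<Rightarrow> bool" where
  "mean_equicontinuous \<nu> F \<mu> T f \<longleftrightarrow>
     (\<forall>\<tau>>0. \<exists>M. compact M \<and> measure \<mu> M \<ge> 1 - \<tau> \<and>
        (\<forall>\<epsilon>>0. \<exists>\<delta>>0. \<forall>x\<in>M. \<forall>y\<in>M. dist x y \<le> \<delta> \<longrightarrow> rho_fun \<nu> F T f x y \<le> \<epsilon>))"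

text \<open>All three sets are sets of representatives. Equality for every representative
  includes the equality of the corresponding sets of classes.\<close>

definition H_ap :: "'x measure \<Rightarrow> ('g \<Rightarrow> 'x \<Rightarrow> 'x) \<Rightarrow> ('x \<Rightarrow> complex) set" where
  "H_ap \<mu> T = {f \<in> L2_fun \<mu>. almost_periodic \<mu> T f}"

definition H_ms ::
  "'g measure \<Rightarrow> (nat \<Rightarrow> 'g set) \<Rightarrow> 'x measure \<Rightarrow> ('g \<Rightarrow> 'x \<Rightarrow> 'x) \<Rightarrow> ('x \<Rightarrow> complex) set" where
  "H_ms \<nu> F \<mu> T = {f \<in> L2_fun \<mu>. mean_sensitive \<nu> F \<mu> T f}"

definition H_me ::
  "'g measure \<Rightarrow> (nat \<Rightarrow> 'g set) \<Rightarrow> 'x::metric_space measure \<Rightarrow> ('g \<Rightarrow> 'x \<Rightarrow> 'x) \<Rightarrow>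
   ('x \<Rightarrow> complex) set" where
  "H_me \<nu> F \<mu> T = {f \<in> L2_fun \<mu>. mean_equicontinuous \<nu> F \<mu> T f}"

end

theory Submission
  imports Defs
begin

text \<open>
  Each property implies the next along almost periodic, mean equicontinuous, not mean sensitive,
  almost periodic. Almost periodicity means that the orbit of \<open>f\<close> is totally bounded in \<open>L\<^sup>2\<close>.

  If \<open>f\<close> is not mean sensitive, take \<open>A\<close> of positive measure on which \<open>d_f \<le> \<epsilon>\<close>. Whenever
  \<open>T\<^sup>h x\<close> and \<open>T\<^sup>k x\<close> both lie in \<open>A\<close>, the ergodic theorem for \<open>|U\<^sup>h f - U\<^sup>k f|\<^sup>2\<close> gives
  \<open>\<parallel>U\<^sup>h f - U\<^sup>k f\<parallel> = d_f (T\<^sup>h x, T\<^sup>k x) \<le> \<epsilon>\<close>. So an \<open>\<epsilon>\<close>-separated set of translates of \<open>f\<close> makes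
  the corresponding preimages of \<open>A\<close> almost disjoint, and has at most \<open>1 / \<mu> A\<close> elements.

  If the orbit of \<open>f\<close> is totally bounded, weighted averages of \<open>f (T\<^sup>j x)\<close> over those \<open>j\<close> with
  \<open>U\<^sup>j f\<close> close to \<open>f\<close> have a limit point \<open>h\<close> that is close to a multiple of \<open>f\<close> and satisfies,
  almost everywhere, \<open>|h (T\<^sup>j x) - h (T\<^sup>k x)| \<le> C \<parallel>U\<^sup>j f - U\<^sup>k f\<parallel>\<close>. Hence the values of \<open>h\<close> along the orbit
  of \<open>x\<close> are determined, up to a small error, by finitely many of them. Rounding those gives a countable
  measurable partition on whose pieces the mean distance of orbits is small, and by Lusin's theorem the
  partition is locally constant on a compact set of measure close to 1.
\<close>

section \<open>Ergodic averages and separated orbits\<close>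

text \<open>Total boundedness of the orbit of \<open>f\<close> in \<open>L\<^sup>2\<close> says
  nothing about \<open>f\<close> along the orbit of a single point, and an almost-everywhere
  statement about translates has an exceptional set depending on the translates, of which there may
  be uncountably many. The average \<open>h\<close> removes the first obstacle. By asymptotic
  invariance, its value at \<open>T k x\<close> is an average of the fixed function
  \<open>f (T i x)\<close> of \<open>i\<close> against a translated weight. Going from
  \<open>k\<close> to \<open>j\<close> changes only the weight, which is Lipschitz for the distance
  of translates of \<open>f\<close>. The constant in the resulting modulus needs a bound on
  \<open>f\<close>, so the argument is run for bounded real functions and in the
  \<open>L\<^sup>1\<close> norm, which truncation respects. The ergodic theorem does not give
  convergence of these weighted averages, as the weight lives on the group; total boundedness gives
  it along a subsequence. Fubini's theorem removes the second obstacle: orbits are compared only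
  through integrals over countably many probability measures on the group. Lusin's theorem is
  applied to the codes, since continuity of \<open>f\<close> on a compact set would not control
  orbits.\<close>

lemma norm_diff_square_le:
  fixes a b :: "'b::real_normed_vector"
  shows "(norm (a - b))\<^sup>2 \<le> 2 * (norm a)\<^sup>2 + 2 * (norm b)\<^sup>2"
proof -
  have "(norm (a - b))\<^sup>2 \<le> (norm a + norm b)\<^sup>2"
    by (simp add: norm_triangle_ineq4 power_mono)
  also have "\<dots> \<le> 2 * (norm a)\<^sup>2 + 2 * (norm b)\<^sup>2"
    using sum_squares_bound[of "norm a" "norm b"] by (simp add: power2_sum)
  finally show ?thesis .
qed

lemma integrable_norm_diff_square:
  fixes f g :: "'a \<Rightarrow> 'b::{banach, second_countable_topology}"
  assumes [measurable]: "f \<in> borel_measurable M" "g \<in> borel_measurable M"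
    and "integrable M (\<lambda>x. (norm (f x))\<^sup>2)" "integrable M (\<lambda>x. (norm (g x))\<^sup>2)"
  shows "integrable M (\<lambda>x. (norm (f x - g x))\<^sup>2)"
proof (rule Bochner_Integration.integrable_bound)
  show "integrable M (\<lambda>x. 2 * (norm (f x))\<^sup>2 + 2 * (norm (g x))\<^sup>2)"
    using assms by simp
  show "AE x in M. norm ((norm (f x - g x))\<^sup>2) \<le> norm (2 * (norm (f x))\<^sup>2 + 2 * (norm (g x))\<^sup>2)"
    using norm_diff_square_le[of "f _" "g _"] by simp
qed measurable

text \<open>Here \<open>P n\<close> plays the role of normalized Haar measure on the
  \<open>n\<close>-th Folner set. Of Haar measure and the Folner property only asymptotic invariance
  is kept. Eventual integrability is part of the ergodic theorem because an integral that does not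
  exist has the value 0.\<close>

locale folner_ergodic = prob_space M
  for M :: "'x measure" +
  fixes P :: "nat \<Rightarrow> 'g::topological_ab_group_add measure"
    and T :: "'g \<Rightarrow> 'x \<Rightarrow> 'x"
  assumes prob_space_P: "prob_space (P n)"
    and sets_P [measurable_cong]: "sets (P n) = sets borel"
    and space_M [simp]: "space M = UNIV"
    and T_zero [simp]: "T 0 x = x"
    and T_plus: "T (g + h) x = T g (T h x)"
    and T_measurable2: "(\<lambda>(j, x). T j x) \<in> borel \<Otimes>\<^sub>M M \<rightarrow>\<^sub>M M"
    and distr_T: "distr M M (T j) = M"
    and asymptotically_invariant:
      "\<phi> \<in> borel_measurable borel \<Longrightarrow> (\<And>j. \<bar>\<phi> j\<bar> \<le> (B :: real)) \<Longrightarrow>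
        (\<lambda>n. (\<integral>j. \<phi> (g + j) \<partial>P n) - (\<integral>j. \<phi> j \<partial>P n)) \<longlonglongrightarrow> 0"
    and pointwise_ergodic:
      "integrable M f \<Longrightarrow> AE x in M.
        (\<forall>\<^sub>F n in sequentially. integrable (P n) (\<lambda>j. f (T j x))) \<and>
        (\<lambda>n. (\<integral>j. f (T j x) \<partial>P n) :: real) \<longlonglongrightarrow> (\<integral>y. f y \<partial>M)"
begin

lemma space_P [simp]: "space (P n) = UNIV"
  using sets_eq_imp_space_eq[OF sets_P] by simp

lemma measurable_T [measurable (raw)]:
  assumes "a \<in> N \<rightarrow>\<^sub>M borel" "u \<in> N \<rightarrow>\<^sub>M M"
  shows "(\<lambda>z. T (a z) (u z)) \<in> N \<rightarrow>\<^sub>M M"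
  using measurable_compose[OF measurable_Pair[OF assms] T_measurable2] by simp

lemma T_commute: "T g (T h x) = T h (T g x)"
  by (metis T_plus add.commute)

lemma integrable_T_iff:
  fixes f :: "'x \<Rightarrow> 'b::{banach, second_countable_topology}"
  assumes "f \<in> borel_measurable M"
  shows "integrable M (\<lambda>x. f (T j x)) \<longleftrightarrow> integrable M f"
  using integrable_distr_eq[of "T j" M M f] assms by (simp add: distr_T)

lemma integral_T:
  fixes f :: "'x \<Rightarrow> 'b::{banach, second_countable_topology}"
  assumes "f \<in> borel_measurable M"
  shows "(\<integral>x. f (T j x) \<partial>M) = (\<integral>x. f x \<partial>M)"
  using integral_distr[of "T j" M M f] assms by (simp add: distr_T)

lemma AE_T:
  assumes "AE x in M. Q x"
  shows "AE x in M. Q (T j x)"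
  using AE_distrD[of "T j" M M Q] assms unfolding distr_T by simp

lemma measure_T_vimage:
  assumes "A \<in> sets M"
  shows "measure M (T j -` A) = measure M A"
  using measure_distr[of "T j" M M A] assms by (simp add: distr_T)

end

text \<open>The exponent 2 is the one of almost periodicity, the exponent 1 the one that behaves
  well under truncation and averaging. No root is taken, since \<open>e\<close> ranges over all
  positive numbers.\<close>

definition totally_bounded_orbit ::
  "'x measure \<Rightarrow> ('g \<Rightarrow> 'x \<Rightarrow> 'x) \<Rightarrow> nat \<Rightarrow> ('x \<Rightarrow> 'b::{banach, second_countable_topology}) \<Rightarrow> bool"
where
  "totally_bounded_orbit M T p f \<longleftrightarrow>
    (\<forall>e>0. \<exists>K. finite K \<and> (\<forall>j. \<exists>k\<in>K. (\<integral>x. norm (f (T j x) - f (T k x)) ^ p \<partial>M) \<le> e))"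

context folner_ergodic begin

text \<open>The preimages of \<open>A\<close> under the \<open>T h\<close> all have the measure of
  \<open>A\<close> and are pairwise almost disjoint, so together they fit into a space of measure 1.
  The set \<open>G\<close> leaves room for restricting the distance to generic points: having full
  measure, it contains \<open>T h x\<close> and \<open>T k x\<close> for almost every
  \<open>x\<close>.\<close>

lemma card_separated_le:
  fixes f :: "'x \<Rightarrow> complex"
  assumes f [measurable]: "f \<in> borel_measurable M"
    and int: "integrable M (\<lambda>x. (norm (f x))\<^sup>2)"
    and A [measurable]: "A \<in> sets M"
    and G: "AE x in M. x \<in> G"
    and close: "\<And>x y. x \<in> A \<Longrightarrow> y \<in> A \<Longrightarrow> x \<in> G \<Longrightarrow> y \<in> G \<Longrightarrow>
      limsup (\<lambda>n. ereal (sqrt (\<integral>j. (norm (f (T j x) - f (T j y)))\<^sup>2 \<partial>P n))) \<le> ereal e"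
    and "e \<ge> 0"
    and "finite I"
    and sep: "\<And>h k. h \<in> I \<Longrightarrow> k \<in> I \<Longrightarrow> h \<noteq> k \<Longrightarrow>
      (\<integral>x. (norm (f (T h x) - f (T k x)))\<^sup>2 \<partial>M) > e\<^sup>2"
  shows "real (card I) * measure M A \<le> 1"
proof -
  have null: "AE x in M. x \<notin> T h -` A \<or> x \<notin> T k -` A" if "h \<in> I" "k \<in> I" "h \<noteq> k" for h k
  proof -
    define u where "u x = (norm (f (T h x) - f (T k x)))\<^sup>2" for x
    have [measurable]: "u \<in> borel_measurable M"
      unfolding u_def by measurable
    have "integrable M u"
      unfolding u_def using integrable_T_iff[of "\<lambda>x. (norm (f x))\<^sup>2"] int
      by (intro integrable_norm_diff_square) auto
    from pointwise_ergodic[OF this] AE_T[OF G, of h] AE_T[OF G, of k]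
    show ?thesis
    proof eventually_elim
      case (elim x)
      show ?case
      proof (rule ccontr)
        assume "\<not> ?case"
        then have "x \<in> T h -` A \<inter> T k -` A"
          by simp
        then have "limsup (\<lambda>n. ereal (sqrt (\<integral>j. (norm (f (T j (T h x)) - f (T j (T k x))))\<^sup>2 \<partial>P n))) \<le> ereal e"
          using elim by (intro close) auto
        \<comment> \<open>Commutativity of the group turns the comparison of the orbits of two
          points into an ergodic average of the single function \<open>u\<close> along the orbit of
          \<open>x\<close>.\<close>
        moreover have "(norm (f (T j (T h x)) - f (T j (T k x))))\<^sup>2 = u (T j x)" for j
          by (simp add: u_def T_commute[of j])
        moreover have "(\<lambda>n. ereal (sqrt (\<integral>j. u (T j x) \<partial>P n))) \<longlonglongrightarrow> ereal (sqrt (\<integral>x. u x \<partial>M))"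
          using elim by (intro tendsto_intros) auto
        ultimately have "sqrt (\<integral>x. u x \<partial>M) \<le> e"
          by (simp add: lim_imp_Limsup)
        then have "(\<integral>x. u x \<partial>M) \<le> e\<^sup>2"
          by (rule sqrt_le_D)
        with sep[OF that] show False
          by (simp add: u_def)
      qed
    qed
  qed
  have sA: "T h -` A \<in> sets M" for h
    using measurable_sets[OF measurable_T[OF measurable_const measurable_ident_sets[OF refl]] A]
    by auto
  have "measure M (\<Union>h\<in>I. T h -` A) = (\<Sum>h\<in>I. measure M (T h -` A))"
    using \<open>finite I\<close>
  proof (rule measure_UNION_AE)
    show "pairwise (\<lambda>i j. AE x in M. x \<notin> T i -` A \<or> x \<notin> T j -` A) I"
      using null by (simp add: pairwise_def)
  qed (use sA in \<open>auto simp: fmeasurable_eq_sets\<close>)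
  also have "\<dots> = real (card I) * measure M A"
    by (simp add: measure_T_vimage)
  finally show ?thesis
    by (metis prob_le_1)
qed


text \<open>A separated set of greatest cardinality is a net: a translate far from all its members
  could be added to it. The previous bound ensures that a greatest cardinality exists.\<close>

lemma totally_bounded_orbit_if_close_sets:
  fixes f :: "'x \<Rightarrow> complex"
  assumes f: "f \<in> borel_measurable M"
    and int: "integrable M (\<lambda>x. (norm (f x))\<^sup>2)"
    and G: "AE x in M. x \<in> G"
    and close: "\<And>e. e > 0 \<Longrightarrow> \<exists>A\<in>sets M. measure M A > 0 \<and> (\<forall>x\<in>A. \<forall>y\<in>A. x \<in> G \<longrightarrow> y \<in> G \<longrightarrow>
      limsup (\<lambda>n. ereal (sqrt (\<integral>j. (norm (f (T j x) - f (T j y)))\<^sup>2 \<partial>P n))) \<le> ereal e)"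
  shows "totally_bounded_orbit M T 2 f"
  unfolding totally_bounded_orbit_def
proof (intro allI impI)
  fix e :: real
  assume "e > 0"
  \<comment> \<open>The root of \<open>e\<close> appears because closeness is measured by the root
    of the mean square, whereas \<open>totally_bounded_orbit\<close> with exponent 2 bounds the mean
    square itself.\<close>
  then obtain A where A: "A \<in> sets M" "measure M A > 0"
    and Ae: "\<And>x y. x \<in> A \<Longrightarrow> y \<in> A \<Longrightarrow> x \<in> G \<Longrightarrow> y \<in> G \<Longrightarrow>
      limsup (\<lambda>n. ereal (sqrt (\<integral>j. (norm (f (T j x) - f (T j y)))\<^sup>2 \<partial>P n))) \<le> ereal (sqrt e)"
    using close[of "sqrt e"] by auto
  let ?S = "\<lambda>I. finite I \<and> (\<forall>h\<in>I. \<forall>k\<in>I. h \<noteq> k \<longrightarrow>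
    (\<integral>x. (norm (f (T h x) - f (T k x)))\<^sup>2 \<partial>M) > e)"
  have "real (card I) * measure M A \<le> 1" if "?S I" for I
    using that \<open>e > 0\<close> by (intro card_separated_le[OF f int A(1) G Ae]) auto
  then have "card I \<le> nat \<lfloor>1 / measure M A\<rfloor>" if "?S I" for I
    using that A(2) by (simp add: le_nat_floor pos_le_divide_eq)
  then have bound: "\<forall>J. ?S J \<longrightarrow> card J < Suc (nat \<lfloor>1 / measure M A\<rfloor>)"
    by (simp add: less_Suc_eq_le)
  have "\<exists>I. ?S I \<and> (\<forall>J. ?S J \<longrightarrow> card J \<le> card I)"
    by (rule ex_has_greatest_nat[of ?S "{}" card, OF _ bound]) simp
  then obtain I where I: "?S I" and max: "\<And>J. ?S J \<Longrightarrow> card J \<le> card I"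
    by blast
  have "\<exists>k\<in>I. (\<integral>x. norm (f (T j x) - f (T k x)) ^ 2 \<partial>M) \<le> e" for j
  proof (rule ccontr)
    assume *: "\<not> ?thesis"
    then have "j \<notin> I"
      using \<open>e > 0\<close> by force
    moreover have "?S (insert j I)"
      using I * by (auto simp: norm_minus_commute not_le)
    ultimately show False
      using max[of "insert j I"] I by simp
  qed
  then show "\<exists>K. finite K \<and> (\<forall>j. \<exists>k\<in>K. (\<integral>x. norm (f (T j x) - f (T k x)) ^ 2 \<partial>M) \<le> e)"
    using I by blast
qed

section \<open>Codings by countable partitions\<close>

text \<open>Equality of codes is a measurable equivalence relation with countably many classes,
  which is the form that Lusin's theorem can handle. Integrability is demanded because an integral
  that does not exist would satisfy the bound trivially.\<close>

definition coded :: "('x \<Rightarrow> 'b::{banach, second_countable_topology}) \<Rightarrow> real \<Rightarrow> bool" where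
  "coded f e \<longleftrightarrow> (\<exists>\<kappa> :: 'x \<Rightarrow> nat. \<exists>G.
    \<kappa> \<in> M \<rightarrow>\<^sub>M count_space UNIV \<and> (AE x in M. x \<in> G) \<and>
    (\<forall>x\<in>G. \<forall>y\<in>G. \<kappa> x = \<kappa> y \<longrightarrow> (\<forall>\<^sub>F n in sequentially.
      integrable (P n) (\<lambda>j. f (T j x) - f (T j y)) \<and> (\<integral>j. norm (f (T j x) - f (T j y)) \<partial>P n) \<le> e)))"

lemma codedI:
  fixes \<kappa> :: "'x \<Rightarrow> nat"
  assumes "\<kappa> \<in> M \<rightarrow>\<^sub>M count_space UNIV" "AE x in M. x \<in> G"
    and "\<And>x y. x \<in> G \<Longrightarrow> y \<in> G \<Longrightarrow> \<kappa> x = \<kappa> y \<Longrightarrow> \<forall>\<^sub>F n in sequentially.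
      integrable (P n) (\<lambda>j. f (T j x) - f (T j y)) \<and> (\<integral>j. norm (f (T j x) - f (T j y)) \<partial>P n) \<le> e"
  shows "coded f e"
  unfolding coded_def
  by (rule exI[of _ \<kappa>], rule exI[of _ G], intro conjI ballI impI) (fact assms(1), fact assms(2), rule assms(3))

text \<open>The code of \<open>g\<close> also serves for \<open>f\<close>: the ergodic theorem for
  \<open>norm (f x - g x)\<close> bounds the error along each of the two orbits by \<open>d\<close>,
  whence the factor 2. The strict inequality turns the limit into a bound that holds
  eventually.\<close>

lemma coded_approx:
  assumes g: "coded g e" and "integrable M f" "integrable M g"
    and d: "(\<integral>x. norm (f x - g x) \<partial>M) < d"
  shows "coded f (e + 2 * d)"
proof -
  have fg [measurable]: "f \<in> borel_measurable M" "g \<in> borel_measurable M"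
    using assms(2,3) by auto
  from g obtain \<kappa> :: "'x \<Rightarrow> nat" and G where [measurable]: "\<kappa> \<in> M \<rightarrow>\<^sub>M count_space UNIV"
    and G: "AE x in M. x \<in> G"
    and \<kappa>: "\<And>x y. x \<in> G \<Longrightarrow> y \<in> G \<Longrightarrow> \<kappa> x = \<kappa> y \<Longrightarrow> \<forall>\<^sub>F n in sequentially.
      integrable (P n) (\<lambda>j. g (T j x) - g (T j y)) \<and> (\<integral>j. norm (g (T j x) - g (T j y)) \<partial>P n) \<le> e"
    unfolding coded_def by blast
  define G' where "G' = G \<inter> {x. \<forall>\<^sub>F n in sequentially. integrable (P n) (\<lambda>j. norm (f (T j x) - g (T j x))) \<and>
      (\<integral>j. norm (f (T j x) - g (T j x)) \<partial>P n) < d}"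
  have "integrable M (\<lambda>x. norm (f x - g x))"
    using assms by simp
  from pointwise_ergodic[OF this] G have "AE x in M. x \<in> G'"
  proof eventually_elim
    case (elim x)
    then have "\<forall>\<^sub>F n in sequentially. (\<integral>j. norm (f (T j x) - g (T j x)) \<partial>P n) < d"
      using d by (auto intro: order_tendstoD(2))
    with elim show ?case
      by (auto simp: G'_def eventually_conj_iff)
  qed
  moreover
  have "\<forall>\<^sub>F n in sequentially. integrable (P n) (\<lambda>j. f (T j x) - f (T j y)) \<and>
      (\<integral>j. norm (f (T j x) - f (T j y)) \<partial>P n) \<le> e + 2 * d"
    if "x \<in> G'" "y \<in> G'" "\<kappa> x = \<kappa> y" for x y
  proof -
    have "\<forall>\<^sub>F n in sequentially. integrable (P n) (\<lambda>j. norm (f (T j z) - g (T j z))) \<and>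
      (\<integral>j. norm (f (T j z) - g (T j z)) \<partial>P n) < d" if "z \<in> G'" for z
      using that by (simp add: G'_def)
    from this[OF that(1)] this[OF that(2)] \<kappa>[of x y]
    have "\<forall>\<^sub>F n in sequentially. integrable (P n) (\<lambda>j. norm (f (T j x) - g (T j x))) \<and>
      (\<integral>j. norm (f (T j x) - g (T j x)) \<partial>P n) < d \<and>
      integrable (P n) (\<lambda>j. norm (f (T j y) - g (T j y))) \<and>
      (\<integral>j. norm (f (T j y) - g (T j y)) \<partial>P n) < d \<and>
      integrable (P n) (\<lambda>j. g (T j x) - g (T j y)) \<and> (\<integral>j. norm (g (T j x) - g (T j y)) \<partial>P n) \<le> e"
      using that by (simp add: G'_def eventually_conj_iff)
    then show ?thesis
    proof eventually_elim
      case (elim n)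
      have bd: "norm (f (T j x) - f (T j y)) \<le>
          norm (f (T j x) - g (T j x)) + norm (g (T j x) - g (T j y)) + norm (f (T j y) - g (T j y))" for j
        using norm_triangle_ineq[of "f (T j x) - g (T j x)" "g (T j x) - f (T j y)"]
          norm_triangle_ineq[of "g (T j x) - g (T j y)" "g (T j y) - f (T j y)"]
        by (simp add: norm_minus_commute[of "f (T j y)"])
      have I: "integrable (P n) (\<lambda>j. norm (f (T j x) - g (T j x)) + norm (g (T j x) - g (T j y)) + norm (f (T j y) - g (T j y)))"
        using elim by auto
      have J: "integrable (P n) (\<lambda>j. f (T j x) - f (T j y))"
        by (rule Bochner_Integration.integrable_bound[OF I]) (use bd in \<open>auto intro: order_trans\<close>)
      have "(\<integral>j. norm (f (T j x) - f (T j y)) \<partial>P n) \<le>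
         (\<integral>j. norm (f (T j x) - g (T j x)) + norm (g (T j x) - g (T j y)) + norm (f (T j y) - g (T j y)) \<partial>P n)"
        by (rule integral_mono) (use bd I J in auto)
      also have "\<dots> \<le> e + 2 * d"
        using elim by auto
      finally show ?case
        using J by simp
    qed
  qed
  ultimately show ?thesis
    by (rule codedI[OF \<open>\<kappa> \<in> M \<rightarrow>\<^sub>M count_space UNIV\<close>])
qed

text \<open>This joins real and imaginary parts; the pair of the two codes is the new code.\<close>

lemma coded_combine:
  assumes "coded f e" "coded g d"
    and h: "h \<in> borel_measurable M"
    and le: "\<And>x y. norm (h x - h y) \<le> norm (f x - f y) + norm (g x - g y)"
  shows "coded h (e + d)"
proof -
  obtain \<kappa> :: "'x \<Rightarrow> nat" and G where \<kappa> [measurable]: "\<kappa> \<in> M \<rightarrow>\<^sub>M count_space UNIV"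
    and G: "AE x in M. x \<in> G"
    and f: "\<And>x y. x \<in> G \<Longrightarrow> y \<in> G \<Longrightarrow> \<kappa> x = \<kappa> y \<Longrightarrow> \<forall>\<^sub>F n in sequentially.
      integrable (P n) (\<lambda>j. f (T j x) - f (T j y)) \<and> (\<integral>j. norm (f (T j x) - f (T j y)) \<partial>P n) \<le> e"
    using assms(1) unfolding coded_def by blast
  obtain \<kappa>' :: "'x \<Rightarrow> nat" and G' where \<kappa>' [measurable]: "\<kappa>' \<in> M \<rightarrow>\<^sub>M count_space UNIV"
    and G': "AE x in M. x \<in> G'"
    and g: "\<And>x y. x \<in> G' \<Longrightarrow> y \<in> G' \<Longrightarrow> \<kappa>' x = \<kappa>' y \<Longrightarrow> \<forall>\<^sub>F n in sequentially.
      integrable (P n) (\<lambda>j. g (T j x) - g (T j y)) \<and> (\<integral>j. norm (g (T j x) - g (T j y)) \<partial>P n) \<le> d"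
    using assms(2) unfolding coded_def by blast
  have "(\<lambda>x. prod_encode (\<kappa> x, \<kappa>' x)) \<in> M \<rightarrow>\<^sub>M count_space UNIV"
    by measurable
  moreover have "AE x in M. x \<in> G \<inter> G'"
    using G G' by eventually_elim auto
  moreover have "\<forall>\<^sub>F n in sequentially. integrable (P n) (\<lambda>j. h (T j x) - h (T j y)) \<and>
      (\<integral>j. norm (h (T j x) - h (T j y)) \<partial>P n) \<le> e + d"
    if "x \<in> G \<inter> G'" "y \<in> G \<inter> G'" "prod_encode (\<kappa> x, \<kappa>' x) = prod_encode (\<kappa> y, \<kappa>' y)" for x y
  proof -
    have "\<kappa> x = \<kappa> y" "\<kappa>' x = \<kappa>' y"
      using that(3) by auto
    with that f[of x y] g[of x y] have "\<forall>\<^sub>F n in sequentially.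
      integrable (P n) (\<lambda>j. f (T j x) - f (T j y)) \<and> (\<integral>j. norm (f (T j x) - f (T j y)) \<partial>P n) \<le> e \<and>
      integrable (P n) (\<lambda>j. g (T j x) - g (T j y)) \<and> (\<integral>j. norm (g (T j x) - g (T j y)) \<partial>P n) \<le> d"
      by (simp add: eventually_conj_iff)
    then show ?thesis
    proof eventually_elim
      case (elim n)
      have I: "integrable (P n) (\<lambda>j. norm (f (T j x) - f (T j y)) + norm (g (T j x) - g (T j y)))"
        using elim by auto
      have J: "integrable (P n) (\<lambda>j. h (T j x) - h (T j y))"
        by (rule Bochner_Integration.integrable_bound[OF I]) (use h le in \<open>auto intro: order_trans\<close>)
      have "(\<integral>j. norm (h (T j x) - h (T j y)) \<partial>P n) \<le>
         (\<integral>j. norm (f (T j x) - f (T j y)) + norm (g (T j x) - g (T j y)) \<partial>P n)"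
        by (rule integral_mono) (use le I J in auto)
      also have "\<dots> \<le> e + d"
        using elim by auto
      finally show ?case
        using J by simp
    qed
  qed
  ultimately show ?thesis
    by (rule codedI)
qed


text \<open>The null set of exceptional \<open>x\<close> depends on \<open>j\<close>, and a union of
  such sets over the whole group need not be null. Fubini's theorem on the product with
  \<open>P n\<close> exchanges the quantifiers at the price of "almost every \<open>j\<close>";
  after that only countably many \<open>n\<close> remain.\<close>

lemma AE_orbit:
  assumes Q: "\<And>j. AE x in M. Q j x"
    and [measurable]: "Measurable.pred (borel \<Otimes>\<^sub>M M) (\<lambda>z. Q (fst z) (snd z))"
  shows "AE x in M. \<forall>n. AE j in P n. Q j x"
proof -
  have "AE x in M. AE j in P n. Q j x" for n
  proof -
    interpret Pn: prob_space "P n" by (rule prob_space_P)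
    interpret pair_sigma_finite "P n" M ..
    have "{z \<in> space (P n \<Otimes>\<^sub>M M). Q (fst z) (snd z)} \<in> sets (P n \<Otimes>\<^sub>M M)"
      by measurable
    from AE_commute[OF this] Q show ?thesis
      by simp
  qed
  then show ?thesis
    by (simp add: AE_all_countable)
qed

text \<open>Minkowski's integral inequality for the \<open>L\<^sup>1\<close> norm, by Fubini: it
  reduces estimates of averages to estimates of single translates.\<close>

lemma integral_norm_average_le:
  fixes \<Phi> :: "'g \<Rightarrow> 'x \<Rightarrow> real"
  assumes m [measurable]: "(\<lambda>z. \<Phi> (fst z) (snd z)) \<in> borel_measurable (borel \<Otimes>\<^sub>M M)"
    and B: "\<And>j x. \<bar>\<Phi> j x\<bar> \<le> B"
  shows "(\<integral>x. \<bar>\<integral>j. \<Phi> j x \<partial>P n\<bar> \<partial>M) \<le> (\<integral>j. (\<integral>x. \<bar>\<Phi> j x\<bar> \<partial>M) \<partial>P n)"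
proof -
  interpret Pn: prob_space "P n" by (rule prob_space_P)
  interpret pair_sigma_finite "P n" M ..
  interpret pair_prob_space "P n" M ..
  have "(\<lambda>z. \<Phi> (snd z) (fst z)) \<in> borel_measurable (M \<Otimes>\<^sub>M P n)"
    using measurable_compose[OF measurable_Pair[OF measurable_snd measurable_fst] m]
    by (simp add: measurable_cong_sets[OF sets_pair_measure_cong[OF refl sets_P] refl])
  then have [measurable]: "(\<lambda>(x, j). \<Phi> j x) \<in> borel_measurable (M \<Otimes>\<^sub>M P n)"
    by (simp add: split_beta)
  have i: "integrable (P n \<Otimes>\<^sub>M M) (\<lambda>(j, x). \<bar>\<Phi> j x\<bar>)"
    by (rule integrable_const_bound[where B = B]) (use B in \<open>auto simp: split_beta\<close>)
  have i1: "integrable M (\<lambda>x. \<integral>j. \<bar>\<Phi> j x\<bar> \<partial>P n)"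
    using integrable_snd[OF i] by simp
  have "\<bar>\<integral>j. \<Phi> j x \<partial>P n\<bar> \<le> (\<integral>j. \<bar>\<Phi> j x\<bar> \<partial>P n)" for x
    by (rule integral_abs_bound)
  then have "(\<integral>x. \<bar>\<integral>j. \<Phi> j x \<partial>P n\<bar> \<partial>M) \<le> (\<integral>x. (\<integral>j. \<bar>\<Phi> j x\<bar> \<partial>P n) \<partial>M)"
    by (intro integral_mono Bochner_Integration.integrable_bound[OF i1]) auto
  also have "\<dots> = (\<integral>j. (\<integral>x. \<bar>\<Phi> j x\<bar> \<partial>M) \<partial>P n)"
    using Fubini_integral[OF i] by simp
  finally show ?thesis .
qed

lemma ex_code_finite:
  assumes "finite K" and u: "\<And>k. k \<in> K \<Longrightarrow> u k \<in> M \<rightarrow>\<^sub>M count_space (UNIV :: int set)"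
  shows "\<exists>\<kappa> :: 'x \<Rightarrow> nat. \<kappa> \<in> M \<rightarrow>\<^sub>M count_space UNIV \<and> (\<forall>x y. \<kappa> x = \<kappa> y \<longrightarrow> (\<forall>k\<in>K. u k x = u k y))"
  using assms
proof (induction K)
  case empty
  then show ?case by (intro exI[of _ "\<lambda>_. 0"]) auto
next
  case (insert k K)
  then obtain \<kappa> :: "'x \<Rightarrow> nat" where [measurable]: "\<kappa> \<in> M \<rightarrow>\<^sub>M count_space UNIV"
    and \<kappa>: "\<And>x y. \<kappa> x = \<kappa> y \<Longrightarrow> \<forall>k\<in>K. u k x = u k y"
    by (metis insertCI)
  have [measurable]: "u k \<in> M \<rightarrow>\<^sub>M count_space UNIV"
    using insert by simp
  have m: "(\<lambda>x. prod_encode (\<kappa> x, to_nat (u k x))) \<in> M \<rightarrow>\<^sub>M count_space UNIV"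
    by measurable
  have "\<forall>k'\<in>insert k K. u k' x = u k' y"
    if "prod_encode (\<kappa> x, to_nat (u k x)) = prod_encode (\<kappa> y, to_nat (u k y))" for x y
    using \<kappa>[of x y] that by simp
  then show ?case
    by (intro exI[of _ "\<lambda>x. prod_encode (\<kappa> x, to_nat (u k x))"] conjI m allI impI)
qed

text \<open>For a finite net \<open>K\<close> with respect to \<open>q\<close>, every
  \<open>h (T j x)\<close> is close to some \<open>h (T k x)\<close> with \<open>k\<close> in
  \<open>K\<close>, and the choice of \<open>k\<close> depends on \<open>j\<close> but not on
  \<open>x\<close>. Two points with the same rounded values on \<open>K\<close> therefore have
  nearby values along their whole orbits, up to null sets.\<close>

lemma coded_of_orbit_modulus:
  fixes h :: "'x \<Rightarrow> real" and q :: "'g \<Rightarrow> 'g \<Rightarrow> real"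
  assumes h [measurable]: "h \<in> borel_measurable M" and B: "\<And>x. \<bar>h x\<bar> \<le> B"
    and q [measurable]: "\<And>k. (\<lambda>j. q j k) \<in> borel_measurable borel"
    and modulus: "\<And>j k. AE x in M. \<bar>h (T j x) - h (T k x)\<bar> \<le> q j k"
    and tb: "\<And>e. e > 0 \<Longrightarrow> \<exists>K. finite K \<and> (\<forall>j. \<exists>k\<in>K. q j k \<le> e)"
    and "e > 0"
  shows "coded h e"
proof -
  obtain K where K: "finite K" "\<And>j. \<exists>k\<in>K. q j k \<le> e / 4"
    using tb[of "e / 4"] \<open>e > 0\<close> by auto
  \<comment> \<open>Values are rounded to multiples of \<open>e / 2\<close>; with the error
    \<open>e / 4\<close> of the net at each of the two points this adds up to
    \<open>e\<close>.\<close>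
  define s where "s = 2 / e"
  have "s > 0"
    using \<open>e > 0\<close> by (simp add: s_def)
  obtain \<kappa> :: "'x \<Rightarrow> nat" where \<kappa>m: "\<kappa> \<in> M \<rightarrow>\<^sub>M count_space UNIV"
    and \<kappa>: "\<And>x y. \<kappa> x = \<kappa> y \<Longrightarrow> \<forall>k\<in>K. \<lfloor>h (T k x) * s\<rfloor> = \<lfloor>h (T k y) * s\<rfloor>"
    using ex_code_finite[OF K(1), of "\<lambda>k x. \<lfloor>h (T k x) * s\<rfloor>"] by auto
  \<comment> \<open>Asking for the modulus at almost every \<open>j\<close> is enough, since only
    integrals with respect to the \<open>P n\<close> will be estimated.\<close>
  define G where "G = {x. \<forall>n. AE j in P n. \<forall>k\<in>K. \<bar>h (T j x) - h (T k x)\<bar> \<le> q j k}"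
  have "AE x in M. \<forall>n. AE j in P n. \<forall>k\<in>K. \<bar>h (T j x) - h (T k x)\<bar> \<le> q j k"
  proof (rule AE_orbit)
    show "AE x in M. \<forall>k\<in>K. \<bar>h (T j x) - h (T k x)\<bar> \<le> q j k" for j
      using modulus K(1) by (simp add: AE_finite_all)
    show "Measurable.pred (borel \<Otimes>\<^sub>M M)
      (\<lambda>z. \<forall>k\<in>K. \<bar>h (T (fst z) (snd z)) - h (T k (snd z))\<bar> \<le> q (fst z) k)"
      
    proof (rule pred_intros_finite(3)[OF K(1)])
      fix k
      have [measurable]: "(\<lambda>z. q (fst z) k) \<in> borel_measurable (borel \<Otimes>\<^sub>M M)"
        by (rule measurable_compose[OF measurable_fst q])
      show "Measurable.pred (borel \<Otimes>\<^sub>M M) (\<lambda>z. \<bar>h (T (fst z) (snd z)) - h (T k (snd z))\<bar> \<le> q (fst z) k)"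
        by measurable
    qed
  qed
  then have "AE x in M. x \<in> G"
    by (simp add: G_def)
  moreover
  have "\<forall>\<^sub>F n in sequentially. integrable (P n) (\<lambda>j. h (T j x) - h (T j y)) \<and>
      (\<integral>j. norm (h (T j x) - h (T j y)) \<partial>P n) \<le> e" if "x \<in> G" "y \<in> G" "\<kappa> x = \<kappa> y" for x y
  proof (intro always_eventually allI conjI)
    fix n
    interpret Pn: prob_space "P n" by (rule prob_space_P)
    have [measurable]: "(\<lambda>j. T j z) \<in> borel \<rightarrow>\<^sub>M M" for z
      by measurable
    show i: "integrable (P n) (\<lambda>j. h (T j x) - h (T j y))"
    proof (rule Pn.integrable_const_bound[where B = "2 * B"])
      have "norm (h (T j x) - h (T j y)) \<le> 2 * B" for j
        using B[of "T j x"] B[of "T j y"] by (simp add: abs_le_iff)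
      then show "AE j in P n. norm (h (T j x) - h (T j y)) \<le> 2 * B" by simp
    qed measurable
    have "AE j in P n. \<forall>k\<in>K. \<bar>h (T j x) - h (T k x)\<bar> \<le> q j k"
      "AE j in P n. \<forall>k\<in>K. \<bar>h (T j y) - h (T k y)\<bar> \<le> q j k"
      using that by (auto simp: G_def)
    then have "AE j in P n. norm (h (T j x) - h (T j y)) \<le> e"
    proof eventually_elim
      case (elim j)
      obtain k where k: "k \<in> K" "q j k \<le> e / 4"
        using K(2) by auto
      have "\<lfloor>h (T k x) * s\<rfloor> = \<lfloor>h (T k y) * s\<rfloor>"
        using \<kappa>[OF that(3)] k by simp
      then have "\<bar>h (T k x) * s - h (T k y) * s\<bar> \<le> 1"
        by linarith
      then have "\<bar>h (T k x) - h (T k y)\<bar> * s \<le> 1"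
        using \<open>s > 0\<close> by (simp add: abs_mult flip: left_diff_distrib)
      then have "\<bar>h (T k x) - h (T k y)\<bar> \<le> e / 2"
        using \<open>e > 0\<close> by (simp add: s_def field_simps)
      moreover have "\<bar>h (T j x) - h (T k x)\<bar> \<le> e / 4" "\<bar>h (T j y) - h (T k y)\<bar> \<le> e / 4"
        using elim k by force+
      ultimately show ?case
        by (simp add: abs_if split: if_splits)
    qed
    then have "(\<integral>j. norm (h (T j x) - h (T j y)) \<partial>P n) \<le> (\<integral>j. e \<partial>P n)"
      by (intro integral_mono_AE) (use i in auto)
    then show "(\<integral>j. norm (h (T j x) - h (T j y)) \<partial>P n) \<le> e"
      using Pn.prob_space by simp
  qed
  ultimately show ?thesis
    by (rule codedI[OF \<kappa>m])
qed

end

section \<open>Orbit averages of functions with totally bounded orbit\<close>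

text \<open>Tychonoff's theorem in place of a diagonal argument: over a countable index type,
  compactness of the cube of all coordinates yields sequential compactness.\<close>

lemma ex_convergent_subsequence_countable:
  fixes w :: "nat \<Rightarrow> 'i::countable \<Rightarrow> real"
  assumes "\<And>n i. w n i \<in> {0..1}"
  obtains r :: "nat \<Rightarrow> nat" where "strict_mono r" "\<And>i. convergent (\<lambda>n. w (r n) i)"
proof -
  have "compactin (product_topology (\<lambda>_. euclidean) UNIV) (PiE UNIV (\<lambda>_::'i. {0..1::real}))"
    by (simp add: compactin_PiE)
  then have "compact (PiE UNIV (\<lambda>_::'i. {0..1::real}))"
    by (simp add: euclidean_product_topology)
  then have "seq_compact (PiE UNIV (\<lambda>_::'i. {0..1::real}))"
    by (rule compact_imp_seq_compact)
  moreover have "\<forall>n. w n \<in> PiE UNIV (\<lambda>_::'i. {0..1::real})"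
    using assms by auto
  ultimately obtain l r where r: "strict_mono r" "(w \<circ> r) \<longlonglongrightarrow> l"
    unfolding seq_compact_def by blast
  have "(\<lambda>n. w (r n) i) \<longlonglongrightarrow> l i" for i
    using continuous_on_tendsto_compose[OF continuous_on_product_coordinates r(2), of i] by simp
  then show ?thesis
    using r(1) that by (auto simp: convergent_def)
qed

context folner_ergodic begin

text \<open>The number \<open>a\<close> is the limiting mass of the weight. Only those
  \<open>j\<close> count for which the translate of \<open>f\<close> by \<open>j\<close> is within
  \<delta> of \<open>f\<close>, so the average differs from \<open>a * f\<close> by at most
  \<open>\<delta> * a\<close>. The weight has Lipschitz constant \<open>1 / \<delta>\<close> and
  \<open>f\<close> is bounded by \<open>B\<close>, whence the factor \<open>B / \<delta>\<close> in
  the modulus.\<close>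

lemma ex_orbit_average:
  fixes f :: "'x \<Rightarrow> real"
  assumes f [measurable]: "f \<in> borel_measurable M" and B: "\<And>x. \<bar>f x\<bar> \<le> B"
    and tb: "totally_bounded_orbit M T 1 f"
    and "\<delta> > 0"
  obtains h :: "'x \<Rightarrow> real" and a :: real
  where "h \<in> borel_measurable M" "\<And>x. \<bar>h x\<bar> \<le> B" "a > 0"
    "(\<integral>x. \<bar>h x - a * f x\<bar> \<partial>M) \<le> \<delta> * a"
    "\<And>j k. AE x in M. \<bar>h (T j x) - h (T k x)\<bar> \<le> B / \<delta> * (\<integral>x. \<bar>f (T j x) - f (T k x)\<bar> \<partial>M)"
proof -
  have "B \<ge> 0"
    using B[of undefined] by linarith
  \<comment> \<open>This is a translation-invariant pseudometric on the group, for which the group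
    itself is totally bounded.\<close>
  define q where "q j k = (\<integral>x. \<bar>f (T j x) - f (T k x)\<bar> \<partial>M)" for j k
  have fint: "integrable M (\<lambda>x. f (T j x) - f (T k x))" for j k
  proof (rule integrable_const_bound[where B = "2 * B"])
    have "norm (f (T j x) - f (T k x)) \<le> 2 * B" for x
      using B[of "T j x"] B[of "T k x"] by (simp add: abs_le_iff)
    then show "AE x in M. norm (f (T j x) - f (T k x)) \<le> 2 * B" by simp
  qed measurable
  have q_nonneg: "q j k \<ge> 0" for j k
    by (simp add: q_def)
  have q_sym: "q j k = q k j" for j k
    by (simp add: q_def abs_minus_commute)
  have q_triangle: "q i k \<le> q i j + q j k" for i j k
  proof -
    have "q i k \<le> (\<integral>x. \<bar>f (T i x) - f (T j x)\<bar> + \<bar>f (T j x) - f (T k x)\<bar> \<partial>M)"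
      unfolding q_def by (intro integral_mono) (use fint in auto)
    then show ?thesis
      using fint by (simp add: q_def)
  qed
  have q_shift: "q (j + g) (k + g) = q j k" for j k g
    using integral_T[of "\<lambda>x. \<bar>f (T j x) - f (T k x)\<bar>" g] by (simp add: q_def T_plus)
  have q_meas [measurable]: "(\<lambda>j. q j k) \<in> borel_measurable borel" for k
    unfolding q_def by measurable
  have q_tb: "\<exists>K. finite K \<and> (\<forall>j. \<exists>k\<in>K. q j k \<le> e)" if "e > 0" for e
    using tb that by (simp add: totally_bounded_orbit_def q_def)
  \<comment> \<open>The weight is supported on the \<open>j\<close> with \<open>q j 0 < \<delta>\<close>, and it is Lipschitz for \<open>q\<close>, which is invariant
    under translation: this is what yields the modulus of continuity of the limit \<open>h\<close>.\<close>
  define \<psi> where "\<psi> j = max 0 (1 - q j 0 / \<delta>)" for j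
  have [measurable]: "\<psi> \<in> borel_measurable borel"
    unfolding \<psi>_def by measurable
  have shift_meas [measurable]: "(\<lambda>j. k + j) \<in> borel \<rightarrow>\<^sub>M borel" for k :: 'g
    by (intro borel_measurable_continuous_onI continuous_intros)
  have \<psi>01: "0 \<le> \<psi> j" "\<psi> j \<le> 1" for j
    using q_nonneg[of j 0] \<open>\<delta> > 0\<close> by (auto simp: \<psi>_def)
  have \<psi>_lipschitz: "\<bar>\<psi> (- j + i) - \<psi> (- k + i)\<bar> \<le> q j k / \<delta>" for i j k
  proof -
    \<comment> \<open>Adding \<open>j + k - i\<close> to both arguments gives the pair
      \<open>k\<close>, \<open>j\<close>. This uses that the group is abelian.\<close>
    have *: "q (- j + i) (- k + i) = q j k"
      using q_shift[of "- j + i" "j + k - i" "- k + i"] q_sym[of k j] by (simp add: algebra_simps)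
    have "\<bar>q (- j + i) 0 - q (- k + i) 0\<bar> \<le> q j k"
      using q_triangle[of "- j + i" 0 "- k + i"] q_triangle[of "- k + i" 0 "- j + i"]
        q_sym[of "- j + i" "- k + i"] * by linarith
    then have "\<bar>q (- j + i) 0 - q (- k + i) 0\<bar> / \<delta> \<le> q j k / \<delta>"
      using \<open>\<delta> > 0\<close> by (simp add: divide_right_mono)
    moreover have "\<bar>\<psi> (- j + i) - \<psi> (- k + i)\<bar> \<le> \<bar>q (- j + i) 0 / \<delta> - q (- k + i) 0 / \<delta>\<bar>"
      unfolding \<psi>_def by linarith
    ultimately show ?thesis
      using \<open>\<delta> > 0\<close> by (simp flip: diff_divide_distrib)
  qed
  define a where "a n = (\<integral>j. \<psi> j \<partial>P n)" for n
  define H where "H n x = (\<integral>j. \<psi> j * f (T j x) \<partial>P n)" for n x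
  have P_integrable: "integrable (P n) \<phi>"
    if "\<phi> \<in> borel_measurable borel" "\<And>j. \<bar>\<phi> j\<bar> \<le> C" for n C and \<phi> :: "'g \<Rightarrow> real"
  proof -
    interpret Pn: prob_space "P n" by (rule prob_space_P)
    show ?thesis
      using that by (intro Pn.integrable_const_bound[where B = C]) auto
  qed
  have P_const: "(\<integral>j. c \<partial>P n) = c" for c :: real and n
    using prob_space.prob_space[OF prob_space_P[of n]] by simp
  have \<psi>f_le: "\<bar>\<psi> j * f x\<bar> \<le> B" for j x
    using mult_mono[of "\<psi> j" 1 "\<bar>f x\<bar>" B] \<psi>01[of j] B[of x] by (simp add: abs_mult)
  have H_B: "\<bar>H n x\<bar> \<le> B" for n x
  proof -
    have "\<bar>H n x\<bar> \<le> (\<integral>j. \<bar>\<psi> j * f (T j x)\<bar> \<partial>P n)"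
      unfolding H_def by (rule integral_abs_bound)
    also have "\<dots> \<le> (\<integral>j. B \<partial>P n)"
      by (rule integral_mono) (use \<psi>f_le \<open>B \<ge> 0\<close> in \<open>auto intro!: P_integrable[of _ B]\<close>)
    finally show ?thesis
      by (simp only: P_const)
  qed
  have [measurable]: "H n \<in> borel_measurable M" for n
  proof -
    interpret Pn: prob_space "P n" by (rule prob_space_P)
    have "(\<lambda>(x, j). \<psi> j * f (T j x)) \<in> borel_measurable (M \<Otimes>\<^sub>M P n)"
      by measurable
    then show ?thesis
      unfolding H_def by (rule Pn.borel_measurable_lebesgue_integral)
  qed

  have near: "(\<integral>x. \<bar>H n x - a n * f x\<bar> \<partial>M) \<le> \<delta> * a n" for n
  proof -
    \<comment> \<open>Writing \<open>f x\<close> as \<open>f (T 0 x)\<close> produces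
      \<open>q j 0\<close>, which is below \<delta> wherever the weight does not vanish.\<close>
    have "H n x - a n * f x = (\<integral>j. \<psi> j * (f (T j x) - f (T 0 x)) \<partial>P n)" for x
    proof -
      have "integrable (P n) (\<lambda>j. \<psi> j * f (T j x))"
        by (rule P_integrable[OF _ \<psi>f_le]) measurable
      moreover have "integrable (P n) (\<lambda>j. \<psi> j * f x)"
        by (rule P_integrable[OF _ \<psi>f_le]) measurable
      ultimately show ?thesis
        by (simp add: H_def a_def right_diff_distrib)
    qed
    then have "(\<integral>x. \<bar>H n x - a n * f x\<bar> \<partial>M) = (\<integral>x. \<bar>\<integral>j. \<psi> j * (f (T j x) - f (T 0 x)) \<partial>P n\<bar> \<partial>M)"
      by simp
    also have "\<dots> \<le> (\<integral>j. (\<integral>x. \<bar>\<psi> j * (f (T j x) - f (T 0 x))\<bar> \<partial>M) \<partial>P n)"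
    proof (rule integral_norm_average_le)
      fix j x
      show "\<bar>\<psi> j * (f (T j x) - f (T 0 x))\<bar> \<le> 2 * B"
        using \<psi>f_le[of j "T j x"] \<psi>f_le[of j "T 0 x"] by (simp add: abs_le_iff right_diff_distrib)
    qed measurable
    also have "\<dots> = (\<integral>j. \<psi> j * q j 0 \<partial>P n)"
      using \<psi>01 by (simp add: abs_mult q_def)
    also have "\<dots> \<le> (\<integral>j. \<delta> * \<psi> j \<partial>P n)"
    proof (rule integral_mono)
      have \<psi>q: "\<psi> j * q j 0 \<le> \<delta> * \<psi> j" for j
      proof (cases "q j 0 \<le> \<delta>")
        case True
        then show ?thesis
          using mult_right_mono[OF True \<psi>01(1)[of j]] by (simp add: mult.commute)
      next
        case False
        then have "\<psi> j = 0"
          using \<open>\<delta> > 0\<close> by (simp add: \<psi>_def)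
        then show ?thesis by simp
      qed
      then show "\<And>j. \<psi> j * q j 0 \<le> \<delta> * \<psi> j" .
      show "integrable (P n) (\<lambda>j. \<delta> * \<psi> j)"
        using \<psi>01 by (intro integrable_mult_right P_integrable[of _ 1]) auto
      have "\<bar>\<psi> j * q j 0\<bar> \<le> \<delta>" for j
        using order_trans[OF \<psi>q[of j] mult_left_le[OF \<psi>01(2)]] \<psi>01(1)[of j] q_nonneg[of j 0] \<open>\<delta> > 0\<close>
        by (simp add: abs_mult)
      then show "integrable (P n) (\<lambda>j. \<psi> j * q j 0)"
        by (intro P_integrable) auto
    qed
    finally show ?thesis
      by (simp add: a_def)
  qed

  have "\<exists>N g. \<forall>j. \<exists>i<N::nat. q j (g i) \<le> 1 / real (Suc m)" for m
  proof -
    obtain K where K: "finite K" "\<And>j. \<exists>k\<in>K. q j k \<le> 1 / real (Suc m)"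
      using q_tb[of "1 / real (Suc m)"] by auto
    obtain N and g :: "nat \<Rightarrow> 'g" where "K = g ` {i. i < N}"
      using finite_imp_nat_seg_image_inj_on[OF K(1)] by auto
    then show ?thesis
      using K(2) by (intro exI[of _ N] exI[of _ g]) auto
  qed
  then obtain N :: "nat \<Rightarrow> nat" and g :: "nat \<Rightarrow> nat \<Rightarrow> 'g"
    where g: "\<And>m j. \<exists>i<N m. q j (g m i) \<le> 1 / real (Suc m)"
    by metis
  \<comment> \<open>Replacing \<open>j\<close> by the nearby point \<open>g m (\<iota> m j)\<close> of a finite net turns \<open>H n\<close> into a combination of
    finitely many translates of \<open>f\<close>, up to an error uniform in \<open>n\<close>. The coefficients \<open>w n (Suc m, i)\<close> converge
    along a subsequence, for all \<open>m\<close> and \<open>i\<close> at once; \<open>w n (0, _)\<close> adds the total weight \<open>a n\<close> to the list.\<close>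
  define \<iota> where "\<iota> m j = (LEAST i. q j (g m i) \<le> 1 / real (Suc m))" for m j
  have \<iota>: "q j (g m (\<iota> m j)) \<le> 1 / real (Suc m)" "\<iota> m j < N m" for m j
  proof -
    obtain i where i: "i < N m" "q j (g m i) \<le> 1 / real (Suc m)"
      using g by blast
    show "q j (g m (\<iota> m j)) \<le> 1 / real (Suc m)"
      unfolding \<iota>_def by (rule LeastI[of _ i]) (rule i)
    show "\<iota> m j < N m"
      unfolding \<iota>_def by (rule le_less_trans[OF Least_le[of _ i] i(1)]) (rule i)
  qed
  \<comment> \<open>Taking the least admissible index makes the selection measurable; its values are
    natural numbers, so \<open>g m\<close> may be applied to it without measurability
    conditions.\<close>
  have [measurable]: "\<iota> m \<in> borel \<rightarrow>\<^sub>M count_space UNIV" for m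
    unfolding \<iota>_def by measurable
  define w where "w n p = (case p of (0, i) \<Rightarrow> a n
    | (Suc m, i) \<Rightarrow> (\<integral>j. \<psi> j * (if \<iota> m j = i then 1 else 0) \<partial>P n))" for n and p :: "nat \<times> nat"
  have P01: "(\<integral>j. \<phi> j \<partial>P n) \<in> {0..1}" if "\<phi> \<in> borel_measurable borel" "\<And>j. 0 \<le> \<phi> j" "\<And>j. \<phi> j \<le> 1" for \<phi> :: "'g \<Rightarrow> real" and n
  proof -
    have "(\<integral>j. \<phi> j \<partial>P n) \<le> (\<integral>j. 1 \<partial>P n)"
      using that by (intro integral_mono P_integrable[of _ 1]) auto
    then show ?thesis
      using that by (simp only: P_const) simp
  qed
  have "w n p \<in> {0..1}" for n p
    unfolding w_def a_def using \<psi>01 by (auto split: prod.split nat.split simp del: atLeastAtMost_iff intro!: P01)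
  then obtain r :: "nat \<Rightarrow> nat" where r: "strict_mono r" and wr: "\<And>p. convergent (\<lambda>n. w (r n) p)"
    using ex_convergent_subsequence_countable[of w] by blast
  have "convergent (\<lambda>n. a (r n))"
    using wr[of "(0, 0)"] by (simp add: w_def)
  then obtain \<alpha> where \<alpha>: "(\<lambda>n. a (r n)) \<longlonglongrightarrow> \<alpha>"
    by (auto simp: convergent_def)
  \<comment> \<open>Finitely many translates of \<open>\<psi>\<close> add up to at least \<open>1 / 2\<close> everywhere.\<close>
  have "\<alpha> > 0"
  proof -
    \<comment> \<open>The weight is at least 1/2 at distance at most \<open>\<delta> / 2\<close>
      from 0, which fixes the mesh of the net.\<close>
    obtain K where K: "finite K" "\<And>j. \<exists>k\<in>K. q j k \<le> \<delta> / 2"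
      using q_tb[of "\<delta> / 2"] \<open>\<delta> > 0\<close> by auto
    have shift_int: "integrable (P n) (\<lambda>j. \<psi> (- k + j))" for n k
      by (rule P_integrable[of _ 1]) (measurable, use \<psi>01 in auto)
    have *: "1 / 2 \<le> (\<Sum>k\<in>K. \<psi> (- k + j))" for j
    proof -
      obtain k where k: "k \<in> K" "q j k \<le> \<delta> / 2"
        using K by blast
      have "q (- k + j) 0 \<le> \<delta> / 2"
        using q_shift[of "- k + j" k 0] k by (simp add: add.commute)
      then have "1 / 2 \<le> \<psi> (- k + j)"
        using \<open>\<delta> > 0\<close> by (simp add: \<psi>_def field_simps max_def)
      also have "\<dots> \<le> (\<Sum>k\<in>K. \<psi> (- k + j))"
        using k K(1) \<psi>01 by (intro member_le_sum) auto
      finally show ?thesis .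
    qed
    have "(\<integral>j. 1 / 2 \<partial>P n) \<le> (\<integral>j. (\<Sum>k\<in>K. \<psi> (- k + j)) \<partial>P n)" for n
    proof (rule integral_mono)
      show "integrable (P n) (\<lambda>j. 1 / 2 :: real)"
        by (rule P_integrable[of _ 1]) auto
      show "integrable (P n) (\<lambda>j. \<Sum>k\<in>K. \<psi> (- k + j))"
        by (intro Bochner_Integration.integrable_sum shift_int)
    qed (rule *)
    then have **: "1 / 2 \<le> (\<Sum>k\<in>K. (\<integral>j. \<psi> (- k + j) \<partial>P n))" for n
      using shift_int by (simp only: P_const) (simp add: Bochner_Integration.integral_sum)
    \<comment> \<open>Asymptotic invariance gives every translate of the weight the same limiting
      mass \<alpha>, so \<open>card K\<close> times \<alpha> is at least 1/2.\<close>
    have "(\<lambda>n. (\<integral>j. \<psi> (- k + j) \<partial>P n) - a n) \<longlonglongrightarrow> 0" for k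
      unfolding a_def by (rule asymptotically_invariant[of _ 1]) (use \<psi>01 in auto)
    then have "(\<lambda>n. ((\<integral>j. \<psi> (- k + j) \<partial>P (r n)) - a (r n)) + a (r n)) \<longlonglongrightarrow> 0 + \<alpha>" for k
      by (intro tendsto_add \<alpha>) (rule LIMSEQ_subseq_LIMSEQ[OF _ r, unfolded o_def])
    then have "(\<lambda>n. \<Sum>k\<in>K. (\<integral>j. \<psi> (- k + j) \<partial>P (r n))) \<longlonglongrightarrow> (\<Sum>k\<in>K. \<alpha>)"
      by (intro tendsto_sum) simp
    then have "1 / 2 \<le> (\<Sum>k\<in>K. \<alpha>)"
      using ** by (intro LIMSEQ_le_const) auto
    show ?thesis
    proof (rule ccontr)
      assume "\<not> \<alpha> > 0"
      then have "(\<Sum>k\<in>K. \<alpha>) \<le> 0"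
        by (intro sum_nonpos) simp
      with \<open>1 / 2 \<le> (\<Sum>k\<in>K. \<alpha>)\<close> show False
        by linarith
    qed
  qed

  have H_int: "integrable M (H n)" for n
    using H_B by (intro integrable_const_bound[where B = B]) auto
  \<comment> \<open>The averages are Cauchy in \<open>L\<^sup>1\<close> along \<open>r\<close>:
    passing to the finite net costs less than \<open>e / 4\<close> at each of the two indices, and
    the resulting finite combinations \<open>A\<close> differ by at most \<open>e / 2\<close>
    uniformly in \<open>x\<close>, because their coefficients converge and \<open>f\<close> is
    bounded.\<close>
  have "\<exists>N0. \<forall>n\<ge>N0. \<forall>n'\<ge>N0. (\<integral>x. norm (H (r n) x - H (r n') x) \<partial>M) < e" if "e > 0" for e
  proof -
    obtain m where m: "1 / real (Suc m) < e / 4"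
      using nat_approx_posE[of "e / 4"] \<open>e > 0\<close> by auto
    define A where "A n x = (\<Sum>i<N m. w n (Suc m, i) * f (T (g m i) x))" for n x
    have [measurable]: "A n \<in> borel_measurable M" for n
      unfolding A_def by measurable
    have \<psi>f_le2: "\<bar>\<psi> j * (f (T j x) - f (T (g m (\<iota> m j)) x))\<bar> \<le> 2 * B" for j x
      using \<psi>f_le[of j "T j x"] \<psi>f_le[of j "T (g m (\<iota> m j)) x"]
      by (simp add: abs_le_iff right_diff_distrib)
    have [measurable]: "(\<lambda>j. g m (\<iota> m j)) \<in> borel \<rightarrow>\<^sub>M borel"
      by (rule measurable_compose[of "\<iota> m" borel "count_space UNIV" "g m"]) measurable
    have A: "A n x = (\<integral>j. \<psi> j * f (T (g m (\<iota> m j)) x) \<partial>P n)" for n x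
    proof -
      have pw: "(\<Sum>i<N m. (\<psi> j * (if \<iota> m j = i then 1 else 0)) * f (T (g m i) x)) =
          \<psi> j * f (T (g m (\<iota> m j)) x)" for j
      proof -
        have "(\<Sum>i<N m. (\<psi> j * (if \<iota> m j = i then 1 else 0)) * f (T (g m i) x)) =
            (\<Sum>i<N m. if \<iota> m j = i then \<psi> j * f (T (g m i) x) else 0)"
          by (intro sum.cong) auto
        then show ?thesis
          using \<iota>(2)[of m j] by simp
      qed
      have "A n x = (\<Sum>i<N m. (\<integral>j. (\<psi> j * (if \<iota> m j = i then 1 else 0)) * f (T (g m i) x) \<partial>P n))"
        by (simp add: A_def w_def)
      also have "\<dots> = (\<integral>j. (\<Sum>i<N m. (\<psi> j * (if \<iota> m j = i then 1 else 0)) * f (T (g m i) x)) \<partial>P n)"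
      proof (rule Bochner_Integration.integral_sum[symmetric])
        show "integrable (P n) (\<lambda>j. (\<psi> j * (if \<iota> m j = i then 1 else 0)) * f (T (g m i) x))" for i
        proof (rule P_integrable[of _ B])
          show "\<bar>(\<psi> j * (if \<iota> m j = i then 1 else 0)) * f (T (g m i) x)\<bar> \<le> B" for j
            using \<psi>f_le[of j "T (g m i) x"] \<open>B \<ge> 0\<close> by simp
        qed measurable
      qed
      also have "\<dots> = (\<integral>j. \<psi> j * f (T (g m (\<iota> m j)) x) \<partial>P n)"
        by (simp only: pw)
      finally show ?thesis .
    qed
    have HA: "(\<integral>x. \<bar>H n x - A n x\<bar> \<partial>M) \<le> 1 / real (Suc m)" for n
    proof -
      have "H n x - A n x = (\<integral>j. \<psi> j * (f (T j x) - f (T (g m (\<iota> m j)) x)) \<partial>P n)" for x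
      proof -
        have "integrable (P n) (\<lambda>j. \<psi> j * f (T j x))"
          by (rule P_integrable[OF _ \<psi>f_le]) measurable
        moreover have "integrable (P n) (\<lambda>j. \<psi> j * f (T (g m (\<iota> m j)) x))"
          by (rule P_integrable[OF _ \<psi>f_le]) measurable
        ultimately show ?thesis
          by (simp add: H_def A right_diff_distrib)
      qed
      then have "(\<integral>x. \<bar>H n x - A n x\<bar> \<partial>M) =
          (\<integral>x. \<bar>\<integral>j. \<psi> j * (f (T j x) - f (T (g m (\<iota> m j)) x)) \<partial>P n\<bar> \<partial>M)"
        by simp
      also have "\<dots> \<le> (\<integral>j. (\<integral>x. \<bar>\<psi> j * (f (T j x) - f (T (g m (\<iota> m j)) x))\<bar> \<partial>M) \<partial>P n)"
        by (rule integral_norm_average_le[OF _ \<psi>f_le2]) measurable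
      also have "\<dots> = (\<integral>j. \<psi> j * q j (g m (\<iota> m j)) \<partial>P n)"
        using \<psi>01 by (simp add: abs_mult q_def)
      also have "\<dots> \<le> (\<integral>j. 1 / real (Suc m) \<partial>P n)"
      proof (rule integral_mono)
        have le: "\<psi> j * q j (g m (\<iota> m j)) \<le> 1 / real (Suc m)" for j
          using mult_mono[OF \<psi>01(2)[of j] \<iota>(1)[of j m]] q_nonneg by simp
        then show "\<And>j. \<psi> j * q j (g m (\<iota> m j)) \<le> 1 / real (Suc m)" .
        show "integrable (P n) (\<lambda>j. 1 / real (Suc m))"
          by (rule P_integrable[of _ "1 / real (Suc m)"]) auto
        show "integrable (P n) (\<lambda>j. \<psi> j * q j (g m (\<iota> m j)))"
        proof (rule P_integrable)
          show "\<bar>\<psi> j * q j (g m (\<iota> m j))\<bar> \<le> 1 / real (Suc m)" for j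
            using le[of j] \<psi>01(1)[of j] q_nonneg[of j "g m (\<iota> m j)"] by (simp only: abs_mult abs_of_nonneg)
          show "(\<lambda>j. \<psi> j * q j (g m (\<iota> m j))) \<in> borel_measurable borel"
            unfolding q_def by measurable
        qed
      qed
      finally show ?thesis
        by (simp only: P_const)
    qed
    obtain l where l: "\<And>i. (\<lambda>n. w (r n) (Suc m, i)) \<longlonglongrightarrow> l i"
      using wr[of "(Suc m, _)"] unfolding convergent_def by metis
    have "(\<lambda>n. \<Sum>i<N m. \<bar>w (r n) (Suc m, i) - l i\<bar> * B) \<longlonglongrightarrow> (\<Sum>i<N m. \<bar>l i - l i\<bar> * B)"
      by (intro tendsto_intros l)
    then have "\<forall>\<^sub>F n in sequentially. (\<Sum>i<N m. \<bar>w (r n) (Suc m, i) - l i\<bar> * B) < e / 4"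
      by (rule order_tendstoD) (use \<open>e > 0\<close> in simp)
    then obtain N0 where N0: "\<And>n. n \<ge> N0 \<Longrightarrow> (\<Sum>i<N m. \<bar>w (r n) (Suc m, i) - l i\<bar> * B) < e / 4"
      by (auto simp: eventually_sequentially)
    have A_int: "integrable M (A n)" for n
    proof -
      have "integrable M (\<lambda>x. f (T k x))" for k
        using B by (intro integrable_const_bound[where B = B]) auto
      then show ?thesis
        unfolding A_def[abs_def] by (intro Bochner_Integration.integrable_sum integrable_mult_right)
    qed
    have "(\<integral>x. norm (H (r n) x - H (r n') x) \<partial>M) < e" if n: "n \<ge> N0" "n' \<ge> N0" for n n'
    proof -
      have AA: "\<bar>A (r n) x - A (r n') x\<bar> \<le> e / 2" for x
      proof -
        have "A (r n) x - A (r n') x = (\<Sum>i<N m. (w (r n) (Suc m, i) - w (r n') (Suc m, i)) * f (T (g m i) x))"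
          by (simp add: A_def left_diff_distrib sum_subtractf)
        also have "\<bar>\<dots>\<bar> \<le> (\<Sum>i<N m. \<bar>(w (r n) (Suc m, i) - w (r n') (Suc m, i)) * f (T (g m i) x)\<bar>)"
          by (rule sum_abs)
        also have "\<dots> \<le> (\<Sum>i<N m. \<bar>w (r n) (Suc m, i) - l i\<bar> * B + \<bar>w (r n') (Suc m, i) - l i\<bar> * B)"
        proof (rule sum_mono)
          fix i
          have "\<bar>w (r n) (Suc m, i) - w (r n') (Suc m, i)\<bar> \<le>
              \<bar>w (r n) (Suc m, i) - l i\<bar> + \<bar>w (r n') (Suc m, i) - l i\<bar>"
            by linarith
          from mult_mono[OF this B[of "T (g m i) x"]]
          show "\<bar>(w (r n) (Suc m, i) - w (r n') (Suc m, i)) * f (T (g m i) x)\<bar> \<le>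
              \<bar>w (r n) (Suc m, i) - l i\<bar> * B + \<bar>w (r n') (Suc m, i) - l i\<bar> * B"
            by (simp add: abs_mult distrib_right)
        qed
        finally show ?thesis
          using N0[OF n(1)] N0[OF n(2)] by (simp add: sum.distrib)
      qed
      have "(\<integral>x. norm (H (r n) x - H (r n') x) \<partial>M) \<le>
          (\<integral>x. \<bar>H (r n) x - A (r n) x\<bar> + \<bar>H (r n') x - A (r n') x\<bar> + e / 2 \<partial>M)"
      proof (rule integral_mono)
        show "norm (H (r n) x - H (r n') x) \<le> \<bar>H (r n) x - A (r n) x\<bar> + \<bar>H (r n') x - A (r n') x\<bar> + e / 2" for x
          using AA[of x] unfolding real_norm_def by linarith
      qed (use H_int A_int in auto)
      also have "\<dots> = (\<integral>x. \<bar>H (r n) x - A (r n) x\<bar> \<partial>M) + (\<integral>x. \<bar>H (r n') x - A (r n') x\<bar> \<partial>M) + e / 2"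
        using H_int A_int prob_space by simp
      also have "\<dots> < e"
        using HA[of "r n"] HA[of "r n'"] m by linarith
      finally show ?thesis .
    qed
    then show ?thesis
      by blast
  qed
  then obtain s where s: "strict_mono s" and Cs: "AE x in M. Cauchy (\<lambda>i. H (r (s i)) x)"
    using cauchy_L1_AE_cauchy_subseq[of M "\<lambda>n. H (r n)", OF H_int] by blast
  define t where "t i = r (s i)" for i
  have t: "strict_mono t"
    using strict_mono_o[OF r s] by (simp add: t_def[abs_def] o_def)
  \<comment> \<open>Where the averages diverge, \<open>lim\<close> is an arbitrary number; clipping
    makes the bound \<open>B\<close> hold everywhere and changes nothing where they
    converge.\<close>
  define h where "h x = max (- B) (min B (lim (\<lambda>i. H (t i) x)))" for x
  have h_meas [measurable]: "h \<in> borel_measurable M"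
    unfolding h_def by measurable
  have h_B: "\<bar>h x\<bar> \<le> B" for x
    using \<open>B \<ge> 0\<close> by (auto simp: h_def)
  have h: "AE x in M. (\<lambda>i. H (t i) x) \<longlonglongrightarrow> h x"
    using Cs
  proof eventually_elim
    case (elim x)
    then have *: "(\<lambda>i. H (t i) x) \<longlonglongrightarrow> lim (\<lambda>i. H (t i) x)"
      by (simp add: t_def Cauchy_convergent_iff convergent_LIMSEQ_iff)
    have "\<bar>lim (\<lambda>i. H (t i) x)\<bar> \<le> B"
      by (rule tendsto_upperbound[OF tendsto_rabs[OF *]]) (use H_B in auto)
    then have "h x = lim (\<lambda>i. H (t i) x)"
      by (auto simp: h_def)
    then show ?case
      using * by simp
  qed
  have a_t: "(\<lambda>i. a (t i)) \<longlonglongrightarrow> \<alpha>"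
    using LIMSEQ_subseq_LIMSEQ[OF \<alpha> s] by (simp add: t_def o_def)
  have "(\<lambda>i. (\<integral>x. \<bar>H (t i) x - a (t i) * f x\<bar> \<partial>M)) \<longlonglongrightarrow> (\<integral>x. \<bar>h x - \<alpha> * f x\<bar> \<partial>M)"
  proof (rule integral_dominated_convergence[where w = "\<lambda>_. 2 * B"])
    show "AE x in M. (\<lambda>i. \<bar>H (t i) x - a (t i) * f x\<bar>) \<longlonglongrightarrow> \<bar>h x - \<alpha> * f x\<bar>"
      using h by eventually_elim (intro tendsto_intros a_t)
    have af: "\<bar>a n * f x\<bar> \<le> B" for n x
      using mult_mono[of "a n" 1 "\<bar>f x\<bar>" B] P01[of \<psi> n] \<psi>01 B[of x] by (simp add: a_def abs_mult)
    have "\<bar>H n x - a n * f x\<bar> \<le> 2 * B" for n x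
      using abs_triangle_ineq4[of "H n x" "a n * f x"] H_B[of n x] af[of n x] by linarith
    then show "AE x in M. norm \<bar>H (t i) x - a (t i) * f x\<bar> \<le> 2 * B" for i
      by simp
  qed measurable
  then have "(\<integral>x. \<bar>h x - \<alpha> * f x\<bar> \<partial>M) \<le> \<delta> * \<alpha>"
    by (rule LIMSEQ_le[OF _ tendsto_mult_left[OF a_t]]) (use near in auto)
  moreover
  have "AE x in M. \<bar>h (T j x) - h (T k x)\<bar> \<le> B / \<delta> * q j k" for j k
    using AE_T[OF h, of j] AE_T[OF h, of k]
  proof eventually_elim
    case (elim x)
    \<comment> \<open>Substituting \<open>k + j\<close> for the variable moves the translation from
      the point to the weight: \<open>\<phi> k\<close> is the integrand of the average at
      \<open>T k x\<close> after this change, and asymptotic invariance says that the change is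
      harmless in the limit.\<close>
    define \<phi> where "\<phi> k i = \<psi> (- k + i) * f (T i x)" for k i
    have [measurable]: "\<phi> k \<in> borel_measurable borel" for k
      unfolding \<phi>_def by measurable
    have \<phi>_B: "\<bar>\<phi> k i\<bar> \<le> B" for k i
      unfolding \<phi>_def by (rule \<psi>f_le)
    have lim: "(\<lambda>i. (\<integral>j. \<phi> k j \<partial>P (t i))) \<longlonglongrightarrow> h (T k x)"
      if "(\<lambda>i. H (t i) (T k x)) \<longlonglongrightarrow> h (T k x)" for k
    proof -
      have "H n (T k x) = (\<integral>j. \<phi> k (k + j) \<partial>P n)" for n
        by (simp add: H_def \<phi>_def T_plus T_commute[of k])
      moreover have "(\<lambda>n. (\<integral>j. \<phi> k (k + j) \<partial>P n) - (\<integral>j. \<phi> k j \<partial>P n)) \<longlonglongrightarrow> 0"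
        by (rule asymptotically_invariant[OF _ \<phi>_B]) measurable
      ultimately have "(\<lambda>i. H (t i) (T k x) - (\<integral>j. \<phi> k j \<partial>P (t i))) \<longlonglongrightarrow> 0"
        using LIMSEQ_subseq_LIMSEQ[OF _ t] by (fastforce simp: o_def)
      from tendsto_diff[OF that this] show ?thesis
        by simp
    qed
    have "\<bar>(\<integral>i. \<phi> j i \<partial>P n) - (\<integral>i. \<phi> k i \<partial>P n)\<bar> \<le> B / \<delta> * q j k" for n
    proof -
      have int: "integrable (P n) (\<phi> k)" for k
        by (rule P_integrable[OF _ \<phi>_B]) measurable
      have le: "\<bar>\<phi> j i - \<phi> k i\<bar> \<le> B / \<delta> * q j k" for i
        using mult_mono[OF \<psi>_lipschitz[of j i k] B[of "T i x"]] q_nonneg[of j k] \<open>\<delta> > 0\<close>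
        by (simp add: \<phi>_def abs_mult mult.commute flip: left_diff_distrib)
      have "\<bar>(\<integral>i. \<phi> j i - \<phi> k i \<partial>P n)\<bar> \<le> (\<integral>i. \<bar>\<phi> j i - \<phi> k i\<bar> \<partial>P n)"
        by (rule integral_abs_bound)
      also have "\<dots> \<le> (\<integral>i. B / \<delta> * q j k \<partial>P n)"
      proof (rule integral_mono)
        show "integrable (P n) (\<lambda>i. B / \<delta> * q j k)"
          by (rule P_integrable[of _ "\<bar>B / \<delta> * q j k\<bar>"]) simp_all
      qed (use int le in auto)
      finally show ?thesis
        using int by (simp only: P_const) simp
    qed
    then show ?case
      using tendsto_rabs[OF tendsto_diff[OF lim[OF elim(1)] lim[OF elim(2)]]]
      by (intro LIMSEQ_le_const2) auto
  qed
  ultimately show ?thesis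
    using that[of h \<alpha>] h_B \<open>\<alpha> > 0\<close> h_meas by (simp add: q_def)
qed

end

section \<open>Reduction from square-integrable complex functions to bounded real ones\<close>

text \<open>Truncation, real part and imaginary part are contractions, so \<open>g\<close> may be
  any of them applied to \<open>f\<close>.\<close>

lemma totally_bounded_orbit_1_mono:
  assumes f: "totally_bounded_orbit M T 1 f"
    and int: "\<And>j k. integrable M (\<lambda>x. norm (f (T j x) - f (T k x)))"
    and le: "\<And>x y. norm (g x - g y) \<le> norm (f x - f y)"
  shows "totally_bounded_orbit M T 1 g"
  unfolding totally_bounded_orbit_def
proof (intro allI impI)
  fix e :: real
  assume "e > 0"
  then obtain K where K: "finite K" "\<And>j. \<exists>k\<in>K. (\<integral>x. norm (f (T j x) - f (T k x)) ^ 1 \<partial>M) \<le> e"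
    using f unfolding totally_bounded_orbit_def by blast
  have "(\<integral>x. norm (g (T j x) - g (T k x)) ^ 1 \<partial>M) \<le> (\<integral>x. norm (f (T j x) - f (T k x)) ^ 1 \<partial>M)" for j k
    using int[of j k] le by (intro integral_mono') auto
  then show "\<exists>K. finite K \<and> (\<forall>j. \<exists>k\<in>K. (\<integral>x. norm (g (T j x) - g (T k x)) ^ 1 \<partial>M) \<le> e)"
    using K by (meson order_trans)
qed

lemma (in prob_space) integrable_norm_of_square:
  fixes f :: "'a \<Rightarrow> 'b::{banach, second_countable_topology}"
  assumes "f \<in> borel_measurable M" "integrable M (\<lambda>x. (norm (f x))\<^sup>2)"
  shows "integrable M f"
proof (rule Bochner_Integration.integrable_bound)
  show "integrable M (\<lambda>x. 1 + (norm (f x))\<^sup>2)"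
    using assms by simp
  have "t \<le> 1 + t\<^sup>2" for t :: real
    using sum_power2_ge_zero[of "t - 1 / 2" 0] by (simp add: power2_eq_square algebra_simps)
  then show "AE x in M. norm (f x) \<le> norm (1 + (norm (f x))\<^sup>2)"
    by simp
qed fact

text \<open>Cauchy-Schwarz against the constant 1, in the form that a variance is
  nonnegative.\<close>

lemma (in prob_space) integral_norm_le_sqrt:
  fixes f :: "'a \<Rightarrow> 'b::{banach, second_countable_topology}"
  assumes "f \<in> borel_measurable M" "integrable M (\<lambda>x. (norm (f x))\<^sup>2)"
  shows "(\<integral>x. norm (f x) \<partial>M) \<le> sqrt (\<integral>x. (norm (f x))\<^sup>2 \<partial>M)"
proof -
  have "integrable M f"
    using assms by (rule integrable_norm_of_square)
  then have "0 \<le> (\<integral>x. (norm (f x))\<^sup>2 \<partial>M) - (\<integral>x. norm (f x) \<partial>M)\<^sup>2"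
    using variance_positive[of "\<lambda>x. norm (f x)"] variance_eq[of "\<lambda>x. norm (f x)"] assms by simp
  then show ?thesis
    by (intro real_le_rsqrt) simp
qed

context folner_ergodic begin

lemma coded_of_bounded:
  fixes f :: "'x \<Rightarrow> real"
  assumes f [measurable]: "f \<in> borel_measurable M" and B: "\<And>x. \<bar>f x\<bar> \<le> B"
    and tb: "totally_bounded_orbit M T 1 f" and "e > 0"
  shows "coded f e"
proof -
  have "B \<ge> 0"
    using B[of undefined] by linarith
  obtain h :: "'x \<Rightarrow> real" and a :: real
    where h [measurable]: "h \<in> borel_measurable M" and hB: "\<And>x. \<bar>h x\<bar> \<le> B" and "a > 0"
      and near: "(\<integral>x. \<bar>h x - a * f x\<bar> \<partial>M) \<le> e / 8 * a"
      and modulus: "\<And>j k. AE x in M. \<bar>h (T j x) - h (T k x)\<bar> \<le> B / (e / 8) * (\<integral>x. \<bar>f (T j x) - f (T k x)\<bar> \<partial>M)"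
    \<comment> \<open>With this choice \<open>h x / a\<close> is within \<open>e / 8\<close> of
      \<open>f\<close> in \<open>L\<^sup>1\<close>, hence strictly within \<open>e / 4\<close>,
      which \<open>coded_approx\<close> counts twice; the other \<open>e / 2\<close> goes to the
      code of \<open>h x / a\<close>.\<close>
    using ex_orbit_average[OF f B tb, of "e / 8"] \<open>e > 0\<close> by auto
  define C where "C = B / (e / 8) / a"
  have "C \<ge> 0"
    using \<open>B \<ge> 0\<close> \<open>e > 0\<close> \<open>a > 0\<close> by (simp add: C_def)
  have "coded (\<lambda>x. h x / a) (e / 2)"
  proof (rule coded_of_orbit_modulus)
    show "\<bar>h x / a\<bar> \<le> B / a" for x
      using hB[of x] \<open>a > 0\<close> by (simp add: divide_right_mono)
    show "(\<lambda>j. C * (\<integral>x. \<bar>f (T j x) - f (T k x)\<bar> \<partial>M)) \<in> borel_measurable borel" for k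
      by measurable
    show "AE x in M. \<bar>h (T j x) / a - h (T k x) / a\<bar> \<le> C * (\<integral>x. \<bar>f (T j x) - f (T k x)\<bar> \<partial>M)" for j k
      using modulus[of j k]
    proof eventually_elim
      case (elim x)
      have "\<bar>h (T j x) / a - h (T k x) / a\<bar> = \<bar>h (T j x) - h (T k x)\<bar> / a"
        using \<open>a > 0\<close> by (simp flip: diff_divide_distrib)
      also have "\<dots> \<le> B / (e / 8) * (\<integral>x. \<bar>f (T j x) - f (T k x)\<bar> \<partial>M) / a"
        using elim \<open>a > 0\<close> by (intro divide_right_mono) auto
      finally show ?case
        by (simp add: C_def)
    qed
    fix d :: real
    assume "d > 0"
    \<comment> \<open>Division by \<open>C + 1\<close> covers the case \<open>C = 0\<close>, which
      occurs when \<open>B = 0\<close>.\<close>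
    then have "d / (C + 1) > 0"
      using \<open>C \<ge> 0\<close> by simp
    then obtain K where K: "finite K" "\<And>j. \<exists>k\<in>K. (\<integral>x. \<bar>f (T j x) - f (T k x)\<bar> \<partial>M) \<le> d / (C + 1)"
      using tb unfolding totally_bounded_orbit_def by (metis (mono_tags, lifting) power_one_right real_norm_def Bochner_Integration.integral_cong)
    have Cq: "C * q \<le> d" if "q \<le> d / (C + 1)" for q
    proof -
      have "C * q \<le> C * (d / (C + 1))"
        using that \<open>C \<ge> 0\<close> by (rule mult_left_mono)
      also have "\<dots> \<le> d"
        using \<open>C \<ge> 0\<close> \<open>d > 0\<close> by (simp add: field_simps)
      finally show ?thesis .
    qed
    show "\<exists>K. finite K \<and> (\<forall>j. \<exists>k\<in>K. C * (\<integral>x. \<bar>f (T j x) - f (T k x)\<bar> \<partial>M) \<le> d)"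
    proof (intro exI conjI allI)
      fix j
      obtain k where "k \<in> K" "(\<integral>x. \<bar>f (T j x) - f (T k x)\<bar> \<partial>M) \<le> d / (C + 1)"
        using K(2) by blast
      then show "\<exists>k\<in>K. C * (\<integral>x. \<bar>f (T j x) - f (T k x)\<bar> \<partial>M) \<le> d"
        by (intro bexI[of _ k] Cq)
    qed (rule K(1))
  qed (use \<open>e > 0\<close> in auto)
  moreover have "integrable M f"
    using B by (intro integrable_const_bound[where B = B]) auto
  moreover have "integrable M (\<lambda>x. h x / a)"
    using hB by (intro integrable_divide integrable_const_bound[where B = B]) auto
  moreover have "(\<integral>x. norm (f x - h x / a) \<partial>M) < e / 4"
  proof -
    have "norm (f x - h x / a) = \<bar>h x - a * f x\<bar> / a" for x
      using \<open>a > 0\<close> by (simp add: abs_minus_commute field_simps abs_if)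
    then have "(\<integral>x. norm (f x - h x / a) \<partial>M) = (\<integral>x. \<bar>h x - a * f x\<bar> \<partial>M) / a"
      by simp
    also have "\<dots> \<le> e / 8"
      using near \<open>a > 0\<close> by (simp add: pos_divide_le_eq)
    finally show ?thesis
      using \<open>e > 0\<close> by simp
  qed
  ultimately have "coded f (e / 2 + 2 * (e / 4))"
    by (rule coded_approx)
  then show ?thesis
    by simp
qed

text \<open>Truncations approximate \<open>f\<close> in \<open>L\<^sup>1\<close> and, being
  contractions of it, keep the orbit totally bounded.\<close>

lemma coded_of_integrable:
  fixes f :: "'x \<Rightarrow> real"
  assumes f: "integrable M f" and tb: "totally_bounded_orbit M T 1 f" and "e > 0"
  shows "coded f e"
proof -
  have [measurable]: "f \<in> borel_measurable M"
    using f by simp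
  define g where "g n x = max (- real n) (min (real n) (f x))" for n x
  have [measurable]: "g n \<in> borel_measurable M" for n
    unfolding g_def by measurable
  have gB: "\<bar>g n x\<bar> \<le> real n" for n x
    by (auto simp: g_def)
  have "(\<lambda>n. (\<integral>x. norm (f x - g n x) \<partial>M)) \<longlonglongrightarrow> (\<integral>x. 0 \<partial>M)"
  proof (rule integral_dominated_convergence[where w = "\<lambda>x. norm (f x)"])
    show "AE x in M. (\<lambda>n. norm (f x - g n x)) \<longlonglongrightarrow> 0"
    proof (rule AE_I2)
      fix x
      obtain n0 where n0: "\<bar>f x\<bar> \<le> real n0"
        using real_arch_simple by blast
      have "norm (f x - g n x) = 0" if "n \<ge> n0" for n
      proof -
        have "\<bar>f x\<bar> \<le> real n"
          using n0 that by linarith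
        then show ?thesis
          by (simp add: g_def)
      qed
      then show "(\<lambda>n. norm (f x - g n x)) \<longlonglongrightarrow> 0"
        by (intro tendsto_eventually eventually_sequentiallyI[of n0])
    qed
    show "AE x in M. norm (norm (f x - g n x)) \<le> norm (f x)" for n
      by (auto simp: g_def)
  qed (use f in auto)
  then have "\<forall>\<^sub>F n in sequentially. (\<integral>x. norm (f x - g n x) \<partial>M) < e / 4"
    by (rule order_tendstoD) (use \<open>e > 0\<close> in simp)
  then obtain n where n: "(\<integral>x. norm (f x - g n x) \<partial>M) < e / 4"
    by (auto simp: eventually_sequentially)
  have "totally_bounded_orbit M T 1 (g n)"
  proof (rule totally_bounded_orbit_1_mono[OF tb])
    show "norm (g n x - g n y) \<le> norm (f x - f y)" for x y
      by (auto simp: g_def)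
    show "integrable M (\<lambda>x. norm (f (T j x) - f (T k x)))" for j k
      using integrable_T_iff[of f] f by simp
  qed
  then have "coded (g n) (e / 2)"
    using gB \<open>e > 0\<close> by (intro coded_of_bounded) auto
  moreover have "integrable M (g n)"
    using gB by (intro integrable_const_bound[where B = "real n"]) auto
  ultimately have "coded f (e / 2 + 2 * (e / 4))"
    using f n by (intro coded_approx)
  then show ?thesis by simp
qed

text \<open>On a probability space the \<open>L\<^sup>1\<close> norm is at most the
  \<open>L\<^sup>2\<close> norm, so total boundedness passes from exponent 2 to exponent 1, where
  real and imaginary parts can be treated separately.\<close>

lemma coded_of_totally_bounded_orbit:
  fixes f :: "'x \<Rightarrow> complex"
  assumes f [measurable]: "f \<in> borel_measurable M" and int: "integrable M (\<lambda>x. (norm (f x))\<^sup>2)"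
    and tb: "totally_bounded_orbit M T 2 f" and "e > 0"
  shows "coded f e"
proof -
  have fint: "integrable M f"
    using integrable_norm_of_square[OF f int] .
  then have dint: "integrable M (\<lambda>x. norm (f (T j x) - f (T k x)))" for j k
    using integrable_T_iff[of f] by simp
  have dint2: "integrable M (\<lambda>x. (norm (f (T j x) - f (T k x)))\<^sup>2)" for j k
    using integrable_T_iff[of "\<lambda>x. (norm (f x))\<^sup>2"] int by (intro integrable_norm_diff_square) auto
  have tb1: "totally_bounded_orbit M T 1 f"
    unfolding totally_bounded_orbit_def
  proof (intro allI impI)
    fix d :: real
    assume "d > 0"
    then obtain K where K: "finite K" "\<And>j. \<exists>k\<in>K. (\<integral>x. norm (f (T j x) - f (T k x)) ^ 2 \<partial>M) \<le> d\<^sup>2"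
      using tb unfolding totally_bounded_orbit_def by (metis zero_less_power)
    have *: "(\<integral>x. norm (f (T j x) - f (T k x)) ^ 1 \<partial>M) \<le> d"
      if "(\<integral>x. norm (f (T j x) - f (T k x)) ^ 2 \<partial>M) \<le> d\<^sup>2" for j k
    proof -
      have "(\<integral>x. norm (f (T j x) - f (T k x)) ^ 1 \<partial>M) \<le> sqrt (\<integral>x. (norm (f (T j x) - f (T k x)))\<^sup>2 \<partial>M)"
        using integral_norm_le_sqrt[OF _ dint2[of j k]] by simp
      also have "\<dots> \<le> d"
        using that \<open>d > 0\<close> by (intro real_le_lsqrt) auto
      finally show ?thesis .
    qed
    show "\<exists>K. finite K \<and> (\<forall>j. \<exists>k\<in>K. (\<integral>x. norm (f (T j x) - f (T k x)) ^ 1 \<partial>M) \<le> d)"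
    proof (intro exI conjI allI)
      fix j
      obtain k where "k \<in> K" "(\<integral>x. norm (f (T j x) - f (T k x)) ^ 2 \<partial>M) \<le> d\<^sup>2"
        using K(2) by blast
      then show "\<exists>k\<in>K. (\<integral>x. norm (f (T j x) - f (T k x)) ^ 1 \<partial>M) \<le> d"
        by (intro bexI[of _ k] *)
    qed (rule K(1))
  qed
  have "coded (\<lambda>x. Re (f x)) (e / 2)"
  proof (rule coded_of_integrable)
    show "totally_bounded_orbit M T 1 (\<lambda>x. Re (f x))"
      by (rule totally_bounded_orbit_1_mono[OF tb1 dint]) (use abs_Re_le_cmod[of "f _ - f _"] in simp)
  qed (use fint \<open>e > 0\<close> in auto)
  moreover have "coded (\<lambda>x. Im (f x)) (e / 2)"
  proof (rule coded_of_integrable)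
    show "totally_bounded_orbit M T 1 (\<lambda>x. Im (f x))"
      by (rule totally_bounded_orbit_1_mono[OF tb1 dint]) (use abs_Im_le_cmod[of "f _ - f _"] in simp)
  qed (use fint \<open>e > 0\<close> in auto)
  ultimately have "coded f (e / 2 + e / 2)"
    by (rule coded_combine[OF _ _ f]) (use cmod_le[of "f _ - f _"] in simp)
  then show ?thesis by simp
qed

end

section \<open>The space of square-integrable functions\<close>

text \<open>With \<open>a\<close> and \<open>b\<close> the two norms, the pointwise bound by
  \<open>(1 + b / a) * (norm z)\<^sup>2 + (1 + a / b) * (norm w)\<^sup>2\<close> integrates to
  exactly the square of \<open>a + b\<close>.\<close>

lemma minkowski_square:
  fixes f g :: "'a \<Rightarrow> complex"
  assumes [measurable]: "f \<in> borel_measurable M" "g \<in> borel_measurable M"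
    and f: "integrable M (\<lambda>x. (norm (f x))\<^sup>2)" and g: "integrable M (\<lambda>x. (norm (g x))\<^sup>2)"
  shows "sqrt (\<integral>x. (norm (f x - g x))\<^sup>2 \<partial>M) \<le>
    sqrt (\<integral>x. (norm (f x))\<^sup>2 \<partial>M) + sqrt (\<integral>x. (norm (g x))\<^sup>2 \<partial>M)"
proof (rule field_le_epsilon)
  fix e :: real
  assume "e > 0"
  \<comment> \<open>The extra \<open>e / 2\<close> keeps \<open>a\<close> and \<open>b\<close>
    positive, so that both quotients make sense even if a norm is 0.\<close>
  define a where "a = sqrt (\<integral>x. (norm (f x))\<^sup>2 \<partial>M) + e / 2"
  define b where "b = sqrt (\<integral>x. (norm (g x))\<^sup>2 \<partial>M) + e / 2"
  have pos: "a > 0" "b > 0"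
    using \<open>e > 0\<close> by (auto simp: a_def b_def add_nonneg_pos)
  have sq: "(\<integral>x. (norm (f x))\<^sup>2 \<partial>M) \<le> a\<^sup>2" "(\<integral>x. (norm (g x))\<^sup>2 \<partial>M) \<le> b\<^sup>2"
    using \<open>e > 0\<close> by (auto simp: a_def b_def intro!: sqrt_le_D)
  have le: "(norm (z - w))\<^sup>2 \<le> (1 + b / a) * (norm z)\<^sup>2 + (1 + a / b) * (norm w)\<^sup>2" for z w :: complex
  proof -
    have "2 * norm z * norm w \<le> b / a * (norm z)\<^sup>2 + a / b * (norm w)\<^sup>2"
      using sum_squares_bound[of "sqrt (b / a) * norm z" "sqrt (a / b) * norm w"] pos
      by (simp add: power_mult_distrib power_divide real_sqrt_divide)
    moreover have "(norm (z - w))\<^sup>2 \<le> (norm z + norm w)\<^sup>2"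
      by (simp add: norm_triangle_ineq4 power_mono)
    ultimately show ?thesis
      by (simp add: power2_sum algebra_simps)
  qed
  have "(\<integral>x. (norm (f x - g x))\<^sup>2 \<partial>M) \<le>
      (\<integral>x. (1 + b / a) * (norm (f x))\<^sup>2 + (1 + a / b) * (norm (g x))\<^sup>2 \<partial>M)"
    using f g le by (intro integral_mono integrable_norm_diff_square) auto
  also have "\<dots> = (1 + b / a) * (\<integral>x. (norm (f x))\<^sup>2 \<partial>M) + (1 + a / b) * (\<integral>x. (norm (g x))\<^sup>2 \<partial>M)"
    using f g by simp
  also have "\<dots> \<le> (1 + b / a) * a\<^sup>2 + (1 + a / b) * b\<^sup>2"
    using sq pos by (intro add_mono mult_left_mono) auto
  also have "\<dots> = (a + b)\<^sup>2"
    using pos by (simp add: field_simps power2_eq_square)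
  finally have "sqrt (\<integral>x. (norm (f x - g x))\<^sup>2 \<partial>M) \<le> a + b"
    using pos by (intro real_le_lsqrt) auto
  then show "sqrt (\<integral>x. (norm (f x - g x))\<^sup>2 \<partial>M) \<le>
      sqrt (\<integral>x. (norm (f x))\<^sup>2 \<partial>M) + sqrt (\<integral>x. (norm (g x))\<^sup>2 \<partial>M) + e"
    by (simp add: a_def b_def)
qed

lemma L2_dist_class:
  assumes f: "f \<in> L2_fun M" and g: "g \<in> L2_fun M"
  shows "L2_dist M (L2_class M f) (L2_class M g) = sqrt (\<integral>x. (norm (f x - g x))\<^sup>2 \<partial>M)"
proof -
  have rep: "(SOME h. h \<in> L2_class M u) \<in> L2_class M u" if "u \<in> L2_fun M" for u
    by (rule someI[of _ u]) (use that in \<open>simp add: L2_class_def\<close>)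
  from rep[OF f] rep[OF g] have
    "(SOME h. h \<in> L2_class M f) \<in> borel_measurable M" "(SOME h. h \<in> L2_class M g) \<in> borel_measurable M"
    "AE x in M. (SOME h. h \<in> L2_class M f) x = f x" "AE x in M. (SOME h. h \<in> L2_class M g) x = g x"
    by (auto simp: L2_class_def L2_fun_def)
  moreover have "f \<in> borel_measurable M" "g \<in> borel_measurable M"
    using f g by (auto simp: L2_fun_def)
  ultimately show ?thesis
    unfolding L2_dist_def by (intro arg_cong[where f = sqrt] integral_cong_AE) auto
qed

lemma L2_class_eq_iff:
  assumes f: "f \<in> L2_fun M" and g: "g \<in> L2_fun M"
  shows "L2_class M f = L2_class M g \<longleftrightarrow> (AE x in M. f x = g x)"
proof
  assume "L2_class M f = L2_class M g"
  then have "f \<in> L2_class M g"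
    using f by (auto simp: L2_class_def)
  then show "AE x in M. f x = g x"
    by (simp add: L2_class_def)
next
  assume *: "AE x in M. f x = g x"
  show "L2_class M f = L2_class M g"
    unfolding L2_class_def using * by (auto elim: eventually_elim2)
qed

lemma L2_spaceE:
  assumes "p \<in> L2_space M"
  obtains f where "f \<in> L2_fun M" "p = L2_class M f"
  using assms by (auto simp: L2_space_def)

lemma integrable_L2_diff:
  assumes "f \<in> L2_fun M" "g \<in> L2_fun M"
  shows "integrable M (\<lambda>x. (norm (f x - g x))\<^sup>2)"
  using assms by (intro integrable_norm_diff_square) (auto simp: L2_fun_def)

lemma Metric_space_L2: "Metric_space (L2_space M) (L2_dist M)"
proof
  fix p q
  show "0 \<le> L2_dist M p q" "L2_dist M p q = L2_dist M q p"
    by (simp_all add: L2_dist_def norm_minus_commute)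
next
  fix p q
  assume "p \<in> L2_space M" "q \<in> L2_space M"
  then obtain f g where f: "f \<in> L2_fun M" "p = L2_class M f" and g: "g \<in> L2_fun M" "q = L2_class M g"
    by (metis L2_spaceE)
  have "L2_dist M p q = 0 \<longleftrightarrow> (AE x in M. (norm (f x - g x))\<^sup>2 = 0)"
    using f g integral_nonneg_eq_0_iff_AE[OF integrable_L2_diff[OF f(1) g(1)]]
    by (simp add: L2_dist_class)
  then show "L2_dist M p q = 0 \<longleftrightarrow> p = q"
    using f g by (simp add: L2_class_eq_iff)
next
  fix p q r
  assume "p \<in> L2_space M" "q \<in> L2_space M" "r \<in> L2_space M"
  then obtain f g h where f: "f \<in> L2_fun M" "p = L2_class M f" and g: "g \<in> L2_fun M" "q = L2_class M g"
    and h: "h \<in> L2_fun M" "r = L2_class M h"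
    by (metis L2_spaceE)
  have [measurable]: "f \<in> borel_measurable M" "g \<in> borel_measurable M" "h \<in> borel_measurable M"
    using f g h by (auto simp: L2_fun_def)
  show "L2_dist M p r \<le> L2_dist M p q + L2_dist M q r"
    using minkowski_square[OF _ _ integrable_L2_diff[OF f(1) g(1)] integrable_L2_diff[OF h(1) g(1)]] f g h
    by (simp add: L2_dist_class norm_minus_commute[of "h _"])
qed

text \<open>The Riesz-Fischer argument: a Cauchy sequence in \<open>L\<^sup>2\<close> is Cauchy in
  \<open>L\<^sup>1\<close>, hence has a subsequence converging almost everywhere, and Fatou's lemma
  shows that its limit is also the limit in \<open>L\<^sup>2\<close>.\<close>

lemma (in prob_space) mcomplete_L2: "Metric_space.mcomplete (L2_space M) (L2_dist M)"
proof -
  interpret L2: Metric_space "L2_space M" "L2_dist M"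
    by (rule Metric_space_L2)
  show ?thesis
    unfolding L2.mcomplete_def
  proof (intro allI impI)
    fix \<sigma>
    assume C: "L2.MCauchy \<sigma>"
    then have "\<forall>n. \<exists>f. f \<in> L2_fun M \<and> \<sigma> n = L2_class M f"
      unfolding L2.MCauchy_def by (metis L2_spaceE range_subsetD)
    then obtain f where f: "\<And>n. f n \<in> L2_fun M" and \<sigma>: "\<And>n. \<sigma> n = L2_class M (f n)"
      by metis
    have [measurable]: "f n \<in> borel_measurable M" for n
      using f by (simp add: L2_fun_def)
    have int: "integrable M (\<lambda>x. (norm (f i x - f j x))\<^sup>2)" for i j
      by (rule integrable_L2_diff[OF f f])
    have C': "\<exists>N. \<forall>i\<ge>N. \<forall>j\<ge>N. sqrt (\<integral>x. (norm (f i x - f j x))\<^sup>2 \<partial>M) < e" if "e > 0" for e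
      using C that unfolding L2.MCauchy_def \<sigma> by (simp add: L2_dist_class f)
    have L1: "\<exists>N. \<forall>i\<ge>N. \<forall>j\<ge>N. (\<integral>x. norm (f i x - f j x) \<partial>M) < e" if "e > 0" for e
    proof -
      have "(\<integral>x. norm (f i x - f j x) \<partial>M) \<le> sqrt (\<integral>x. (norm (f i x - f j x))\<^sup>2 \<partial>M)" for i j
        by (rule integral_norm_le_sqrt[OF _ int]) measurable
      then show ?thesis
        using C'[OF that] by (meson le_less_trans)
    qed
    have fint: "integrable M (f n)" for n
      using f[of n] by (simp add: L2_fun_def integrable_norm_of_square)
    obtain r where r: "strict_mono r" and AEC: "AE x in M. Cauchy (\<lambda>i. f (r i) x)"
      by (rule cauchy_L1_AE_cauchy_subseq[of M f, OF fint L1])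
    define F where "F x = lim (\<lambda>i. f (r i) x)" for x
    have [measurable]: "F \<in> borel_measurable M"
      unfolding F_def by measurable
    have lim: "AE x in M. (\<lambda>i. f (r i) x) \<longlonglongrightarrow> F x"
      using AEC by eventually_elim (simp add: F_def Cauchy_convergent_iff convergent_LIMSEQ_iff)
    have fatou: "(\<integral>\<^sup>+x. ennreal ((norm (F x - f n x))\<^sup>2) \<partial>M) \<le> ennreal (e\<^sup>2)"
      if N: "\<And>i j. i \<ge> N \<Longrightarrow> j \<ge> N \<Longrightarrow> sqrt (\<integral>x. (norm (f i x - f j x))\<^sup>2 \<partial>M) < e" and "n \<ge> N" "e > 0" for N n e
    proof -
      have "(\<integral>\<^sup>+x. ennreal ((norm (F x - f n x))\<^sup>2) \<partial>M) =
          (\<integral>\<^sup>+x. liminf (\<lambda>i. ennreal ((norm (f (r i) x - f n x))\<^sup>2)) \<partial>M)"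
      proof (rule nn_integral_cong_AE)
        show "AE x in M. ennreal ((norm (F x - f n x))\<^sup>2) = liminf (\<lambda>i. ennreal ((norm (f (r i) x - f n x))\<^sup>2))"
          using lim
        proof eventually_elim
          case (elim x)
          have "(\<lambda>i. ennreal ((norm (f (r i) x - f n x))\<^sup>2)) \<longlonglongrightarrow> ennreal ((norm (F x - f n x))\<^sup>2)"
            by (intro tendsto_ennrealI tendsto_intros elim)
          from lim_imp_Liminf[OF trivial_limit_sequentially this] show ?case
            by simp
        qed
      qed
      also have "\<dots> \<le> liminf (\<lambda>i. (\<integral>\<^sup>+x. ennreal ((norm (f (r i) x - f n x))\<^sup>2) \<partial>M))"
        by (rule nn_integral_liminf) measurable
      also have "\<dots> \<le> limsup (\<lambda>i. (\<integral>\<^sup>+x. ennreal ((norm (f (r i) x - f n x))\<^sup>2) \<partial>M))"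
        by (rule Liminf_le_Limsup) simp
      also have "\<dots> \<le> ennreal (e\<^sup>2)"
      proof (rule Limsup_bounded, rule eventually_sequentiallyI)
        fix i
        assume "i \<ge> N"
        then have "sqrt (\<integral>x. (norm (f (r i) x - f n x))\<^sup>2 \<partial>M) \<le> e"
          using N[of "r i" n] \<open>n \<ge> N\<close> seq_suble[OF r, of i] by auto
        then have "(\<integral>x. (norm (f (r i) x - f n x))\<^sup>2 \<partial>M) \<le> e\<^sup>2"
          by (rule sqrt_le_D)
        then show "(\<integral>\<^sup>+x. ennreal ((norm (f (r i) x - f n x))\<^sup>2) \<partial>M) \<le> ennreal (e\<^sup>2)"
          by (subst nn_integral_eq_integral[OF int]) (auto intro: ennreal_leI)
      qed
      finally show ?thesis .
    qed
    have diff_int: "integrable M (\<lambda>x. (norm (F x - f n x))\<^sup>2)"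
      if N: "\<And>i j. i \<ge> N \<Longrightarrow> j \<ge> N \<Longrightarrow> sqrt (\<integral>x. (norm (f i x - f j x))\<^sup>2 \<partial>M) < e" and "n \<ge> N" "e > 0" for N n e
    proof (rule integrableI_bounded)
      show "(\<integral>\<^sup>+x. ennreal (norm ((norm (F x - f n x))\<^sup>2)) \<partial>M) < \<infinity>"
        using fatou[OF N \<open>n \<ge> N\<close> \<open>e > 0\<close>] by (simp add: le_less_trans)
    qed measurable
    have F: "F \<in> L2_fun M"
    proof -
      obtain N where N: "\<And>i j. i \<ge> N \<Longrightarrow> j \<ge> N \<Longrightarrow> sqrt (\<integral>x. (norm (f i x - f j x))\<^sup>2 \<partial>M) < 1"
        using C'[of 1] by auto
      have "integrable M (\<lambda>x. (norm (F x - f N x))\<^sup>2)"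
        by (rule diff_int[of N 1 N]) (use N in auto)
      then have "integrable M (\<lambda>x. (norm ((F x - f N x) - (- f N x)))\<^sup>2)"
        by (rule integrable_norm_diff_square[rotated 2]) (use f[of N] in \<open>auto simp: L2_fun_def\<close>)
      then show ?thesis
        by (simp add: L2_fun_def)
    qed
    have "limitin L2.mtopology \<sigma> (L2_class M F) sequentially"
      unfolding L2.limitin_metric
    proof (intro conjI allI impI)
      show "L2_class M F \<in> L2_space M"
        using F by (simp add: L2_space_def)
      fix e :: real
      assume "e > 0"
      then obtain N where N: "\<And>i j. i \<ge> N \<Longrightarrow> j \<ge> N \<Longrightarrow> sqrt (\<integral>x. (norm (f i x - f j x))\<^sup>2 \<partial>M) < e / 2"
        using C'[of "e / 2"] by auto
      show "\<forall>\<^sub>F n in sequentially. \<sigma> n \<in> L2_space M \<and> L2_dist M (\<sigma> n) (L2_class M F) < e"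
      proof (rule eventually_sequentiallyI)
        fix n
        assume "n \<ge> N"
        have "integrable M (\<lambda>x. (norm (F x - f n x))\<^sup>2)"
          by (rule diff_int[of N "e / 2" n]) (use N \<open>n \<ge> N\<close> \<open>e > 0\<close> in auto)
        moreover have "(\<integral>\<^sup>+x. ennreal ((norm (F x - f n x))\<^sup>2) \<partial>M) \<le> ennreal ((e / 2)\<^sup>2)"
          by (rule fatou[of N "e / 2" n]) (use N \<open>n \<ge> N\<close> \<open>e > 0\<close> in auto)
        ultimately have "ennreal (\<integral>x. (norm (F x - f n x))\<^sup>2 \<partial>M) \<le> ennreal ((e / 2)\<^sup>2)"
          by (simp add: nn_integral_eq_integral)
        then have "(\<integral>x. (norm (F x - f n x))\<^sup>2 \<partial>M) \<le> (e / 2)\<^sup>2"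
          by simp
        then have "sqrt (\<integral>x. (norm (F x - f n x))\<^sup>2 \<partial>M) \<le> e / 2"
          using \<open>e > 0\<close> by (intro real_le_lsqrt) auto
        then show "\<sigma> n \<in> L2_space M \<and> L2_dist M (\<sigma> n) (L2_class M F) < e"
          using \<open>e > 0\<close> f F by (auto simp: \<sigma> L2_dist_class L2_space_def norm_minus_commute)
      qed
    qed
    then show "\<exists>x. limitin L2.mtopology \<sigma> x sequentially"
      by blast
  qed
qed

text \<open>In a complete space a set has compact closure exactly if it is totally bounded. The
  centres in \<open>mtotally_bounded\<close> belong to the set, so they are translates of
  \<open>f\<close>, as in \<open>totally_bounded_orbit\<close>.\<close>

lemma (in folner_ergodic) almost_periodic_iff_totally_bounded_orbit:
  assumes f: "f \<in> L2_fun M"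
  shows "almost_periodic M T f \<longleftrightarrow> totally_bounded_orbit M T 2 f"
proof -
  interpret L2: Metric_space "L2_space M" "L2_dist M"
    by (rule Metric_space_L2)
  have fm [measurable]: "f \<in> borel_measurable M"
    using f by (simp add: L2_fun_def)
  have fT: "f \<circ> T j \<in> L2_fun M" for j
    using f integrable_T_iff[of "\<lambda>x. (norm (f x))\<^sup>2" j] by (auto simp: L2_fun_def comp_def)
  let ?c = "\<lambda>j. L2_class M (f \<circ> T j)"
  have c: "?c j \<in> L2_space M" for j
    using fT by (simp add: L2_space_def)
  have dist: "L2_dist M (?c j) (?c k) = sqrt (\<integral>x. norm (f (T j x) - f (T k x)) ^ 2 \<partial>M)" for j k
    by (simp add: L2_dist_class[OF fT fT])
  have "almost_periodic M T f \<longleftrightarrow> L2.mtotally_bounded (range ?c)"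
    unfolding almost_periodic_def L2_topology_def
    using L2.mtotally_bounded_eq_compact_closure_of[OF mcomplete_L2] c by (auto simp: image_subset_iff)
  also have "\<dots> \<longleftrightarrow> totally_bounded_orbit M T 2 f"
  proof
    assume tb: "L2.mtotally_bounded (range ?c)"
    show "totally_bounded_orbit M T 2 f"
      unfolding totally_bounded_orbit_def
    proof (intro allI impI)
      fix e :: real
      assume "e > 0"
      then obtain C where C: "finite C" "C \<subseteq> range ?c" "range ?c \<subseteq> (\<Union>x\<in>C. L2.mball x (sqrt e))"
        using tb unfolding L2.mtotally_bounded_def by (metis real_sqrt_gt_zero)
      obtain K where K: "finite K" "C = ?c ` K"
        using finite_subset_image[OF C(1,2)] by auto
      show "\<exists>K. finite K \<and> (\<forall>j. \<exists>k\<in>K. (\<integral>x. norm (f (T j x) - f (T k x)) ^ 2 \<partial>M) \<le> e)"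
      proof (intro exI conjI allI)
        fix j
        have "?c j \<in> (\<Union>x\<in>C. L2.mball x (sqrt e))"
          using C(3) by blast
        then obtain k where "k \<in> K" "L2_dist M (?c k) (?c j) < sqrt e"
          by (auto simp: K(2))
        then show "\<exists>k\<in>K. (\<integral>x. norm (f (T j x) - f (T k x)) ^ 2 \<partial>M) \<le> e"
          by (intro bexI[of _ k]) (simp_all add: dist norm_minus_commute)
      qed fact
    qed
  next
    assume tb: "totally_bounded_orbit M T 2 f"
    show "L2.mtotally_bounded (range ?c)"
      unfolding L2.mtotally_bounded_def
    proof (intro allI impI)
      fix e :: real
      assume "e > 0"
      then obtain K where K: "finite K" "\<And>j. \<exists>k\<in>K. (\<integral>x. norm (f (T j x) - f (T k x)) ^ 2 \<partial>M) \<le> (e / 2)\<^sup>2"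
        using tb unfolding totally_bounded_orbit_def by (metis half_gt_zero zero_less_power)
      have "?c j \<in> (\<Union>x\<in>?c ` K. L2.mball x e)" for j
      proof -
        obtain k where k: "k \<in> K" "(\<integral>x. norm (f (T j x) - f (T k x)) ^ 2 \<partial>M) \<le> (e / 2)\<^sup>2"
          using K(2) by blast
        then have "sqrt (\<integral>x. norm (f (T j x) - f (T k x)) ^ 2 \<partial>M) \<le> e / 2"
          using \<open>e > 0\<close> by (intro real_le_lsqrt) auto
        then have "L2_dist M (?c j) (?c k) < e"
          using \<open>e > 0\<close> by (simp add: dist)
        then have "L2_dist M (?c k) (?c j) < e"
          by (subst L2.commute)
        then show ?thesis
          using k c by auto
      qed
      then show "\<exists>C. finite C \<and> C \<subseteq> range ?c \<and> range ?c \<subseteq> (\<Union>x\<in>C. L2.mball x e)"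
        using K(1) by (intro exI[of _ "?c ` K"]) blast
    qed
  qed
  finally show ?thesis .
qed

section \<open>The pointwise ergodic theorem on the phase space\<close>

text \<open>The type class of the phase space provides no countable base; the balls of radius
  \<open>1 / real (Suc n)\<close> around finite nets form one.\<close>

lemma second_countable_of_compact_UNIV:
  assumes "compact (UNIV :: 'x::metric_space set)"
  shows "second_countable (euclidean :: 'x topology)"
proof -
  have "\<exists>K::'x set. finite K \<and> UNIV \<subseteq> (\<Union>x\<in>K. ball x (1 / real (Suc n)))" for n
    using seq_compact_imp_totally_bounded[OF compact_imp_seq_compact[OF assms]] by simp
  then obtain K :: "nat \<Rightarrow> 'x set" where K: "\<And>n. finite (K n)"
    "\<And>n. UNIV \<subseteq> (\<Union>x\<in>K n. ball x (1 / real (Suc n)))"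
    by metis
  define \<B> where "\<B> = (\<Union>n. (\<lambda>x. ball x (1 / real (Suc n))) ` K n)"
  show ?thesis
    unfolding second_countable_def
  proof (intro exI conjI allI impI)
    show "countable \<B>"
      unfolding \<B>_def using K(1) by (auto intro: countable_finite)
    show "\<forall>V\<in>\<B>. openin euclidean V"
      by (auto simp: \<B>_def)
    fix U :: "'x set" and x
    assume U: "openin euclidean U \<and> x \<in> U"
    then obtain e where e: "e > 0" "ball x e \<subseteq> U"
      by (auto simp: open_contains_ball)
    obtain n where n: "1 / real (Suc n) < e / 2"
      using nat_approx_posE[of "e / 2"] e by auto
    obtain k where k: "k \<in> K n" "x \<in> ball k (1 / real (Suc n))"
      using K(2)[of n] by blast
    have "ball k (1 / real (Suc n)) \<subseteq> ball x e"
    proof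
      fix y
      assume "y \<in> ball k (1 / real (Suc n))"
      then show "y \<in> ball x e"
        using k(2) n dist_triangle2[of x y k] by (simp add: dist_commute)
    qed
    then show "\<exists>V\<in>\<B>. x \<in> V \<and> V \<subseteq> U"
      using k e by (intro bexI[of _ "ball k (1 / real (Suc n))"]) (auto simp: \<B>_def)
  qed
qed

text \<open>A point is determined by the set of indices of the basic open sets containing it, and
  there are as many sets of natural numbers as reals.\<close>

lemma ex_inj_real_of_second_countable:
  assumes "second_countable (euclidean :: 'x::t2_space topology)"
  shows "\<exists>\<phi> :: 'x \<Rightarrow> real. inj \<phi>"
proof -
  obtain \<B> :: "'x set set" where \<B>: "countable \<B>"
    "\<And>U x. open U \<Longrightarrow> x \<in> U \<Longrightarrow> \<exists>V\<in>\<B>. x \<in> V \<and> V \<subseteq> U"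
    using assms unfolding second_countable_def by auto
  define u where "u x = {n. x \<in> from_nat_into \<B> n}" for x
  have "inj u"
  proof (rule injI, rule ccontr)
    fix x y
    assume "u x = u y" "x \<noteq> y"
    then obtain U where "open U" "x \<in> U" "y \<notin> U"
      using t1_space by blast
    then obtain V where V: "V \<in> \<B>" "x \<in> V" "y \<notin> V"
      using \<B>(2) by blast
    then obtain n where "V = from_nat_into \<B> n"
      using \<B>(1) from_nat_into_surj by metis
    with V \<open>u x = u y\<close> show False
      by (auto simp: u_def)
  qed
  moreover obtain v :: "nat set \<Rightarrow> real" where "bij v"
    using nat_sets_eqpoll_reals by (auto simp: eqpoll_def)
  ultimately show ?thesis
    by (intro exI[of _ "v \<circ> u"] inj_compose) (auto simp: bij_def)
qed

text \<open>The hypothesis speaks about sets of reals with an arbitrary Polish topology. So any injection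
  of the phase space into the reals will do: it carries both the measure and the topology along, and need not
  be measurable with respect to the Borel sets of the reals.\<close>

lemma pointwise_ergodic_tds:
  fixes \<mu> :: "'x::metric_space measure" and f :: "'x \<Rightarrow> complex"
    and \<nu> :: "'g::topological_ab_group_add measure"
  assumes pe: "satisfies_pointwise_ergodic \<nu> F"
    and tds: "ergodic_tds \<mu> T"
    and f: "integrable \<mu> f"
  shows "AE x in \<mu>. generic \<nu> F \<mu> T f x"
proof -
  have comp: "compact (UNIV :: 'x set)" and sets_\<mu>: "sets \<mu> = sets borel" and "prob_space \<mu>"
    and erg: "ergodic_action \<mu> T"
    using tds by (auto simp: ergodic_tds_def)
  interpret prob_space \<mu> by fact
  have [simp]: "space \<mu> = UNIV"
    using sets_eq_imp_space_eq[OF sets_\<mu>] by simp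
  note sets_\<mu> [measurable_cong]
  have T0: "T 0 x = x" and Tplus: "T (g + h) x = T g (T h x)"
    and Tm: "(\<lambda>(j, x). T j x) \<in> borel \<Otimes>\<^sub>M \<mu> \<rightarrow>\<^sub>M \<mu>"
    and Tinv: "A \<in> sets \<mu> \<Longrightarrow> emeasure \<mu> (T j -` A) = emeasure \<mu> A"
    and Terg: "A \<in> sets \<mu> \<Longrightarrow> (\<And>j. T j -` A = A) \<Longrightarrow> measure \<mu> A = 0 \<or> measure \<mu> A = 1" for g h x j A
    using erg by (auto simp: ergodic_action_def measure_preserving_action_def)
  obtain \<phi> :: "'x \<Rightarrow> real" where inj [simp]: "inj \<phi>"
    using ex_inj_real_of_second_countable[OF second_countable_of_compact_UNIV[OF comp]] by blast
  define N where "N = embed_measure \<mu> \<phi>"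
  define S where "S g r = \<phi> (T g (inv \<phi> r))" for g r
  have space_N: "space N = range \<phi>"
    by (simp add: N_def space_embed_measure)
  have \<phi> [measurable]: "\<phi> \<in> \<mu> \<rightarrow>\<^sub>M N"
    unfolding N_def by (rule measurable_embed_measure2) simp
  have inv [measurable]: "inv \<phi> \<in> N \<rightarrow>\<^sub>M \<mu>"
    unfolding N_def by (rule measurable_embed_measure1) simp
  have N_distr: "N = distr \<mu> N \<phi>"
    unfolding N_def by (rule embed_measure_eq_distr') simp
  have emeasure_N: "emeasure N A = emeasure \<mu> (\<phi> -` A)" if "A \<in> sets N" for A
    using that by (subst N_distr) (simp add: emeasure_distr)
  have std: "standard_prob_space N"
    unfolding standard_prob_space_def
  proof (intro conjI exI)
    show "prob_space N"
      by (subst N_distr) (rule prob_space_distr[OF \<phi>])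
    let ?\<tau> = "pullback_topology (range \<phi>) (inv \<phi>) euclidean"
    have "homeomorphic_maps euclidean ?\<tau> \<phi> (inv \<phi>)"
      unfolding homeomorphic_maps_def
    proof (intro conjI)
      show "continuous_map euclidean ?\<tau> \<phi>"
        by (rule continuous_map_pullback') (auto simp: comp_def)
      show "continuous_map ?\<tau> euclidean (inv \<phi>)"
        using continuous_map_pullback[OF continuous_map_id, of "range \<phi>" "inv \<phi>" euclidean] by simp
    qed (auto simp: topspace_pullback_topology)
    then have hom: "(euclidean :: 'x topology) homeomorphic_space ?\<tau>"
      by (auto simp: homeomorphic_space_def)
    have "compact_space (euclidean :: 'x topology)"
      using comp by (simp add: compact_space_def)
    then have "completely_metrizable_space (euclidean :: 'x topology)"
      using Met_TC.completely_metrizable_space_mtopology[where ?'a = 'x]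
        Met_TC.compact_space_imp_mcomplete[where ?'a = 'x] by simp
    then show "completely_metrizable_space ?\<tau>"
      using homeomorphic_completely_metrizable_space[OF hom] by simp
    show "second_countable ?\<tau>"
      using homeomorphic_space_second_countability[OF hom] second_countable_of_compact_UNIV[OF comp] by simp
    show "topspace ?\<tau> = space N"
      by (auto simp: topspace_pullback_topology space_N)
    have "sets N = {\<phi> ` A |A. A \<in> sets borel}"
      by (simp add: N_def sets_embed_measure sets_\<mu>)
    also have "\<dots> = {inv \<phi> -` A \<inter> range \<phi> |A. A \<in> sigma_sets UNIV {U. open U}}"
    proof -
      have "inv \<phi> -` A \<inter> range \<phi> = \<phi> ` A" for A
        by auto
      then show ?thesis
        by (simp add: borel_def)
    qed
    also have "\<dots> = sigma_sets (range \<phi>) {inv \<phi> -` A \<inter> range \<phi> |A. A \<in> {U. open U}}"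
      by (rule sigma_sets_vimage_commute) auto
    also have "{inv \<phi> -` A \<inter> range \<phi> |A. A \<in> {U. open U}} = {U. openin ?\<tau> U}"
      by (auto simp: openin_pullback_topology)
    finally show "sets N = sigma_sets (space N) {U. openin ?\<tau> U}"
      by (simp add: space_N)
  qed
  have S_vimage: "\<phi> -` (S j -` A \<inter> range \<phi>) = T j -` (\<phi> -` A)" for j A
    using inj by (auto simp: S_def inj_eq)
  have vimage_N: "\<phi> -` A \<in> sets \<mu>" if "A \<in> sets N" for A
    using measurable_sets[OF \<phi> that] by simp
  have Sm: "(\<lambda>(j, r). S j r) \<in> borel \<Otimes>\<^sub>M N \<rightarrow>\<^sub>M N"
  proof -
    have "(\<lambda>z. (fst z, inv \<phi> (snd z))) \<in> borel \<Otimes>\<^sub>M N \<rightarrow>\<^sub>M borel \<Otimes>\<^sub>M \<mu>"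
      by measurable
    from measurable_compose[OF measurable_compose[OF this Tm] \<phi>] show ?thesis
      by (simp add: S_def split_beta)
  qed
  have Sj: "S j \<in> N \<rightarrow>\<^sub>M N" for j
    using measurable_compose[OF _ Sm, of "\<lambda>r. (j, r)" N] by simp
  have act: "ergodic_action N S"
    unfolding ergodic_action_def measure_preserving_action_def
  proof (intro conjI ballI allI impI)
    fix j A
    assume A: "A \<in> sets N"
    have "emeasure N (S j -` A \<inter> space N) = emeasure \<mu> (T j -` (\<phi> -` A))"
      using measurable_sets[OF Sj A] by (simp add: emeasure_N space_N flip: S_vimage)
    also have "\<dots> = emeasure N A"
      using Tinv[OF vimage_N[OF A]] A by (simp add: emeasure_N)
    finally show "emeasure N (S j -` A \<inter> space N) = emeasure N A" .
  next
    fix A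
    assume A: "A \<in> sets N" and *: "\<forall>j. S j -` A \<inter> space N = A"
    have "T j -` (\<phi> -` A) = \<phi> -` A" for j
      using * by (simp add: space_N flip: S_vimage)
    from Terg[OF vimage_N[OF A] this] show "measure N A = 0 \<or> measure N A = 1"
      using A by (simp add: measure_def emeasure_N)
  next
    fix r assume "r \<in> space N"
    then show "S 0 r = r"
      by (auto simp: space_N S_def T0)
  next
    fix g h r assume "r \<in> space N"
    show "S (g + h) r = S g (S h r)"
      by (simp add: S_def Tplus)
  qed (rule Sm)
  have fm [measurable]: "f \<in> borel_measurable \<mu>"
    using f by simp
  have "integrable N (\<lambda>r. f (inv \<phi> r))"
    by (subst N_distr, subst integrable_distr_eq[OF \<phi>]) (use f in auto)
  then have "AE r in N. generic \<nu> F N S (\<lambda>r. f (inv \<phi> r)) r"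
    using pe std act unfolding satisfies_pointwise_ergodic_def by blast
  then have "AE r in distr \<mu> N \<phi>. generic \<nu> F N S (\<lambda>r. f (inv \<phi> r)) r"
    by (simp only: N_distr[symmetric])
  from AE_distrD[OF \<phi> this] have "AE x in \<mu>. generic \<nu> F N S (\<lambda>r. f (inv \<phi> r)) (\<phi> x)" .
  moreover have "(\<integral>r. f (inv \<phi> r) \<partial>N) = (\<integral>x. f x \<partial>\<mu>)"
    by (subst N_distr, subst integral_distr[OF \<phi>]) auto
  ultimately show ?thesis
    by (simp add: generic_def S_def)
qed

section \<open>Averages over Folner sets as probability measures\<close>

lemma
  fixes h :: "'a \<Rightarrow> 'b::{banach, second_countable_topology}"
  assumes A [measurable]: "A \<in> sets M" and fin: "0 < emeasure M A" "emeasure M A < \<infinity>"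
    and h [measurable]: "h \<in> borel_measurable M"
  shows integral_uniform_measure:
      "(\<integral>x. h x \<partial>uniform_measure M A) = (1 / measure M A) *\<^sub>R (LINT x:A|M. h x)"
    and integrable_uniform_measure_iff:
      "integrable (uniform_measure M A) h \<longleftrightarrow> set_integrable M A h"
proof -
  have e: "emeasure M A = ennreal (measure M A)"
    using fin by (simp add: emeasure_eq_ennreal_measure)
  then have pos: "measure M A > 0"
    using fin by simp
  have u: "uniform_measure M A = density M (\<lambda>x. ennreal (indicator A x / measure M A))"
    unfolding uniform_measure_def e
    using divide_ennreal[of 1 "measure M A"] pos
    by (intro arg_cong[where f = "density M"] ext) (auto split: split_indicator)
  have "(\<integral>x. h x \<partial>uniform_measure M A) = (\<integral>x. (indicator A x / measure M A) *\<^sub>R h x \<partial>M)"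
    unfolding u using pos by (intro integral_density) auto
  also have "\<dots> = (\<integral>x. (1 / measure M A) *\<^sub>R (indicator A x *\<^sub>R h x) \<partial>M)"
    by simp
  also have "\<dots> = (1 / measure M A) *\<^sub>R (LINT x:A|M. h x)"
    unfolding set_lebesgue_integral_def by (rule integral_scaleR_right)
  finally show "(\<integral>x. h x \<partial>uniform_measure M A) = (1 / measure M A) *\<^sub>R (LINT x:A|M. h x)" .
  have "integrable (uniform_measure M A) h \<longleftrightarrow> integrable M (\<lambda>x. (indicator A x / measure M A) *\<^sub>R h x)"
    unfolding u using pos by (intro integrable_density) auto
  also have "(\<lambda>x. (indicator A x / measure M A) *\<^sub>R h x) = (\<lambda>x. (1 / measure M A) *\<^sub>R (indicator A x *\<^sub>R h x))"
    by simp
  also have "integrable M \<dots> \<longleftrightarrow> set_integrable M A h"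
    unfolding set_integrable_def
    using pos integrable_scaleR_right[of "measure M A" M "\<lambda>x. (1 / measure M A) *\<^sub>R (indicator A x *\<^sub>R h x)"]
      integrable_scaleR_right[of "1 / measure M A" M "\<lambda>x. indicator A x *\<^sub>R h x"]
    by auto
  finally show "integrable (uniform_measure M A) h \<longleftrightarrow> set_integrable M A h" .
qed

lemma haar_distr:
  assumes "haar_measure \<nu>"
  shows "distr \<nu> borel ((+) g) = \<nu>"
proof (rule measure_eqI)
  have s: "sets \<nu> = sets borel"
    and inv: "\<And>g A. A \<in> sets borel \<Longrightarrow> emeasure \<nu> ((+) g ` A) = emeasure \<nu> A"
    using assms by (auto simp: haar_measure_def)
  show "sets (distr \<nu> borel ((+) g)) = sets \<nu>"
    by (simp add: s)
  fix A
  assume "A \<in> sets (distr \<nu> borel ((+) g))"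
  then have A: "A \<in> sets borel"
    by simp
  have m: "(+) g \<in> \<nu> \<rightarrow>\<^sub>M borel"
    unfolding measurable_cong_sets[OF s refl] by (intro borel_measurable_continuous_onI continuous_intros)
  have "(+) g -` A = (+) (- g) ` A"
    by (auto simp: image_iff intro!: bexI[of _ "g + _"])
  then show "emeasure (distr \<nu> borel ((+) g)) A = emeasure \<nu> A"
    using sets_eq_imp_space_eq[OF s] inv[OF A, of "- g"] by (simp add: emeasure_distr[OF m A])
qed

text \<open>By invariance of Haar measure the translated integral over \<open>F n\<close> is the
  integral over \<open>g + F n\<close>. The two integrals differ only on the symmetric difference,
  where the integrand is at most \<open>B\<close> in absolute value.\<close>

lemma folner_asymptotically_invariant:
  fixes \<phi> :: "'g::{topological_ab_group_add,t2_space} \<Rightarrow> real"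
  assumes haar: "haar_measure \<nu>" and fol: "folner_sequence \<nu> F"
    and \<phi>: "\<phi> \<in> borel_measurable borel" and B: "\<And>j. \<bar>\<phi> j\<bar> \<le> B"
  shows "(\<lambda>n. (\<integral>j. \<phi> (g + j) \<partial>uniform_measure \<nu> (F n)) - (\<integral>j. \<phi> j \<partial>uniform_measure \<nu> (F n))) \<longlonglongrightarrow> 0"
proof -
  have s: "sets \<nu> = sets borel"
    using haar by (simp add: haar_measure_def)
  note s [measurable_cong]
  note \<phi> [measurable]
  have F [measurable]: "F n \<in> sets \<nu>" and fin: "0 < emeasure \<nu> (F n)" "emeasure \<nu> (F n) < \<infinity>" for n
    using fol by (auto simp: folner_sequence_def)
  have shift [measurable]: "(+) k \<in> \<nu> \<rightarrow>\<^sub>M borel" for k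
    unfolding measurable_cong_sets[OF s refl] by (intro borel_measurable_continuous_onI continuous_intros)
  have shift' [measurable]: "(+) k \<in> borel \<rightarrow>\<^sub>M \<nu>" for k
    unfolding measurable_cong_sets[OF refl s] by (intro borel_measurable_continuous_onI continuous_intros)
  define E where "E n = (+) g ` F n" for n
  have E_vimage: "E n = (\<lambda>j. - g + j) -` F n" for n
    by (auto simp: E_def image_iff intro!: bexI[of _ "- g + _"])
  have E [measurable]: "E n \<in> sets \<nu>" for n
    using measurable_sets[OF shift' F, of "- g" n] by (simp only: E_vimage s space_borel Int_UNIV_right)
  have emE: "emeasure \<nu> (E n) = emeasure \<nu> (F n)" for n
    using haar F[of n] s by (simp add: haar_measure_def E_def)
  have bound: "\<bar>(\<integral>j. \<phi> (g + j) \<partial>uniform_measure \<nu> (F n)) - (\<integral>j. \<phi> j \<partial>uniform_measure \<nu> (F n))\<bar> \<le>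
      B * (measure \<nu> (sym_diff (E n) (F n)) / measure \<nu> (F n))" for n
  proof -
    have int: "integrable \<nu> (\<lambda>j. indicator A j * \<phi> j)" if "A \<in> sets \<nu>" "emeasure \<nu> A < \<infinity>" for A
    proof (rule Bochner_Integration.integrable_bound)
      show "integrable \<nu> (\<lambda>j. B * indicator A j)"
        using that by simp
      show "AE j in \<nu>. norm (indicator A j * \<phi> j) \<le> norm (B * indicator A j)"
        using order_trans[OF B abs_ge_self] by (auto simp: indicator_def)
    qed (use that in measurable)
    have finE: "emeasure \<nu> (E n) < \<infinity>"
      using fin by (simp add: emE)
    have finD: "emeasure \<nu> (sym_diff (E n) (F n)) < \<infinity>"
      by (rule le_less_trans[OF emeasure_mono[of _ "E n \<union> F n"]])
         (use finE fin(2)[of n] in \<open>auto simp: emeasure_Un_Int[symmetric] intro: le_less_trans[OF emeasure_subadditive]\<close>)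
    have "(LINT j:F n|\<nu>. \<phi> (g + j)) = (\<integral>j. indicator (E n) (g + j) * \<phi> (g + j) \<partial>\<nu>)"
      by (simp add: set_lebesgue_integral_def E_vimage indicator_def)
    also have "\<dots> = (\<integral>j. indicator (E n) j * \<phi> j \<partial>distr \<nu> borel ((+) g))"
      by (subst integral_distr) (use s in auto)
    finally have 1: "(LINT j:F n|\<nu>. \<phi> (g + j)) = (\<integral>j. indicator (E n) j * \<phi> j \<partial>\<nu>)"
      by (simp add: haar_distr[OF haar])
    have "(LINT j:F n|\<nu>. \<phi> (g + j)) - (LINT j:F n|\<nu>. \<phi> j) =
        (\<integral>j. indicator (E n) j * \<phi> j - indicator (F n) j * \<phi> j \<partial>\<nu>)"
      unfolding 1 using int[OF E finE] int[OF F fin(2)] by (simp add: set_lebesgue_integral_def)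
    also have "\<bar>\<dots>\<bar> \<le> (\<integral>j. \<bar>indicator (E n) j * \<phi> j - indicator (F n) j * \<phi> j\<bar> \<partial>\<nu>)"
      by (rule integral_abs_bound)
    also have "\<dots> \<le> (\<integral>j. B * indicator (sym_diff (E n) (F n)) j \<partial>\<nu>)"
    proof (rule integral_mono)
      show "integrable \<nu> (\<lambda>j. \<bar>indicator (E n) j * \<phi> j - indicator (F n) j * \<phi> j\<bar>)"
        using int[OF E finE] int[OF F fin(2)] by simp
      show "integrable \<nu> (\<lambda>j. B * indicator (sym_diff (E n) (F n)) j)"
        using finD by simp
      show "\<bar>indicator (E n) j * \<phi> j - indicator (F n) j * \<phi> j\<bar> \<le> B * indicator (sym_diff (E n) (F n)) j" for j
        using B[of j] by (auto simp: indicator_def)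
    qed
    also have "\<dots> = B * measure \<nu> (sym_diff (E n) (F n))"
      by simp
    finally have "\<bar>(LINT j:F n|\<nu>. \<phi> (g + j)) - (LINT j:F n|\<nu>. \<phi> j)\<bar> / measure \<nu> (F n) \<le>
        B * measure \<nu> (sym_diff (E n) (F n)) / measure \<nu> (F n)"
      by (rule divide_right_mono) simp
    moreover have "(\<integral>j. \<phi> (g + j) \<partial>uniform_measure \<nu> (F n)) = (LINT j:F n|\<nu>. \<phi> (g + j)) / measure \<nu> (F n)"
      "(\<integral>j. \<phi> j \<partial>uniform_measure \<nu> (F n)) = (LINT j:F n|\<nu>. \<phi> j) / measure \<nu> (F n)"
      by (subst integral_uniform_measure[OF F fin]; simp)+
    ultimately show ?thesis
      by (simp add: abs_mult flip: diff_divide_distrib)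
  qed
  have "(\<lambda>n. B * (measure \<nu> (sym_diff (E n) (F n)) / measure \<nu> (F n))) \<longlonglongrightarrow> B * 0"
    using fol unfolding folner_sequence_def E_def by (intro tendsto_mult_left) auto
  then have "(\<lambda>n. B * (measure \<nu> (sym_diff (E n) (F n)) / measure \<nu> (F n))) \<longlonglongrightarrow> 0"
    by simp
  then show ?thesis
    by (rule Lim_null_comparison[rotated]) (use bound in \<open>simp add: always_eventually\<close>)
qed

lemma generic_iff_uniform_measure:
  fixes f :: "'x \<Rightarrow> 'b::{banach, second_countable_topology}"
  assumes fol: "folner_sequence \<nu> F" and m: "(\<lambda>j. f (T j x)) \<in> borel_measurable \<nu>"
  shows "generic \<nu> F M T f x \<longleftrightarrow>
    (\<forall>\<^sub>F n in sequentially. integrable (uniform_measure \<nu> (F n)) (\<lambda>j. f (T j x))) \<and>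
    (\<lambda>n. \<integral>j. f (T j x) \<partial>uniform_measure \<nu> (F n)) \<longlonglongrightarrow> (\<integral>y. f y \<partial>M)"
proof -
  have F: "F n \<in> sets \<nu>" and fin: "0 < emeasure \<nu> (F n)" "emeasure \<nu> (F n) < \<infinity>" for n
    using fol by (auto simp: folner_sequence_def)
  show ?thesis
    by (simp add: generic_def folner_average_def integral_uniform_measure[OF F fin m]
        integrable_uniform_measure_iff[OF F fin m])
qed

lemma folner_ergodic_uniform_measure:
  fixes \<nu> :: "'g::{topological_ab_group_add,t2_space} measure" and \<mu> :: "'x::metric_space measure"
  assumes haar: "haar_measure \<nu>" and fol: "folner_sequence \<nu> F"
    and pe: "satisfies_pointwise_ergodic \<nu> F" and tds: "ergodic_tds \<mu> T"
  shows "folner_ergodic \<mu> (\<lambda>n. uniform_measure \<nu> (F n)) T"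
proof -
  have s: "sets \<nu> = sets borel"
    using haar by (simp add: haar_measure_def)
  have F: "F n \<in> sets \<nu>" and fin: "0 < emeasure \<nu> (F n)" "emeasure \<nu> (F n) < \<infinity>" for n
    using fol by (auto simp: folner_sequence_def)
  have sets_\<mu>: "sets \<mu> = sets borel" and "prob_space \<mu>" and erg: "ergodic_action \<mu> T"
    using tds by (auto simp: ergodic_tds_def)
  interpret prob_space \<mu> by fact
  have [simp]: "space \<mu> = UNIV"
    using sets_eq_imp_space_eq[OF sets_\<mu>] by simp
  have Tm: "(\<lambda>(j, x). T j x) \<in> borel \<Otimes>\<^sub>M \<mu> \<rightarrow>\<^sub>M \<mu>"
    using erg by (simp add: ergodic_action_def measure_preserving_action_def)
  have Tj: "T j \<in> \<mu> \<rightarrow>\<^sub>M \<mu>" for j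
    using measurable_compose[OF _ Tm, of "\<lambda>x. (j, x)" \<mu>] by simp
  have Tx: "(\<lambda>j. T j x) \<in> \<nu> \<rightarrow>\<^sub>M \<mu>" for x
    using measurable_compose[OF _ Tm, of "\<lambda>j. (j, x)" borel] by (simp add: measurable_cong_sets[OF s refl])
  show ?thesis
  proof (intro folner_ergodic.intro folner_ergodic_axioms.intro)
    show "prob_space (uniform_measure \<nu> (F n))" for n
      using fin[of n] by (intro prob_space_uniform_measure) auto
    show "sets (uniform_measure \<nu> (F n)) = sets borel" for n
      by (simp add: s)
    show "distr \<mu> \<mu> (T j) = \<mu>" for j
      by (rule measure_eqI)
         (use erg Tj in \<open>auto simp: emeasure_distr ergodic_action_def measure_preserving_action_def\<close>)
    show "(\<lambda>n. (\<integral>j. \<phi> (g + j) \<partial>uniform_measure \<nu> (F n)) - (\<integral>j. \<phi> j \<partial>uniform_measure \<nu> (F n))) \<longlonglongrightarrow> 0"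
      if "\<phi> \<in> borel_measurable borel" "\<And>j. \<bar>\<phi> j\<bar> \<le> B" for \<phi> :: "'g \<Rightarrow> real" and B g
      by (rule folner_asymptotically_invariant[OF haar fol that])
    show "AE x in \<mu>. (\<forall>\<^sub>F n in sequentially. integrable (uniform_measure \<nu> (F n)) (\<lambda>j. f (T j x))) \<and>
        (\<lambda>n. \<integral>j. f (T j x) \<partial>uniform_measure \<nu> (F n)) \<longlonglongrightarrow> (\<integral>y. f y \<partial>\<mu>)"
      if f: "integrable \<mu> f" for f :: "'x \<Rightarrow> real"
    proof -
      have fT: "(\<lambda>j. f (T j x)) \<in> borel_measurable \<nu>" for x
        using f by (intro measurable_compose[OF Tx]) simp
      \<comment> \<open>The hypothesis is about complex functions, so the real statement is obtained
        through the embedding.\<close>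
      have "integrable \<mu> (\<lambda>x. complex_of_real (f x))"
        using f by simp
      from pointwise_ergodic_tds[OF pe tds this]
      show ?thesis
      proof eventually_elim
        case (elim x)
        have "(\<lambda>j. complex_of_real (f (T j x))) \<in> borel_measurable \<nu>"
          using fT by simp
        with elim have "(\<forall>\<^sub>F n in sequentially. integrable (uniform_measure \<nu> (F n)) (\<lambda>j. complex_of_real (f (T j x)))) \<and>
            (\<lambda>n. \<integral>j. complex_of_real (f (T j x)) \<partial>uniform_measure \<nu> (F n)) \<longlonglongrightarrow> (\<integral>y. complex_of_real (f y) \<partial>\<mu>)"
          by (simp only: generic_iff_uniform_measure[OF fol])
        then show ?case
          by (simp add: tendsto_of_real_iff complex_of_real_integrable_eq)
      qed
    qed
  qed (use erg Tm prob_space_axioms in \<open>auto simp: ergodic_action_def measure_preserving_action_def\<close>)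
qed

section \<open>Lusin's theorem for countable partitions\<close>

text \<open>Regularity by induction over the sigma-algebra generated by the closed sets.
  Approximating from both sides at once is what makes the step for complements work, as it swaps the
  closed and the open set.\<close>

lemma ex_closed_open_approximation:
  fixes M :: "'a::metric_space measure"
  assumes "finite_measure M" and sets: "sets M = sets borel" and "A \<in> sets M" and "e > 0"
  shows "\<exists>C U. closed C \<and> open U \<and> C \<subseteq> A \<and> A \<subseteq> U \<and> measure M (U - C) < e"
proof -
  interpret finite_measure M by fact
  have closed_sets: "closed C \<Longrightarrow> C \<in> sets M" and open_sets: "open U \<Longrightarrow> U \<in> sets M" for C U
    by (auto simp: sets)
  have "A \<in> sigma_sets UNIV (Collect closed)"
    using assms(3) by (simp add: sets borel_eq_closed)
  then have "\<forall>e>0. \<exists>C U. closed C \<and> open U \<and> C \<subseteq> A \<and> A \<subseteq> U \<and> measure M (U - C) < e"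
  proof induction
    case (Basic C)
    then have C: "closed C"
      by simp
    show ?case
    proof (intro allI impI)
      fix e :: real
      assume "e > 0"
      \<comment> \<open>A closed set is the intersection of its decreasing open
        neighbourhoods.\<close>
      define U where "U n = (\<Union>x\<in>C. ball x (1 / real (Suc n)))" for n
      have U: "open (U n)" for n
        by (auto simp: U_def)
      have "decseq U"
      proof (rule decseq_SucI)
        fix n
        have "1 / real (Suc (Suc n)) \<le> 1 / real (Suc n)"
          by (simp add: field_simps)
        then show "U (Suc n) \<subseteq> U n"
          by (force simp: U_def)
      qed
      have "(\<Inter>n. U n) = C"
      proof
        show "(\<Inter>n. U n) \<subseteq> C"
        proof
          fix x
          assume x: "x \<in> (\<Inter>n. U n)"
          have "\<exists>y\<in>C. dist y x < d" if "d > 0" for d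
          proof -
            obtain n where "1 / real (Suc n) < d"
              using nat_approx_posE[OF \<open>d > 0\<close>] by blast
            moreover have "x \<in> U n"
              using x by blast
            ultimately show ?thesis
              by (force simp: U_def)
          qed
          then have "x \<in> closure C"
            by (simp add: closure_approachable)
          then show "x \<in> C"
            using C by simp
        qed
        show "C \<subseteq> (\<Inter>n. U n)"
          by (force simp: U_def)
      qed
      moreover have "(\<lambda>n. measure M (U n)) \<longlonglongrightarrow> measure M (\<Inter>n. U n)"
        using \<open>decseq U\<close> U open_sets by (intro finite_Lim_measure_decseq) auto
      ultimately have "(\<lambda>n. measure M (U n) - measure M C) \<longlonglongrightarrow> measure M C - measure M C"
        by (intro tendsto_intros) simp
      then have "\<forall>\<^sub>F n in sequentially. measure M (U n) - measure M C < e"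
        by (rule order_tendstoD) (use \<open>e > 0\<close> in simp)
      then obtain n where n: "measure M (U n) - measure M C < e"
        by (auto simp: eventually_sequentially)
      have "C \<subseteq> U n"
        by (force simp: U_def)
      then have "measure M (U n - C) < e"
        using n finite_measure_Diff[OF open_sets[OF U[of n]] closed_sets[OF C]] by simp
      then show "\<exists>D V. closed D \<and> open V \<and> D \<subseteq> C \<and> C \<subseteq> V \<and> measure M (V - D) < e"
        using C U \<open>C \<subseteq> U n\<close> by blast
    qed
  next
    case Empty
    then show ?case
      by (intro allI impI exI[of _ "{}"]) simp
  next
    case (Compl A)
    show ?case
    proof (intro allI impI)
      fix e :: real
      assume "e > 0"
      then obtain C U where "closed C" "open U" "C \<subseteq> A" "A \<subseteq> U" "measure M (U - C) < e"
        using Compl.IH[rule_format, OF \<open>e > 0\<close>] by blast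
      moreover have "- C - - U = U - C"
        by auto
      ultimately show "\<exists>D V. closed D \<and> open V \<and> D \<subseteq> UNIV - A \<and> UNIV - A \<subseteq> V \<and> measure M (V - D) < e"
        by (intro exI[of _ "- U"] exI[of _ "- C"]) auto
    qed
  next
    case (Union A)
    show ?case
    proof (intro allI impI)
      fix e :: real
      assume "e > 0"
      \<comment> \<open>One half of \<open>e\<close> is shared among the countably many sets. The
        other half pays for cutting the union of the \<open>C i\<close> down to finitely many, since
        a countable union of closed sets need not be closed.\<close>
      define d where "d i = e / 2 * (1 / 2) ^ Suc i" for i
      have d_pos: "d i > 0" for i
        using \<open>e > 0\<close> by (simp add: d_def)
      have "\<exists>C U. closed C \<and> open U \<and> C \<subseteq> A i \<and> A i \<subseteq> U \<and> measure M (U - C) < d i" for i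
        by (rule Union.IH[rule_format, OF d_pos])
      then obtain C U where CU: "\<And>i. closed (C i)" "\<And>i. open (U i)" "\<And>i. C i \<subseteq> A i" "\<And>i. A i \<subseteq> U i"
        "\<And>i. measure M (U i - C i) < d i"
        by metis
      have [measurable]: "C i \<in> sets M" "U i \<in> sets M" for i
        using CU open_sets closed_sets by auto
      have d_sums: "d sums (e / 2)"
        using sums_mult[OF power_half_series, of "e / 2"] by (simp only: d_def[abs_def] mult_1_right)
      have sm: "summable (\<lambda>i. measure M (U i - C i))"
        by (rule summable_comparison_test'[OF sums_summable[OF d_sums], of 0]) (use CU(5) in \<open>auto intro: less_imp_le\<close>)
      have "measure M (\<Union>i. U i - C i) \<le> (\<Sum>i. measure M (U i - C i))"
        by (rule finite_measure_subadditive_countably[OF _ sm]) auto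
      also have "\<dots> \<le> e / 2"
        using suminf_le[OF _ sm sums_summable[OF d_sums]] CU(5) sums_unique[OF d_sums] by (auto intro: less_imp_le)
      finally have 1: "measure M (\<Union>i. U i - C i) \<le> e / 2" .
      define D where "D n = (\<Union>i. C i) - (\<Union>i<n. C i)" for n
      have "(\<lambda>n. measure M (D n)) \<longlonglongrightarrow> measure M (\<Inter>n. D n)"
        by (intro finite_Lim_measure_decseq) (auto simp: D_def decseq_def)
      moreover have "(\<Inter>n. D n) = {}"
        by (auto simp: D_def)
      ultimately have "\<forall>\<^sub>F n in sequentially. measure M (D n) < e / 2"
        by (intro order_tendstoD(2)[where y = "measure M (\<Inter>n. D n)"]) (use \<open>e > 0\<close> in auto)
      then obtain n where n: "measure M (D n) < e / 2"
        by (auto simp: eventually_sequentially)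
      have "measure M ((\<Union>i. U i) - (\<Union>i<n. C i)) \<le> measure M ((\<Union>i. U i - C i) \<union> D n)"
        by (rule finite_measure_mono) (auto simp: D_def)
      also have "\<dots> \<le> measure M (\<Union>i. U i - C i) + measure M (D n)"
        by (rule measure_Un_le) (auto simp: D_def)
      also have "\<dots> < e"
        using 1 n by linarith
      finally have "measure M ((\<Union>i. U i) - (\<Union>i<n. C i)) < e" .
      moreover have "closed (\<Union>i<n. C i)" "open (\<Union>i. U i)"
        using CU(1,2) by (simp_all add: closed_UN open_UN)
      moreover have "(\<Union>i<n. C i) \<subseteq> (\<Union>i. A i)" "(\<Union>i. A i) \<subseteq> (\<Union>i. U i)"
        using CU(3,4) by fast+
      ultimately show "\<exists>C V. closed C \<and> open V \<and> C \<subseteq> (\<Union>i. A i) \<and> (\<Union>i. A i) \<subseteq> V \<and> measure M (V - C) < e"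
        by blast
    qed
  qed
  then show ?thesis
    using \<open>e > 0\<close> by blast
qed

text \<open>One compact set has to serve all \<kappa> at once, because mean equicontinuity fixes the
  compact set before the tolerance. Each \<open>\<kappa> m\<close> is made continuous on a closed
  set, and these sets are intersected.\<close>

lemma ex_compact_uniformly_constant:
  fixes M :: "'a::metric_space measure" and \<kappa> :: "nat \<Rightarrow> 'a \<Rightarrow> nat"
  assumes "prob_space M" and comp: "compact (UNIV :: 'a set)" and sets: "sets M = sets borel"
    and \<kappa> [measurable]: "\<And>m. \<kappa> m \<in> M \<rightarrow>\<^sub>M count_space UNIV"
    and G: "AE x in M. x \<in> G" and "\<tau> > 0"
  obtains K where "compact K" "K \<subseteq> G" "measure M K \<ge> 1 - \<tau>"
    "\<And>m. \<exists>\<delta>>0. \<forall>x\<in>K. \<forall>y\<in>K. dist x y \<le> \<delta> \<longrightarrow> \<kappa> m x = \<kappa> m y"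
proof -
  interpret prob_space M by fact
  have [simp]: "space M = UNIV"
    using sets_eq_imp_space_eq[OF sets] by simp
  obtain N where N: "{x\<in>space M. x \<notin> G} \<subseteq> N" "emeasure M N = 0" "N \<in> sets M"
    using AE_E[OF G] by blast
  \<comment> \<open>The set \<open>G\<close> need not be measurable; \<open>H\<close> is a
    measurable subset of it with full measure.\<close>
  define H where "H = - N"
  have H: "H \<subseteq> G" "H \<in> sets M"
    using N(1) sets.compl_sets[OF N(3)] by (auto simp: H_def Compl_eq_Diff_UNIV)
  note H(2) [measurable]
  have "measure M H = 1"
    using prob_compl[OF N(3)] N(2) by (simp add: H_def Compl_eq_Diff_UNIV measure_def)
  have "\<exists>C. closed C \<and> C \<subseteq> H \<and> continuous_on C (\<lambda>x. real (\<kappa> m x)) \<and> measure M (- C) \<le> d"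
    if "d > 0" for m d
  proof -
    define A where "A i = H \<inter> \<kappa> m -` {i}" for i
    have A: "A i \<in> sets M" for i
      using measurable_sets[OF \<kappa>, of "{i}" m] by (auto simp: A_def)
    note A [measurable]
    have "(\<lambda>n. measure M (\<Union>i<n. A i)) \<longlonglongrightarrow> measure M (\<Union>n. \<Union>i<n. A i)"
      by (intro finite_Lim_measure_incseq) (auto simp: incseq_def intro: order_less_le_trans)
    moreover have "(\<Union>n. \<Union>i<n. A i) = H"
      by (auto simp: A_def)
    ultimately have "\<forall>\<^sub>F n in sequentially. measure M (\<Union>i<n. A i) > 1 - d / 2"
      using \<open>d > 0\<close> \<open>measure M H = 1\<close> by (intro order_tendstoD(1)[where y = 1]) auto
    then obtain n where n: "measure M (\<Union>i<n. A i) > 1 - d / 2"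
      by (auto simp: eventually_sequentially)
    \<comment> \<open>\<open>Suc n\<close> instead of \<open>n\<close> keeps the tolerance positive
      for \<open>n = 0\<close>; the \<open>n\<close> errors still sum to at most
      \<open>d / 2\<close>.\<close>
    have "\<exists>C. closed C \<and> C \<subseteq> A i \<and> measure M (A i - C) \<le> d / (2 * real (Suc n))" for i
    proof -
      have "d / (2 * real (Suc n)) > 0"
        using \<open>d > 0\<close> by simp
      from ex_closed_open_approximation[OF finite_measure_axioms sets A[of i] this]
      obtain C U where CU: "closed C" "open U" "C \<subseteq> A i" "A i \<subseteq> U" "measure M (U - C) < d / (2 * real (Suc n))"
        by blast
      have "measure M (A i - C) \<le> measure M (U - C)"
        using CU by (intro finite_measure_mono) (auto simp: sets)
      then show ?thesis
        using CU by (intro exI[of _ C]) auto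
    qed
    then obtain C where C: "\<And>i. closed (C i)" "\<And>i. C i \<subseteq> A i"
      "\<And>i. measure M (A i - C i) \<le> d / (2 * real (Suc n))"
      by metis
    have [measurable]: "C i \<in> sets M" for i
      using C(1) by (simp add: sets)
    define K where "K = (\<Union>i<n. C i)"
    have cont: "continuous_on (C i) (\<lambda>x. real (\<kappa> m x))" for i
    proof (subst continuous_on_cong[OF refl])
      show "real (\<kappa> m x) = real i" if "x \<in> C i" for x
        using that C(2)[of i] by (auto simp: A_def)
    qed simp
    show ?thesis
    proof (intro exI conjI)
      show "closed K"
        unfolding K_def using C(1) by auto
      show "K \<subseteq> H"
        using C(2) by (auto simp: K_def A_def)
      show "continuous_on K (\<lambda>x. real (\<kappa> m x))"
        unfolding K_def by (rule continuous_on_closed_Union) (use C(1) cont in auto)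
      have "measure M (- K) \<le> measure M (- (\<Union>i<n. A i) \<union> (\<Union>i<n. A i - C i))"
      proof (rule finite_measure_mono)
        have "- (\<Union>i<n. A i) \<in> sets M"
          using sets.compl_sets[of "\<Union>i<n. A i" M] by (simp add: Compl_eq_Diff_UNIV)
        then show "- (\<Union>i<n. A i) \<union> (\<Union>i<n. A i - C i) \<in> sets M"
          by measurable
      qed (auto simp: K_def)
      also have "\<dots> \<le> measure M (- (\<Union>i<n. A i)) + measure M (\<Union>i<n. A i - C i)"
      proof (rule measure_Un_le)
        show "- (\<Union>i<n. A i) \<in> sets M"
          using sets.compl_sets[of "\<Union>i<n. A i" M] by (simp add: Compl_eq_Diff_UNIV)
      qed measurable
      also have "measure M (- (\<Union>i<n. A i)) = 1 - measure M (\<Union>i<n. A i)"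
        using prob_compl[of "\<Union>i<n. A i"] by (simp add: Compl_eq_Diff_UNIV)
      also have "measure M (\<Union>i<n. A i - C i) \<le> (\<Sum>i<n. measure M (A i - C i))"
        by (rule finite_measure_subadditive_finite) auto
      also have "\<dots> \<le> (\<Sum>i<n. d / (2 * real (Suc n)))"
        by (rule sum_mono) (rule C(3))
      also have "\<dots> \<le> d / 2"
        using \<open>d > 0\<close> by (simp add: field_simps)
      finally show "measure M (- K) \<le> d"
        using n by linarith
    qed
  qed
  note * = this
  define d where "d m = \<tau> * (1 / 2) ^ Suc m" for m
  have "d m > 0" for m
    using \<open>\<tau> > 0\<close> by (simp add: d_def)
  with * have "\<exists>C. closed C \<and> C \<subseteq> H \<and> continuous_on C (\<lambda>x. real (\<kappa> m x)) \<and> measure M (- C) \<le> d m" for m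
    by blast
  then obtain C where C: "\<And>m. closed (C m)" "\<And>m. C m \<subseteq> H" "\<And>m. continuous_on (C m) (\<lambda>x. real (\<kappa> m x))"
    "\<And>m. measure M (- C m) \<le> d m"
    by metis
  define K where "K = (\<Inter>m. C m)"
  have K: "closed K" "K \<subseteq> C m" for m
    using C(1) by (auto simp: K_def)
  then have "compact K"
    using compact_Int_closed[OF comp, of K] by simp
  moreover have "K \<subseteq> G"
    using K(2)[of 0] C(2)[of 0] H(1) by blast
  moreover have "measure M K \<ge> 1 - \<tau>"
  proof -
    have d_sums: "d sums \<tau>"
      using sums_mult[OF power_half_series, of \<tau>] by (simp only: d_def[abs_def] mult_1_right)
    have sm: "summable (\<lambda>m. measure M (- C m))"
      by (rule summable_comparison_test'[OF sums_summable[OF d_sums], of 0]) (use C(4) in auto)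
    have "1 - measure M K = measure M (\<Union>m. - C m)"
      using prob_compl[of K] K(1) by (simp add: K_def sets Compl_eq_Diff_UNIV)
    also have "\<dots> \<le> (\<Sum>m. measure M (- C m))"
      by (rule finite_measure_subadditive_countably[OF _ sm]) (use C(1) in \<open>auto simp: sets\<close>)
    also have "\<dots> \<le> \<tau>"
      using suminf_le[OF C(4) sm sums_summable[OF d_sums]] sums_unique[OF d_sums] by simp
    finally show ?thesis
      by simp
  qed
  moreover have "\<exists>\<delta>>0. \<forall>x\<in>K. \<forall>y\<in>K. dist x y \<le> \<delta> \<longrightarrow> \<kappa> m x = \<kappa> m y" for m
  proof -
    have "uniformly_continuous_on K (\<lambda>x. real (\<kappa> m x))"
      by (rule compact_uniformly_continuous[OF continuous_on_subset[OF C(3) K(2)] \<open>compact K\<close>])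
    \<comment> \<open>Natural numbers at distance less than 1 are equal, so uniform continuity of a
      code means that it is constant at small distances.\<close>
    then obtain \<delta> where \<delta>: "\<delta> > 0"
      "\<And>x y. x \<in> K \<Longrightarrow> y \<in> K \<Longrightarrow> dist y x < \<delta> \<Longrightarrow> dist (real (\<kappa> m y)) (real (\<kappa> m x)) < 1"
      unfolding uniformly_continuous_on_def by (metis zero_less_one)
    have const: "\<kappa> m x = \<kappa> m y" if "x \<in> K" "y \<in> K" "dist x y \<le> \<delta> / 2" for x y
      using \<delta>(2)[of y x] that \<delta>(1) by (auto simp: dist_real_def)
    show ?thesis
      by (intro exI[of _ "\<delta> / 2"] conjI ballI impI) (use \<delta>(1) in simp, (rule const; assumption))
  qed
  ultimately show ?thesis
    by (rule that)
qed

section \<open>The three implications\<close>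

locale ergodic_tds_folner =
  fixes \<nu> :: "'g::{topological_ab_group_add,t2_space} measure" and F :: "nat \<Rightarrow> 'g set"
    and \<mu> :: "'x::metric_space measure" and T :: "'g \<Rightarrow> 'x \<Rightarrow> 'x"
  assumes haar: "haar_measure \<nu>" and folner: "folner_sequence \<nu> F"
    and pointwise: "satisfies_pointwise_ergodic \<nu> F" and tds: "ergodic_tds \<mu> T"

sublocale ergodic_tds_folner \<subseteq> folner_ergodic \<mu> "\<lambda>n. uniform_measure \<nu> (F n)" T
  by (rule folner_ergodic_uniform_measure[OF haar folner pointwise tds])

context ergodic_tds_folner begin

abbreviation P where "P n \<equiv> uniform_measure \<nu> (F n)"

lemma sets_\<nu> [measurable_cong]: "sets \<nu> = sets borel"
  using haar by (simp add: haar_measure_def)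

lemma sets_\<mu>: "sets \<mu> = sets borel"
  using tds by (simp add: ergodic_tds_def)

lemma compact_phase_space: "compact (UNIV :: 'x set)"
  using tds by (simp add: ergodic_tds_def)

lemma folner_set: "F n \<in> sets \<nu>" "0 < emeasure \<nu> (F n)" "emeasure \<nu> (F n) < \<infinity>"
  using folner by (auto simp: folner_sequence_def)

lemma upper_density_eq:
  assumes "S \<in> sets \<nu>"
  shows "upper_density \<nu> F S = limsup (\<lambda>n. ereal (measure (P n) S))"
proof -
  have "measure (P n) S = measure \<nu> (S \<inter> F n) / measure \<nu> (F n)" for n
    using folner_set[of n] assms by (subst measure_uniform_measure) (auto simp: Int_commute)
  then show ?thesis
    by (simp add: upper_density_def)
qed

lemma d_fun_eq:
  assumes [measurable]: "f \<in> borel_measurable \<mu>"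
  shows "d_fun \<nu> F T f x y = limsup (\<lambda>n. ereal (sqrt (\<integral>j. (cmod (f (T j x) - f (T j y)))\<^sup>2 \<partial>P n)))"
proof -
  have "(\<lambda>j. (cmod (f (T j x) - f (T j y)))\<^sup>2) \<in> borel_measurable \<nu>"
    by measurable
  then show ?thesis
    by (simp add: d_fun_def folner_average_def integral_uniform_measure[OF folner_set])
qed

lemma generic_iff:
  fixes f :: "'x \<Rightarrow> real"
  assumes [measurable]: "f \<in> borel_measurable \<mu>"
  shows "generic \<nu> F \<mu> T f x \<longleftrightarrow>
    (\<forall>\<^sub>F n in sequentially. integrable (P n) (\<lambda>j. f (T j x))) \<and>
    (\<lambda>n. \<integral>j. f (T j x) \<partial>P n) \<longlonglongrightarrow> (\<integral>y. f y \<partial>\<mu>)"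
  by (rule generic_iff_uniform_measure[OF folner]) measurable

text \<open>Chebyshev's inequality bounds the density of the set where the difference exceeds
  \<open>e\<close> by \<open>d / e\<close>, which is less than \<open>e\<close> as
  \<open>d < e\<^sup>2\<close>.\<close>

lemma rho_fun_le:
  assumes [measurable]: "f \<in> borel_measurable \<mu>" and "e > 0" "d < e\<^sup>2"
    and ev: "\<forall>\<^sub>F n in sequentially. integrable (P n) (\<lambda>j. f (T j x) - f (T j y)) \<and>
      (\<integral>j. norm (f (T j x) - f (T j y)) \<partial>P n) \<le> d"
  shows "rho_fun \<nu> F T f x y \<le> e"
proof -
  define S where "S = {i. cmod (f (T i x) - f (T i y)) > e}"
  have S [measurable]: "S \<in> sets \<nu>"
  proof -
    have "{i \<in> space \<nu>. cmod (f (T i x) - f (T i y)) > e} \<in> sets \<nu>"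
      by measurable
    then show ?thesis
      using sets_eq_imp_space_eq[OF sets_\<nu>] by (simp add: S_def)
  qed
  have "\<forall>\<^sub>F n in sequentially. measure (P n) S \<le> d / e"
    using ev
  proof eventually_elim
    case (elim n)
    interpret Pn: prob_space "P n" by (rule prob_space_P)
    have "e * measure (P n) S = (\<integral>j. e * indicator S j \<partial>P n)"
      by simp
    also have "\<dots> \<le> (\<integral>j. norm (f (T j x) - f (T j y)) \<partial>P n)"
    proof (rule integral_mono)
      show "e * indicator S j \<le> norm (f (T j x) - f (T j y))" for j
        by (auto simp: S_def indicator_def)
      show "integrable (P n) (\<lambda>j. e * indicator S j)"
        using S by (intro integrable_mult_right integrable_real_indicator) (simp_all add: less_top[symmetric])
    qed (use elim in auto)
    finally show ?case
      using elim \<open>e > 0\<close> by (simp add: pos_le_divide_eq mult.commute)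
  qed
  then have "upper_density \<nu> F S \<le> ereal (d / e)"
    unfolding upper_density_eq[OF S] by (intro Limsup_bounded) (auto elim: eventually_mono)
  also have "\<dots> < ereal e"
    using \<open>e > 0\<close> \<open>d < e\<^sup>2\<close> by (simp add: pos_divide_less_eq power2_eq_square)
  finally have "upper_density \<nu> F S < ereal e" .
  then show ?thesis
    unfolding rho_fun_def using \<open>e > 0\<close>
    by (intro cInf_lower) (auto simp: S_def bdd_below_def intro: less_imp_le)
qed

lemma mean_equicontinuous_if_coded:
  assumes f [measurable]: "f \<in> borel_measurable \<mu>" and coded: "\<And>e. e > 0 \<Longrightarrow> coded f e"
  shows "mean_equicontinuous \<nu> F \<mu> T f"
  unfolding mean_equicontinuous_def
proof (intro allI impI)
  fix \<tau> :: real
  assume "\<tau> > 0"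
  define Q where "Q m \<kappa> G \<longleftrightarrow> \<kappa> \<in> \<mu> \<rightarrow>\<^sub>M count_space UNIV \<and> (AE x in \<mu>. x \<in> G) \<and>
    (\<forall>x\<in>G. \<forall>y\<in>G. \<kappa> x = \<kappa> y \<longrightarrow> (\<forall>\<^sub>F n in sequentially.
      integrable (P n) (\<lambda>j. f (T j x) - f (T j y)) \<and>
      (\<integral>j. norm (f (T j x) - f (T j y)) \<partial>P n) \<le> 1 / real (Suc m)))"
    for m and \<kappa> :: "'x \<Rightarrow> nat" and G
  have "\<exists>\<kappa> G. Q m \<kappa> G" for m
    using coded[of "1 / real (Suc m)"] by (simp add: coded_def Q_def)
  then obtain \<kappa> G where Q: "\<And>m. Q m (\<kappa> m) (G m)"
    by metis
  have \<kappa>: "\<kappa> m \<in> \<mu> \<rightarrow>\<^sub>M count_space UNIV" and G: "AE x in \<mu>. x \<in> G m"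
    and close: "\<forall>x\<in>G m. \<forall>y\<in>G m. \<kappa> m x = \<kappa> m y \<longrightarrow> (\<forall>\<^sub>F n in sequentially.
      integrable (P n) (\<lambda>j. f (T j x) - f (T j y)) \<and>
      (\<integral>j. norm (f (T j x) - f (T j y)) \<partial>P n) \<le> 1 / real (Suc m))" for m
    using Q[of m] by (simp_all add: Q_def)
  have "AE x in \<mu>. x \<in> (\<Inter>m. G m)"
    using G by (simp add: AE_all_countable)
  then obtain K where K: "compact K" "K \<subseteq> (\<Inter>m. G m)" "measure \<mu> K \<ge> 1 - \<tau>"
    and const: "\<And>m. \<exists>\<delta>>0. \<forall>x\<in>K. \<forall>y\<in>K. dist x y \<le> \<delta> \<longrightarrow> \<kappa> m x = \<kappa> m y"
    by (rule ex_compact_uniformly_constant[where \<kappa> = \<kappa>, OF prob_space_axioms compact_phase_space sets_\<mu> \<kappa> _ \<open>\<tau> > 0\<close>]) (rule that)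
  have "\<exists>\<delta>>0. \<forall>x\<in>K. \<forall>y\<in>K. dist x y \<le> \<delta> \<longrightarrow> rho_fun \<nu> F T f x y \<le> e" if "e > 0" for e
  proof -
    obtain m where m: "1 / real (Suc m) < e\<^sup>2"
      using nat_approx_posE[of "e\<^sup>2"] \<open>e > 0\<close> by auto
    obtain \<delta> where \<delta>: "\<delta> > 0" "\<forall>x\<in>K. \<forall>y\<in>K. dist x y \<le> \<delta> \<longrightarrow> \<kappa> m x = \<kappa> m y"
      using const by blast
    have "rho_fun \<nu> F T f x y \<le> e" if "x \<in> K" "y \<in> K" "dist x y \<le> \<delta>" for x y
    proof (rule rho_fun_le[OF f \<open>e > 0\<close> m])
      have "x \<in> G m" "y \<in> G m" "\<kappa> m x = \<kappa> m y"
        using that K(2) \<delta>(2) by auto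
      then show "\<forall>\<^sub>F n in sequentially. integrable (P n) (\<lambda>j. f (T j x) - f (T j y)) \<and>
          (\<integral>j. norm (f (T j x) - f (T j y)) \<partial>P n) \<le> 1 / real (Suc m)"
        using close[of m] by blast
    qed
    then show ?thesis
      using \<delta>(1) by blast
  qed
  then show "\<exists>K. compact K \<and> measure \<mu> K \<ge> 1 - \<tau> \<and>
      (\<forall>e>0. \<exists>\<delta>>0. \<forall>x\<in>K. \<forall>y\<in>K. dist x y \<le> \<delta> \<longrightarrow> rho_fun \<nu> F T f x y \<le> e)"
    using K(1,3) by blast
qed

lemma eventually_measure_less_if_rho_fun_less:
  assumes [measurable]: "f \<in> borel_measurable \<mu>" and "rho_fun \<nu> F T f x y < e"
  shows "\<forall>\<^sub>F n in sequentially. measure (P n) {i. cmod (f (T i x) - f (T i y)) > e} < e"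
proof -
  have S: "{i. cmod (f (T i x) - f (T i y)) > d} \<in> sets \<nu>" for d
  proof -
    have "{i \<in> space \<nu>. cmod (f (T i x) - f (T i y)) > d} \<in> sets \<nu>"
      by measurable
    then show ?thesis
      using sets_eq_imp_space_eq[OF sets_\<nu>] by simp
  qed
  let ?X = "{d. d > 0 \<and> upper_density \<nu> F {i. cmod (f (T i x) - f (T i y)) > d} < ereal d}"
  \<comment> \<open>Densities never exceed 1, so 2 belongs to the set whose infimum is
    \<open>rho_fun\<close>. Nonemptiness is what allows an element below \<open>e\<close> to be
    extracted.\<close>
  have "upper_density \<nu> F {i. cmod (f (T i x) - f (T i y)) > 2} \<le> ereal 1"
    unfolding upper_density_eq[OF S]
    by (rule Limsup_bounded) (simp add: prob_space.prob_le_1[OF prob_space_P])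
  also have "\<dots> < ereal 2"
    by simp
  finally have "2 \<in> ?X"
    by simp
  then have "?X \<noteq> {}"
    by blast
  moreover have "Inf ?X < e"
    using assms(2) by (simp add: rho_fun_def)
  ultimately obtain d where d: "d > 0" "d < e"
    "upper_density \<nu> F {i. cmod (f (T i x) - f (T i y)) > d} < ereal d"
    using cInf_lessD[of ?X e] by auto
  have "\<forall>\<^sub>F n in sequentially. ereal (measure (P n) {i. cmod (f (T i x) - f (T i y)) > d}) < ereal d"
    using d(3) unfolding upper_density_eq[OF S] by (rule Limsup_lessD)
  then show ?thesis
  proof eventually_elim
    case (elim n)
    interpret Pn: prob_space "P n" by (rule prob_space_P)
    have "measure (P n) {i. cmod (f (T i x) - f (T i y)) > e} \<le> measure (P n) {i. cmod (f (T i x) - f (T i y)) > d}"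
      using d(2) S[of d] by (intro Pn.finite_measure_mono) auto
    then show ?case
      using elim d(2) by simp
  qed
qed

text \<open>Inside the compact set there is a set of positive measure with diameter at most
  \<delta>, consisting of points where the tails of \<open>f\<close> have small averages. No two of
  its points are more than \<open>e\<close> apart for \<open>d_fun\<close>.\<close>

lemma not_mean_sensitive_if_mean_equicontinuous:
  assumes fL: "f \<in> L2_fun \<mu>" and me: "mean_equicontinuous \<nu> F \<mu> T f"
  shows "\<not> mean_sensitive \<nu> F \<mu> T f"
proof
  have f [measurable]: "f \<in> borel_measurable \<mu>" and int: "integrable \<mu> (\<lambda>x. (cmod (f x))\<^sup>2)"
    using fL by (auto simp: L2_fun_def)
  assume "mean_sensitive \<nu> F \<mu> T f"
  then obtain e :: real where "e > 0"
    and ms: "\<And>A. A \<in> sets \<mu> \<Longrightarrow> measure \<mu> A > 0 \<Longrightarrow> \<exists>x\<in>A. \<exists>y\<in>A. d_fun \<nu> F T f x y > ereal e"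
    unfolding mean_sensitive_def by blast
  define h where "h N x = (if (cmod (f x))\<^sup>2 > real N then (cmod (f x))\<^sup>2 else 0)" for N :: nat and x
  have [measurable]: "h N \<in> borel_measurable \<mu>" for N
    unfolding h_def by measurable
  have h_int: "integrable \<mu> (h N)" for N
    by (rule Bochner_Integration.integrable_bound[OF int]) (auto simp: h_def)
  have "(\<lambda>N. \<integral>x. h N x \<partial>\<mu>) \<longlonglongrightarrow> (\<integral>x. 0 \<partial>\<mu>)"
  proof (rule integral_dominated_convergence[where w = "\<lambda>x. (cmod (f x))\<^sup>2"])
    show "AE x in \<mu>. (\<lambda>N. h N x) \<longlonglongrightarrow> 0"
    proof (rule AE_I2)
      fix x
      obtain N0 where "(cmod (f x))\<^sup>2 \<le> real N0"
        using real_arch_simple by blast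
      then have "h N x = 0" if "N \<ge> N0" for N
        using that by (auto simp: h_def)
      then show "(\<lambda>N. h N x) \<longlonglongrightarrow> 0"
        by (intro tendsto_eventually eventually_sequentiallyI[of N0])
    qed
    show "AE x in \<mu>. norm (h N x) \<le> (cmod (f x))\<^sup>2" for N
      by (auto simp: h_def)
  qed (use int in auto)
  then have "\<forall>\<^sub>F N in sequentially. (\<integral>x. h N x \<partial>\<mu>) < e\<^sup>2 / 16"
    by (rule order_tendstoD) (use \<open>e > 0\<close> in simp)
  then obtain N where N: "(\<integral>x. h N x \<partial>\<mu>) < e\<^sup>2 / 16"
    by (auto simp: eventually_sequentially)
  \<comment> \<open>As \<eta> is at most 1, its square is at most \<eta>, so the bounded part of the
    mean square contributes at most \<open>e\<^sup>2 / 4\<close>. The tails of the two points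
    contribute \<open>2 * (e\<^sup>2 / 16)\<close> each, and the total stays below
    \<open>e\<^sup>2\<close>.\<close>
  define \<eta> where "\<eta> = min 1 (e\<^sup>2 / 4 / (1 + 4 * real N))"
  have \<eta>: "\<eta> > 0" "\<eta> \<le> 1"
    using \<open>e > 0\<close> by (auto simp: \<eta>_def)
  have \<eta>e: "\<eta>\<^sup>2 + 4 * real N * \<eta> \<le> e\<^sup>2 / 4"
  proof -
    have "\<eta>\<^sup>2 \<le> \<eta>"
      using \<eta> by (simp add: power2_eq_square mult_left_le)
    moreover have "\<eta> * (1 + 4 * real N) \<le> e\<^sup>2 / 4"
    proof (subst pos_le_divide_eq[symmetric])
      show "\<eta> \<le> e\<^sup>2 / 4 / (1 + 4 * real N)"
        by (simp only: \<eta>_def min.cobounded2)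
    qed (simp add: add_pos_nonneg)
    moreover have "\<eta> * (1 + 4 * real N) = \<eta> + 4 * real N * \<eta>"
      by (simp add: distrib_left)
    ultimately show ?thesis
      by linarith
  qed
  \<comment> \<open>Smallness in density controls the mean square only for bounded functions; \<open>h N\<close> is the unbounded part.\<close>
  have split: "(cmod (f u - f v))\<^sup>2 \<le>
      \<eta>\<^sup>2 + 4 * real N * (if cmod (f u - f v) > \<eta> then 1 else 0) + 2 * h N u + 2 * h N v" for u v
  proof (cases "cmod (f u - f v) > \<eta>")
    case True
    have "(cmod (f w))\<^sup>2 \<le> real N + h N w" for w
      by (auto simp: h_def)
    from this[of u] this[of v] have "(cmod (f u - f v))\<^sup>2 \<le> \<eta>\<^sup>2 + 4 * real N + 2 * h N u + 2 * h N v"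
      using norm_diff_square_le[of "f u" "f v"] zero_le_power2[of \<eta>] by linarith
    then show ?thesis
      using True by simp
  next
    case False
    then have "(cmod (f u - f v))\<^sup>2 \<le> \<eta>\<^sup>2"
      by (intro power_mono) auto
    then show ?thesis
      using False by (simp add: h_def)
  qed
  obtain K where K: "compact K" "measure \<mu> K \<ge> 1 / 2"
    and equi: "\<And>d. d > 0 \<Longrightarrow> \<exists>\<delta>>0. \<forall>x\<in>K. \<forall>y\<in>K. dist x y \<le> \<delta> \<longrightarrow> rho_fun \<nu> F T f x y \<le> d"
    using me unfolding mean_equicontinuous_def by (metis field_sum_of_halves add_diff_cancel half_gt_zero_iff zero_less_one)
  obtain \<delta> where \<delta>: "\<delta> > 0" "\<forall>x\<in>K. \<forall>y\<in>K. dist x y \<le> \<delta> \<longrightarrow> rho_fun \<nu> F T f x y \<le> \<eta> / 2"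
    using equi[of "\<eta> / 2"] \<eta> by auto
  \<comment> \<open>Mean sensitivity offers no control over which points it picks from a given set,
    so the exceptional points for \<open>h N\<close> are removed beforehand.\<close>
  obtain Z where Z: "{x \<in> space \<mu>. \<not> ((\<forall>\<^sub>F n in sequentially. integrable (P n) (\<lambda>j. h N (T j x))) \<and>
      (\<lambda>n. \<integral>j. h N (T j x) \<partial>P n) \<longlonglongrightarrow> (\<integral>y. h N y \<partial>\<mu>))} \<subseteq> Z" "emeasure \<mu> Z = 0" "Z \<in> sets \<mu>"
    using AE_E[OF pointwise_ergodic[OF h_int[of N]]] by blast
  have K_sets: "K \<in> sets \<mu>"
    using compact_imp_closed[OF K(1)] by (simp add: sets_\<mu>)
  obtain C :: "'x set" where C: "finite C" "UNIV \<subseteq> (\<Union>x\<in>C. ball x (\<delta> / 2))"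
    using seq_compact_imp_totally_bounded[OF compact_imp_seq_compact[OF compact_phase_space], rule_format, of "\<delta> / 2"] \<delta>(1)
    by auto
  \<comment> \<open>Finitely many balls cover the space and \<open>K - Z\<close> has positive
    measure, so one of these pieces has positive measure too.\<close>
  define A where "A c = (K - Z) \<inter> ball c (\<delta> / 2)" for c
  have A_sets: "A c \<in> sets \<mu>" for c
    using K_sets Z(3) by (simp add: A_def sets_\<mu>)
  have "\<exists>c\<in>C. measure \<mu> (A c) > 0"
  proof (rule ccontr)
    assume "\<not> ?thesis"
    then have "measure \<mu> (A c) = 0" if "c \<in> C" for c
      using that zero_less_measure_iff[of \<mu> "A c"] by auto
    then have "(\<Sum>c\<in>C. measure \<mu> (A c)) = 0"
      by simp
    moreover have "measure \<mu> (\<Union>c\<in>C. A c) \<le> (\<Sum>c\<in>C. measure \<mu> (A c))"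
      using C(1) A_sets by (intro finite_measure_subadditive_finite) auto
    moreover have "K \<subseteq> (\<Union>c\<in>C. A c) \<union> Z"
      using C(2) by (auto simp: A_def)
    then have "measure \<mu> K \<le> measure \<mu> ((\<Union>c\<in>C. A c) \<union> Z)"
      using C(1) A_sets Z(3) by (intro finite_measure_mono sets.Un sets.finite_UN) auto
    moreover have "measure \<mu> ((\<Union>c\<in>C. A c) \<union> Z) \<le> measure \<mu> (\<Union>c\<in>C. A c) + measure \<mu> Z"
      using C(1) A_sets Z(3) by (intro measure_Un_le sets.finite_UN) auto
    moreover have "measure \<mu> Z = 0"
      using Z(2) by (simp add: measure_def)
    ultimately show False
      using K(2) by linarith
  qed
  then obtain c where c: "measure \<mu> (A c) > 0"
    by blast
  obtain x y where xy: "x \<in> A c" "y \<in> A c" and far: "d_fun \<nu> F T f x y > ereal e"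
    using ms[OF A_sets c] by blast
  have "dist x y \<le> \<delta>"
    using xy dist_triangle3[of x y c] by (simp add: A_def)
  then have "rho_fun \<nu> F T f x y < \<eta>"
    using \<delta>(2) xy \<eta> by (fastforce simp: A_def)
  from eventually_measure_less_if_rho_fun_less[OF f this]
  have ev: "\<forall>\<^sub>F n in sequentially. measure (P n) {i. cmod (f (T i x) - f (T i y)) > \<eta>} < \<eta>" .
  have h_ev: "\<forall>\<^sub>F n in sequentially. integrable (P n) (\<lambda>j. h N (T j z)) \<and> (\<integral>j. h N (T j z) \<partial>P n) < e\<^sup>2 / 16"
    if "z \<in> A c" for z
  proof -
    have "(\<forall>\<^sub>F n in sequentially. integrable (P n) (\<lambda>j. h N (T j z))) \<and>
      (\<lambda>n. \<integral>j. h N (T j z) \<partial>P n) \<longlonglongrightarrow> (\<integral>y. h N y \<partial>\<mu>)"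
      using that Z(1) by (auto simp: A_def)
    from conjunct1[OF this] order_tendstoD(2)[OF conjunct2[OF this] N] show ?thesis
      by (rule eventually_conj)
  qed
  have "\<forall>\<^sub>F n in sequentially. ereal (sqrt (\<integral>j. (cmod (f (T j x) - f (T j y)))\<^sup>2 \<partial>P n)) \<le> ereal e"
    using ev h_ev[OF xy(1)] h_ev[OF xy(2)]
  proof eventually_elim
    case (elim n)
    interpret Pn: prob_space "P n" by (rule prob_space_P)
    define S where "S = {i. cmod (f (T i x) - f (T i y)) > \<eta>}"
    have S [measurable]: "S \<in> sets (P n)"
    proof -
      have "{i \<in> space (P n). cmod (f (T i x) - f (T i y)) > \<eta>} \<in> sets (P n)"
        by measurable
      then show ?thesis
        by (simp add: S_def)
    qed
    have S_int: "integrable (P n) (indicator S :: _ \<Rightarrow> real)"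
      using S by (intro integrable_real_indicator) (simp_all add: less_top[symmetric])
    have "(\<integral>j. (cmod (f (T j x) - f (T j y)))\<^sup>2 \<partial>P n) \<le>
        (\<integral>j. \<eta>\<^sup>2 + 4 * real N * indicator S j + 2 * h N (T j x) + 2 * h N (T j y) \<partial>P n)"
    proof (rule integral_mono')
      show "integrable (P n) (\<lambda>j. \<eta>\<^sup>2 + 4 * real N * indicator S j + 2 * h N (T j x) + 2 * h N (T j y))"
        using S_int elim by auto
      show le: "(cmod (f (T j x) - f (T j y)))\<^sup>2 \<le> \<eta>\<^sup>2 + 4 * real N * indicator S j + 2 * h N (T j x) + 2 * h N (T j y)" for j
        using split[of "T j x" "T j y"]
        by (cases "cmod (f (T j x) - f (T j y)) > \<eta>") (simp_all add: S_def)
      show "0 \<le> \<eta>\<^sup>2 + 4 * real N * indicator S j + 2 * h N (T j x) + 2 * h N (T j y)" for j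
        by (rule order_trans[OF zero_le_power2 le])
    qed
    also have "\<dots> = \<eta>\<^sup>2 + 4 * real N * measure (P n) S + 2 * (\<integral>j. h N (T j x) \<partial>P n) + 2 * (\<integral>j. h N (T j y) \<partial>P n)"
      using S_int elim Pn.prob_space S by simp
    also have "\<dots> \<le> \<eta>\<^sup>2 + 4 * real N * \<eta> + 2 * (e\<^sup>2 / 16) + 2 * (e\<^sup>2 / 16)"
      using elim by (intro add_mono mult_left_mono) (auto simp: S_def)
    also have "\<dots> \<le> e\<^sup>2"
      using \<eta>e zero_le_power2[of e] by linarith
    finally show ?case
      using \<open>e > 0\<close> by (simp add: real_le_lsqrt)
  qed
  then have "d_fun \<nu> F T f x y \<le> ereal e"
    unfolding d_fun_eq[OF f] by (rule Limsup_bounded)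
  with far show False
    by simp
qed

lemma totally_bounded_orbit_if_not_mean_sensitive:
  assumes fL: "f \<in> L2_fun \<mu>" and ms: "\<not> mean_sensitive \<nu> F \<mu> T f"
  shows "totally_bounded_orbit \<mu> T 2 f"
proof -
  have f [measurable]: "f \<in> borel_measurable \<mu>" and int: "integrable \<mu> (\<lambda>x. (cmod (f x))\<^sup>2)"
    using fL by (auto simp: L2_fun_def)
  let ?g = "generic \<nu> F \<mu> T (\<lambda>z. (cmod (f z))\<^sup>2)"
  show ?thesis
  proof (rule totally_bounded_orbit_if_close_sets[OF f int, of "Collect ?g"])
    have "(\<lambda>z. (cmod (f z))\<^sup>2) \<in> borel_measurable \<mu>"
      by measurable
    then show "AE x in \<mu>. x \<in> Collect ?g"
      using pointwise_ergodic[OF int] by (simp add: generic_iff)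
    fix e :: real
    assume "e > 0"
    then have "\<not> (\<forall>A\<in>sets \<mu>. measure \<mu> A > 0 \<longrightarrow>
        (\<exists>x\<in>A. \<exists>y\<in>A. ?g x \<and> ?g y \<and> d_fun \<nu> F T f x y > ereal e))"
      using ms unfolding mean_sensitive_def not_ex de_Morgan_conj by simp
    then obtain A where A: "A \<in> sets \<mu>" "measure \<mu> A > 0"
      and close: "\<not> (\<exists>x\<in>A. \<exists>y\<in>A. ?g x \<and> ?g y \<and> d_fun \<nu> F T f x y > ereal e)"
      by blast
    show "\<exists>A\<in>sets \<mu>. measure \<mu> A > 0 \<and> (\<forall>x\<in>A. \<forall>y\<in>A. x \<in> Collect ?g \<longrightarrow> y \<in> Collect ?g \<longrightarrow>
        limsup (\<lambda>n. ereal (sqrt (\<integral>j. (norm (f (T j x) - f (T j y)))\<^sup>2 \<partial>P n))) \<le> ereal e)"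
    proof (intro bexI[of _ A] conjI ballI impI A)
      fix x y
      assume "x \<in> A" "y \<in> A" "x \<in> Collect ?g" "y \<in> Collect ?g"
      then have "\<not> d_fun \<nu> F T f x y > ereal e"
        using close by blast
      then show "limsup (\<lambda>n. ereal (sqrt (\<integral>j. (norm (f (T j x) - f (T j y)))\<^sup>2 \<partial>P n))) \<le> ereal e"
        by (simp add: d_fun_eq not_less)
    qed
  qed
qed

end

theorem corollary3p8:
  fixes \<nu> :: "'g::{topological_ab_group_add,t2_space} measure"
    and F :: "nat \<Rightarrow> 'g set"
    and \<mu> :: "'x::metric_space measure"
    and T :: "'g \<Rightarrow> 'x \<Rightarrow> 'x"
  assumes "locally_compact_space (euclidean :: 'g topology)"
    and "haar_measure \<nu>"
    and "folner_sequence \<nu> F"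
    and "satisfies_pointwise_ergodic \<nu> F"
    and "ergodic_tds \<mu> T"
  shows "H_ap \<mu> T = L2_fun \<mu> - H_ms \<nu> F \<mu> T \<and> L2_fun \<mu> - H_ms \<nu> F \<mu> T = H_me \<nu> F \<mu> T"
proof -
  interpret ergodic_tds_folner \<nu> F \<mu> T
    using assms by unfold_locales
  have ap_me: "mean_equicontinuous \<nu> F \<mu> T f" if f: "f \<in> L2_fun \<mu>" and ap: "almost_periodic \<mu> T f" for f
  proof (rule mean_equicontinuous_if_coded)
    have "totally_bounded_orbit \<mu> T 2 f"
      using ap almost_periodic_iff_totally_bounded_orbit[OF f] by simp
    then show "coded f e" if "e > 0" for e
      using f that by (intro coded_of_totally_bounded_orbit) (auto simp: L2_fun_def)
  qed (use f in \<open>simp add: L2_fun_def\<close>)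
  have me_ms: "\<not> mean_sensitive \<nu> F \<mu> T f" if "f \<in> L2_fun \<mu>" "mean_equicontinuous \<nu> F \<mu> T f" for f
    using that by (rule not_mean_sensitive_if_mean_equicontinuous)
  have ms_ap: "almost_periodic \<mu> T f" if "f \<in> L2_fun \<mu>" "\<not> mean_sensitive \<nu> F \<mu> T f" for f
    using that totally_bounded_orbit_if_not_mean_sensitive almost_periodic_iff_totally_bounded_orbit by blast
  show ?thesis
    unfolding H_ap_def H_ms_def H_me_def using ap_me me_ms ms_ap by blast
qed

end
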